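(* Let $E$ and $F$ be two Banach lattices such that the norm dual $F'$ is order continuous. The following statements are equivalent: (1) Every regular operator $T : E \to F$ whose adjoint $T' : F' \to E'$ is Lwcc is itself Lwcc. (2) At least one of the following conditions holds: (a) $F$ is order continuous; (b) $E^{a}$ is discrete.
   Context: Operators are bounded linear maps. For a Banach lattice $E$, $E'$ denotes its norm dual, which is a Banach lattice. An operator $T : E \to F$ between Banach lattices is positive if it maps the positive cone of $E$ into that of $F$, and regular if it is the difference of two positive operators. The adjoint of $T : E\to F$ is $T' : F' \to E'$, $T'(f) = f\circ T$. A Banach lattice is called order continuous if its norm is order continuous, i.e. $\|x_\alpha\| \to 0$ for every net $x_\alpha \downarrow 0$. $E^{a}$ denotes the order continuous part of $E$, i.e. the largest closed order ideal of $E$ on which the norm is order continuous; equivalently, $E^{a}$ is the set of all $x\in E$ such that every monotone sequence in $[0,|x|]$ is norm convergent. In a vector lattice, an element $x > 0$ is discrete (an atom) if the order ideal generated by $x$ equals the linear span of $x$. A vector lattice is discrete if it admits a complete disjoint system of discrete elements, i.e. there is a family of pairwise disjoint discrete elements such that the only element disjoint from all of them is $0$ (the zero lattice is discrete, with the empty family). A nonempty bounded subset $A$ of a Banach lattice $E$ is L-weakly compact if $\|x_n\|\to 0$ for every disjoint sequence $(x_n)$ contained in the solid hull of $A$; a sequence is L-weakly compact if its set of terms is. An operator $T : E \to F$ between Banach lattices is Lwcc if $\|T(x_n)\| \to 0$ for every weakly null sequence $(x_n)$ of $E$ that is L-weakly compact (equivalently, $T$ maps L-weakly compact subsets of $E$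 to relatively norm compact subsets of $F$). *)

theory Defs
  imports "HOL-Analysis.Analysis" "HOL-Library.Lattice_Algebras"
begin

section \<open>Banach lattices\<close>

class banach_lattice = banach + ordered_real_vector + lattice_ab_group_add_abs +
  assumes norm_mono_abs: "\<bar>x\<bar> \<le> \<bar>y\<bar> \<Longrightarrow> norm x \<le> norm y"

lemma norm_abs_banach_lattice [simp]: "norm \<bar>x :: 'a::banach_lattice\<bar> = norm x"
  by (simp add: norm_mono_abs order.antisym)

lemma norm_mono_pos:
  fixes x y :: "'a::banach_lattice"
  assumes "0 \<le> x" "x \<le> y"
  shows "norm x \<le> norm y"
  using assms by (intro norm_mono_abs) simp

lemma norm_pprt_le: "norm (pprt x) \<le> norm (x :: 'a::banach_lattice)"
proof (rule norm_mono_abs)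
  show "\<bar>pprt x\<bar> \<le> \<bar>x\<bar>"
    by (simp add: pprt_def abs_ge_self)
qed

lemma norm_pprt_uminus_le: "norm (pprt (- x)) \<le> norm (x :: 'a::banach_lattice)"
  using norm_pprt_le[of "- x"] by simp

lemma pprt_diff: "pprt x - pprt (- x) = (x :: 'a::lattice_ab_group_add)"
  using prts[of x] by (simp add: pprt_neg)

instance real :: banach_lattice
  by standard (auto simp: abs_real_def sup_real_def)


section \<open>The norm dual\<close>

text \<open>
  The order of the dual exists only for scalar-valued maps, so it cannot be put on the type of
  all bounded linear maps; hence a copy of the functionals as a type of its own.
\<close>

typedef (overloaded) 'a dual = "UNIV :: ('a::real_normed_vector \<Rightarrow>\<^sub>L real) set"
  morphisms blinfun_of_dual Dual ..

setup_lifting type_definition_dual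

lift_definition dual_apply :: "'a::real_normed_vector dual \<Rightarrow> 'a \<Rightarrow> real"
  is blinfun_apply .

lemma dual_eqI: "(\<And>x. dual_apply f x = dual_apply g x) \<Longrightarrow> f = g"
  by transfer (rule blinfun_eqI)

lemma bounded_linear_dual_apply: "bounded_linear (dual_apply f)"
  by transfer (rule blinfun.bounded_linear_right)

lemma dual_apply_zero_right: "dual_apply f 0 = 0"
  and dual_apply_add_right: "dual_apply f (x + y) = dual_apply f x + dual_apply f y"
  and dual_apply_diff_right: "dual_apply f (x - y) = dual_apply f x - dual_apply f y"
  and dual_apply_scaleR_right: "dual_apply f (r *\<^sub>R x) = r * dual_apply f x"
  by (transfer; simp add: blinfun.bilinear_simps)+

instantiation dual :: (real_normed_vector) real_normed_vector
begin

lift_definition zero_dual :: "'a dual" is 0 .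
lift_definition plus_dual :: "'a dual \<Rightarrow> 'a dual \<Rightarrow> 'a dual" is "(+)" .
lift_definition minus_dual :: "'a dual \<Rightarrow> 'a dual \<Rightarrow> 'a dual" is "(-)" .
lift_definition uminus_dual :: "'a dual \<Rightarrow> 'a dual" is uminus .
lift_definition scaleR_dual :: "real \<Rightarrow> 'a dual \<Rightarrow> 'a dual" is scaleR .
lift_definition norm_dual :: "'a dual \<Rightarrow> real" is norm .
definition sgn_dual :: "'a dual \<Rightarrow> 'a dual" where "sgn_dual f = scaleR (inverse (norm f)) f"
definition dist_dual :: "'a dual \<Rightarrow> 'a dual \<Rightarrow> real" where "dist_dual f g = norm (f - g)"
definition [code del]:
  "(uniformity :: ('a dual \<times> 'a dual) filter) =
     (INF e\<in>{0<..}. principal {(f, g). dist f g < e})"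
definition open_dual :: "'a dual set \<Rightarrow> bool" where [code del]:
  "open_dual S = (\<forall>f\<in>S. \<forall>\<^sub>F (f', g) in uniformity. f' = f \<longrightarrow> g \<in> S)"

instance
proof
  fix a b :: real and f g h :: "'a dual" and S :: "'a dual set"
  show "f + g + h = f + (g + h)" "f + g = g + f" "0 + f = f" "- f + f = 0" "f - g = f + - g"
    by (transfer; simp)+
  show "a *\<^sub>R (f + g) = a *\<^sub>R f + a *\<^sub>R g" "(a + b) *\<^sub>R f = a *\<^sub>R f + b *\<^sub>R f"
    "a *\<^sub>R b *\<^sub>R f = (a * b) *\<^sub>R f" "1 *\<^sub>R f = f"
    by (transfer; simp add: algebra_simps)+
  show "(norm f = 0) = (f = 0)" "norm (f + g) \<le> norm f + norm g"
    "norm (a *\<^sub>R f) = \<bar>a\<bar> * norm f"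
    by (transfer; simp add: norm_triangle_ineq)+
qed (fact sgn_dual_def dist_dual_def uniformity_dual_def open_dual_def)+

end

lemma dual_apply_zero [simp]: "dual_apply 0 x = 0"
  and dual_apply_add: "dual_apply (f + g) x = dual_apply f x + dual_apply g x"
  and dual_apply_diff: "dual_apply (f - g) x = dual_apply f x - dual_apply g x"
  and dual_apply_minus: "dual_apply (- f) x = - dual_apply f x"
  and dual_apply_scaleR: "dual_apply (a *\<^sub>R f) x = a * dual_apply f x"
  by (transfer; simp add: blinfun.bilinear_simps)+

lemma norm_dual_apply: "\<bar>dual_apply f x\<bar> \<le> norm f * norm x"
  by transfer (metis norm_blinfun real_norm_def)

lemma norm_dual_bound:
  assumes "0 \<le> b" "\<And>x. \<bar>dual_apply f x\<bar> \<le> b * norm x"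
  shows "norm f \<le> b"
  using assms by transfer (auto intro: norm_blinfun_bound)

instance dual :: (real_normed_vector) banach
proof
  fix X :: "nat \<Rightarrow> 'a dual"
  assume X: "Cauchy X"
  have dist: "dist (blinfun_of_dual f) (blinfun_of_dual g) = dist f g" for f g :: "'a dual"
    unfolding dist_norm by transfer simp
  have "Cauchy (\<lambda>n. blinfun_of_dual (X n))"
    using X by (simp add: Cauchy_def dist)
  then obtain L where "(\<lambda>n. blinfun_of_dual (X n)) \<longlonglongrightarrow> L"
    by (auto simp: convergent_eq_Cauchy[symmetric] Cauchy_convergent_iff convergent_def)
  then have "(\<lambda>n. blinfun_of_dual (X n)) \<longlonglongrightarrow> blinfun_of_dual (Dual L)"
    by (simp add: Dual_inverse)
  then have "X \<longlonglongrightarrow> Dual L"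
    unfolding tendsto_iff dist .
  then show "convergent X"
    by (auto simp: convergent_def)
qed

text \<open>
  The Riesz--Kantorovich formula: for \<open>x \<ge> 0\<close>, the positive part of \<open>f\<close> at \<open>x\<close> is the supremum
  of \<open>f\<close> over the order interval from \<open>0\<close> to \<open>x\<close>.
\<close>

definition dual_sup :: "'a::banach_lattice dual \<Rightarrow> 'a \<Rightarrow> real"
  where "dual_sup f x = (SUP y\<in>{0..x}. dual_apply f y)"

lemma dual_apply_interval_le:
  fixes f :: "'a::banach_lattice dual"
  assumes "0 \<le> y" "y \<le> x"
  shows "dual_apply f y \<le> norm f * norm x"
proof -
  have "dual_apply f y \<le> norm f * norm y"
    using norm_dual_apply[of f y] by linarith
  also have "\<dots> \<le> norm f * norm x"
    using assms by (intro mult_left_mono norm_mono_pos) auto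
  finally show ?thesis .
qed

lemma dual_sup_upper:
  fixes f :: "'a::banach_lattice dual"
  assumes "0 \<le> y" "y \<le> x"
  shows "dual_apply f y \<le> dual_sup f x"
  unfolding dual_sup_def
  by (rule cSUP_upper) (use assms in \<open>auto intro!: bdd_aboveI2 dual_apply_interval_le\<close>)

lemma dual_sup_least:
  fixes f :: "'a::banach_lattice dual"
  assumes "0 \<le> x" "\<And>y. 0 \<le> y \<Longrightarrow> y \<le> x \<Longrightarrow> dual_apply f y \<le> b"
  shows "dual_sup f x \<le> b"
  unfolding dual_sup_def by (rule cSUP_least) (use assms in auto)

lemma dual_sup_nonneg: "0 \<le> x \<Longrightarrow> 0 \<le> dual_sup f x"
  using dual_sup_upper[of 0 x f] by (simp add: dual_apply_zero_right)

lemma dual_sup_add: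
  fixes f :: "'a::banach_lattice dual"
  assumes x: "0 \<le> x" and z: "0 \<le> z"
  shows "dual_sup f (x + z) = dual_sup f x + dual_sup f z"
proof (rule antisym)
  show "dual_sup f (x + z) \<le> dual_sup f x + dual_sup f z"
  proof (rule dual_sup_least)
    fix y assume y: "0 \<le> y" "y \<le> x + z"
    have eq: "y - inf y x = sup 0 (y - x)"
      by (simp add: add_sup_distrib_left)
    have "y - inf y x \<le> z"
      unfolding eq using y z by (simp add: diff_le_eq add.commute)
    then have "dual_apply f (inf y x) + dual_apply f (y - inf y x) \<le> dual_sup f x + dual_sup f z"
      using x y by (intro add_mono dual_sup_upper) (auto simp del: diff_inf_eq_sup)
    then show "dual_apply f y \<le> dual_sup f x + dual_sup f z"
      by (simp add: dual_apply_diff_right del: diff_inf_eq_sup)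
  qed (use x z in auto)
next
  have "dual_sup f x \<le> dual_sup f (x + z) - dual_sup f z"
  proof (rule dual_sup_least[OF x])
    fix y assume y: "0 \<le> y" "y \<le> x"
    have "dual_sup f z \<le> dual_sup f (x + z) - dual_apply f y"
    proof (rule dual_sup_least[OF z])
      fix w assume w: "0 \<le> w" "w \<le> z"
      have "dual_apply f (y + w) \<le> dual_sup f (x + z)"
        using y w by (intro dual_sup_upper add_mono) auto
      then show "dual_apply f w \<le> dual_sup f (x + z) - dual_apply f y"
        by (simp add: dual_apply_add_right)
    qed
    then show "dual_apply f y \<le> dual_sup f (x + z) - dual_sup f z"
      by simp
  qed
  then show "dual_sup f x + dual_sup f z \<le> dual_sup f (x + z)"
    by simp
qed

lemma dual_sup_scaleR:
  fixes f :: "'a::banach_lattice dual"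
  assumes x: "0 \<le> x" and c: "0 \<le> c"
  shows "dual_sup f (c *\<^sub>R x) = c * dual_sup f x"
proof -
  have le: "dual_sup f (c *\<^sub>R x) \<le> c * dual_sup f x" if x: "0 \<le> x" and c: "0 < c" for c x
  proof (rule dual_sup_least)
    fix y assume y: "0 \<le> y" "y \<le> c *\<^sub>R x"
    have "(1 / c) *\<^sub>R y \<le> (1 / c) *\<^sub>R c *\<^sub>R x"
      using y c by (intro scaleR_left_mono) auto
    then have "dual_apply f ((1 / c) *\<^sub>R y) \<le> dual_sup f x"
      using y c by (intro dual_sup_upper) (auto intro: scaleR_nonneg_nonneg)
    then show "dual_apply f y \<le> c * dual_sup f x"
      using c by (simp add: dual_apply_scaleR_right field_simps)
  qed (use x c in \<open>auto intro: scaleR_nonneg_nonneg\<close>)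
  show ?thesis
  proof (cases "c = 0")
    case True
    have "dual_sup f 0 \<le> 0"
      by (rule dual_sup_least) (auto dest: order.antisym simp: dual_apply_zero_right)
    then show ?thesis
      using True dual_sup_nonneg[of 0 f] by simp
  next
    case False
    with c have c: "0 < c" by simp
    have "dual_sup f ((1 / c) *\<^sub>R c *\<^sub>R x) \<le> (1 / c) * dual_sup f (c *\<^sub>R x)"
      using x c by (intro le) (auto intro: scaleR_nonneg_nonneg)
    then have "c * dual_sup f x \<le> dual_sup f (c *\<^sub>R x)"
      using c by (simp add: field_simps)
    with le[OF x c] show ?thesis by simp
  qed
qed

definition dual_pos :: "'a::banach_lattice dual \<Rightarrow> 'a dual"
  where "dual_pos f = Dual (Blinfun (\<lambda>x. dual_sup f (pprt x) - dual_sup f (pprt (- x))))"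

lemma dual_pos_aux:
  fixes f :: "'a::banach_lattice dual"
  assumes "0 \<le> a" "0 \<le> b" "a - b = x"
  shows "dual_sup f (pprt x) - dual_sup f (pprt (- x)) = dual_sup f a - dual_sup f b"
proof -
  have "pprt x + b = a + pprt (- x)"
    using pprt_diff[of x] assms(3) by (simp add: algebra_simps)
  then have "dual_sup f (pprt x + b) = dual_sup f (a + pprt (- x))"
    by simp
  then show ?thesis
    using assms by (simp add: dual_sup_add)
qed

lemma bounded_linear_dual_pos:
  fixes f :: "'a::banach_lattice dual"
  shows "bounded_linear (\<lambda>x. dual_sup f (pprt x) - dual_sup f (pprt (- x)))" (is "bounded_linear ?p")
proof (rule bounded_linear_intro)
  fix x y :: 'a and r :: real
  have "?p (x + y) = dual_sup f (pprt x + pprt y) - dual_sup f (pprt (- x) + pprt (- y))"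
  proof (rule dual_pos_aux)
    have "pprt x + pprt y - (pprt (- x) + pprt (- y)) = pprt x - pprt (- x) + (pprt y - pprt (- y))"
      by (simp add: algebra_simps)
    then show "pprt x + pprt y - (pprt (- x) + pprt (- y)) = x + y"
      by (simp only: pprt_diff)
  qed (auto intro: add_nonneg_nonneg)
  then show "?p (x + y) = ?p x + ?p y"
    by (simp add: dual_sup_add)
  show "?p (r *\<^sub>R x) = r *\<^sub>R ?p x"
  proof (cases "0 \<le> r")
    case True
    have "?p (r *\<^sub>R x) = dual_sup f (r *\<^sub>R pprt x) - dual_sup f (r *\<^sub>R pprt (- x))"
      using True pprt_diff[of x]
      by (intro dual_pos_aux) (auto intro: scaleR_nonneg_nonneg simp flip: scaleR_diff_right)
    then show ?thesis
      using True by (simp add: dual_sup_scaleR right_diff_distrib)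
  next
    case False
    have "?p (r *\<^sub>R x) = dual_sup f ((- r) *\<^sub>R pprt (- x)) - dual_sup f ((- r) *\<^sub>R pprt x)"
    proof (rule dual_pos_aux)
      have "(- r) *\<^sub>R pprt (- x) - (- r) *\<^sub>R pprt x = r *\<^sub>R (pprt x - pprt (- x))"
        by (simp add: algebra_simps)
      then show "(- r) *\<^sub>R pprt (- x) - (- r) *\<^sub>R pprt x = r *\<^sub>R x"
        by (simp only: pprt_diff)
    qed (use False in \<open>auto intro!: scaleR_nonneg_nonneg simp del: scaleR_minus_left\<close>)
    also have "\<dots> = (- r) * dual_sup f (pprt (- x)) - (- r) * dual_sup f (pprt x)"
      using False by (intro arg_cong2[of _ _ _ _ minus] dual_sup_scaleR) auto
    finally show ?thesis
      by (simp add: right_diff_distrib)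
  qed
  have "dual_sup f (pprt y) \<le> norm f * norm x" if "norm (pprt y) \<le> norm x" for y
  proof (rule dual_sup_least)
    fix w assume w: "0 \<le> w" "w \<le> pprt y"
    have "dual_apply f w \<le> norm f * norm (pprt y)"
      using w by (rule dual_apply_interval_le)
    also have "\<dots> \<le> norm f * norm x"
      using that by (intro mult_left_mono) auto
    finally show "dual_apply f w \<le> norm f * norm x" .
  qed auto
  from this[OF norm_pprt_le] this[OF norm_pprt_uminus_le]
  show "norm (?p x) \<le> norm x * norm f"
    using dual_sup_nonneg[of "pprt x" f] dual_sup_nonneg[of "pprt (- x)" f]
    by (simp add: abs_le_iff mult.commute) 
qed

lemma dual_pos_apply: "0 \<le> x \<Longrightarrow> dual_apply (dual_pos f) x = dual_sup f x"
  unfolding dual_apply.rep_eq dual_pos_def Dual_inverse[OF UNIV_I]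
  by (subst bounded_linear_Blinfun_apply[OF bounded_linear_dual_pos])
     (use dual_sup_scaleR[of 0 0 f] in \<open>simp add: pprt_neg nprt_def inf_absorb2\<close>)

lemma dual_eq_posI:
  fixes f g :: "'a::banach_lattice dual"
  assumes "\<And>x. 0 \<le> x \<Longrightarrow> dual_apply f x = dual_apply g x"
  shows "f = g"
proof (rule dual_eqI)
  fix x
  have "dual_apply f (pprt x - pprt (- x)) = dual_apply g (pprt x - pprt (- x))"
    by (simp add: dual_apply_diff_right assms)
  then show "dual_apply f x = dual_apply g x"
    by (simp only: pprt_diff)
qed

instantiation dual :: (banach_lattice) banach_lattice
begin

definition less_eq_dual :: "'a dual \<Rightarrow> 'a dual \<Rightarrow> bool"
  where "f \<le> g \<longleftrightarrow> (\<forall>x\<ge>0. dual_apply f x \<le> dual_apply g x)"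
definition less_dual :: "'a dual \<Rightarrow> 'a dual \<Rightarrow> bool"
  where "f < g \<longleftrightarrow> f \<le> g \<and> \<not> g \<le> (f :: 'a dual)"
definition sup_dual :: "'a dual \<Rightarrow> 'a dual \<Rightarrow> 'a dual"
  where "sup f g = g + dual_pos (f - g)"
definition inf_dual :: "'a dual \<Rightarrow> 'a dual \<Rightarrow> 'a dual"
  where "inf f g = f - dual_pos (f - g)"
definition abs_dual :: "'a dual \<Rightarrow> 'a dual"
  where "\<bar>f\<bar> = sup f (- f :: 'a dual)"

instance
proof
  fix f g h :: "'a dual" and a b :: real
  show "f < g \<longleftrightarrow> f \<le> g \<and> \<not> g \<le> f"
    by (rule less_dual_def)
  show "f \<le> f"
    by (simp add: less_eq_dual_def)
  show "f \<le> h" if "f \<le> g" "g \<le> h"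
    using that by (force simp: less_eq_dual_def)
  show "f = g" if "f \<le> g" "g \<le> f"
    using that by (intro dual_eq_posI antisym) (auto simp: less_eq_dual_def)
  show "h + f \<le> h + g" if "f \<le> g"
    using that by (simp add: less_eq_dual_def dual_apply_add)
  show "a *\<^sub>R f \<le> a *\<^sub>R g" if "f \<le> g" "0 \<le> a"
    using that by (auto simp: less_eq_dual_def dual_apply_scaleR intro: mult_left_mono)
  show "a *\<^sub>R f \<le> b *\<^sub>R f" if "a \<le> b" "0 \<le> f"
    using that by (auto simp: less_eq_dual_def dual_apply_scaleR intro: mult_right_mono)
  have pos_ge: "dual_apply f x - dual_apply g x \<le> dual_sup (f - g) x"
    and pos_nn: "0 \<le> dual_sup (f - g) x" if "0 \<le> x" for f g :: "'a dual" and x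
    using dual_sup_upper[of x x "f - g"] dual_sup_nonneg[of x "f - g"] that
    by (auto simp: dual_apply_diff)
  show "inf f g \<le> f" "inf f g \<le> g"
    using pos_ge[of _ f g] pos_nn[of _ f g]
    by (force simp: less_eq_dual_def inf_dual_def dual_apply_diff dual_pos_apply)+
  show "f \<le> sup f g" "g \<le> sup f g"
    using pos_ge[of _ f g] pos_nn[of _ f g]
    by (force simp: less_eq_dual_def sup_dual_def dual_apply_add dual_pos_apply)+
  have mono: "dual_apply f x \<le> dual_apply g x" if "f \<le> g" "0 \<le> x" for f g :: "'a dual" and x
    using that by (simp add: less_eq_dual_def)
  show "h \<le> inf f g" if h: "h \<le> f" "h \<le> g"
    unfolding less_eq_dual_def
  proof (intro allI impI)
    fix x :: 'a assume x: "0 \<le> x"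
    have "dual_sup (f - g) x \<le> dual_apply f x - dual_apply h x"
    proof (rule dual_sup_least[OF x])
      fix y assume y: "0 \<le> y" "y \<le> x"
      have "dual_apply h y \<le> dual_apply g y" "dual_apply h (x - y) \<le> dual_apply f (x - y)"
        using h y by (auto intro: mono)
      then show "dual_apply (f - g) y \<le> dual_apply f x - dual_apply h x"
        by (simp add: dual_apply_diff dual_apply_diff_right)
    qed
    then show "dual_apply h x \<le> dual_apply (inf f g) x"
      using x by (simp add: inf_dual_def dual_apply_diff dual_pos_apply)
  qed
  show "sup g h \<le> f" if h: "g \<le> f" "h \<le> f"
    unfolding less_eq_dual_def
  proof (intro allI impI)
    fix x :: 'a assume x: "0 \<le> x"
    have "dual_sup (g - h) x \<le> dual_apply f x - dual_apply h x"
    proof (rule dual_sup_least[OF x])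
      fix y assume y: "0 \<le> y" "y \<le> x"
      have "dual_apply g y \<le> dual_apply f y" "dual_apply h (x - y) \<le> dual_apply f (x - y)"
        using h y by (auto intro: mono)
      then show "dual_apply (g - h) y \<le> dual_apply f x - dual_apply h x"
        by (simp add: dual_apply_diff dual_apply_diff_right)
    qed
    then show "dual_apply (sup g h) x \<le> dual_apply f x"
      using x by (simp add: sup_dual_def dual_apply_add dual_pos_apply)
  qed
  show abs: "\<bar>f\<bar> = sup f (- f)" for f :: "'a dual"
    by (rule abs_dual_def)
  have sup_abs: "dual_apply \<bar>f\<bar> x = - dual_apply f x + dual_sup (f + f) x" if "0 \<le> x"
    for f :: "'a dual" and x
    using that by (simp add: abs sup_dual_def dual_apply_add dual_apply_diff dual_apply_minus dual_pos_apply)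
  show "norm f \<le> norm g" if le: "\<bar>f\<bar> \<le> \<bar>g\<bar>"
  proof (rule norm_dual_bound)
    fix x :: 'a
    have f1: "\<bar>dual_apply f y\<bar> \<le> dual_apply \<bar>f\<bar> y" if "0 \<le> y" for y
      using dual_sup_upper[of y y "f + f"] dual_sup_nonneg[of y "f + f"] that
      by (auto simp: sup_abs dual_apply_add abs_le_iff)
    have absx: "pprt x + pprt (- x) = \<bar>x\<bar>"
      by (simp add: abs_prts pprt_neg)
    have "dual_apply f x = dual_apply f (pprt x) - dual_apply f (pprt (- x))"
      by (simp only: pprt_diff flip: dual_apply_diff_right)
    then have "\<bar>dual_apply f x\<bar> \<le> dual_apply \<bar>f\<bar> (pprt x) + dual_apply \<bar>f\<bar> (pprt (- x))"
      using f1[of "pprt x"] f1[of "pprt (- x)"] by simp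
    also have "\<dots> = dual_apply \<bar>f\<bar> \<bar>x\<bar>"
      by (simp only: absx flip: dual_apply_add_right)
    also have "\<dots> \<le> dual_apply \<bar>g\<bar> \<bar>x\<bar>"
      using le by (simp add: mono)
    also have "\<dots> \<le> norm g * norm x"
    proof -
      have "dual_sup (g + g) \<bar>x\<bar> \<le> norm g * norm x + dual_apply g \<bar>x\<bar>"
      proof (rule dual_sup_least)
        fix y assume y: "0 \<le> y" "y \<le> \<bar>x\<bar>"
        have "\<bar>y + y - \<bar>x\<bar>\<bar> \<le> \<bar>x\<bar>"
          using y add_mono[OF y(2) y(2)] add_nonneg_nonneg[OF y(1) y(1)]
          by (intro abs_leI) (auto simp: algebra_simps)
        then have "norm (y + y - \<bar>x\<bar>) \<le> norm x"
          by (rule norm_mono_abs)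
        then have "norm g * norm (y + y - \<bar>x\<bar>) \<le> norm g * norm x"
          by (intro mult_left_mono) auto
        then have "dual_apply g (y + y - \<bar>x\<bar>) \<le> norm g * norm x"
          using norm_dual_apply[of g "y + y - \<bar>x\<bar>"] by linarith
        then show "dual_apply (g + g) y \<le> norm g * norm x + dual_apply g \<bar>x\<bar>"
          by (simp add: dual_apply_diff_right dual_apply_add_right dual_apply_add)
      qed auto
      then show ?thesis
        by (simp add: sup_abs)
    qed
    finally show "\<bar>dual_apply f x\<bar> \<le> norm g * norm x" .
  qed auto
qed

end


section \<open>Order continuity\<close>

definition lat_disjoint :: "'a::banach_lattice \<Rightarrow> 'a \<Rightarrow> bool"
  where "lat_disjoint x y \<longleftrightarrow> inf \<bar>x\<bar> \<bar>y\<bar> = 0"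

definition solid_hull :: "'a::banach_lattice set \<Rightarrow> 'a set"
  where "solid_hull A = {y. \<exists>x\<in>A. \<bar>y\<bar> \<le> \<bar>x\<bar>}"

definition order_ideal :: "'a::banach_lattice set \<Rightarrow> bool"
  where "order_ideal I \<longleftrightarrow> subspace I \<and> solid_hull I \<subseteq> I"

text \<open>
  A downward directed subset of \<open>L\<close> with infimum \<open>0\<close> in \<open>L\<close>. It is regarded as a decreasing net
  indexed by itself; nets over other index sets are treated in
  \<open>order_continuous_norm_on_iff_nets\<close> below.
\<close>

definition directed_down_to_zero_in :: "'a::banach_lattice set \<Rightarrow> 'a set \<Rightarrow> bool"
  where "directed_down_to_zero_in L D \<longleftrightarrow>
    D \<subseteq> L \<and> D \<noteq> {} \<and> (\<forall>x\<in>D. \<forall>y\<in>D. \<exists>z\<in>D. z \<le> x \<and> z \<le> y) \<and>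
    (\<forall>x\<in>D. 0 \<le> x) \<and> (\<forall>w\<in>L. (\<forall>x\<in>D. w \<le> x) \<longrightarrow> w \<le> 0)"

definition order_continuous_norm_on :: "'a::banach_lattice set \<Rightarrow> bool"
  where "order_continuous_norm_on L \<longleftrightarrow>
    (\<forall>D. directed_down_to_zero_in L D \<longrightarrow>
      (\<forall>\<epsilon>>0. \<exists>d\<in>D. \<forall>x\<in>D. x \<le> d \<longrightarrow> norm x < \<epsilon>))"

definition net_down_to_zero_in ::
    "'a::banach_lattice set \<Rightarrow> 'i set \<Rightarrow> ('i \<Rightarrow> 'i \<Rightarrow> bool) \<Rightarrow> ('i \<Rightarrow> 'a) \<Rightarrow> bool"
  where "net_down_to_zero_in L I r x \<longleftrightarrow>
    I \<noteq> {} \<and> (\<forall>i\<in>I. r i i) \<and> (\<forall>i\<in>I. \<forall>j\<in>I. \<forall>k\<in>I. r i j \<longrightarrow> r j k \<longrightarrow> r i k) \<and>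
    (\<forall>i\<in>I. \<forall>j\<in>I. \<exists>k\<in>I. r i k \<and> r j k) \<and>
    (\<forall>i\<in>I. x i \<in> L) \<and> (\<forall>i\<in>I. \<forall>j\<in>I. r i j \<longrightarrow> x j \<le> x i) \<and>
    (\<forall>i\<in>I. 0 \<le> x i) \<and> (\<forall>w\<in>L. (\<forall>i\<in>I. w \<le> x i) \<longrightarrow> w \<le> 0)"

lemma order_continuous_norm_on_net:
  assumes L: "order_continuous_norm_on L" and x: "net_down_to_zero_in L I r x" and "0 < \<epsilon>"
  shows "\<exists>i\<in>I. \<forall>j\<in>I. r i j \<longrightarrow> norm (x j) < \<epsilon>"
proof -
  have dir: "\<forall>i\<in>I. \<forall>j\<in>I. \<exists>k\<in>I. r i k \<and> r j k" and dec: "\<forall>i\<in>I. \<forall>j\<in>I. r i j \<longrightarrow> x j \<le> x i"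
    and rest: "I \<noteq> {}" "\<forall>i\<in>I. x i \<in> L" "\<forall>i\<in>I. 0 \<le> x i" "\<forall>w\<in>L. (\<forall>i\<in>I. w \<le> x i) \<longrightarrow> w \<le> 0"
    using x unfolding net_down_to_zero_in_def by - (elim conjE, assumption)+
  have "directed_down_to_zero_in L (x ` I)"
    unfolding directed_down_to_zero_in_def
  proof (intro conjI ballI impI)
    fix y z assume "y \<in> x ` I" "z \<in> x ` I"
    then obtain i j where ij: "i \<in> I" "y = x i" "j \<in> I" "z = x j" by blast
    then obtain k where "k \<in> I" "r i k" "r j k"
      using dir by meson
    with ij show "\<exists>w\<in>x ` I. w \<le> y \<and> w \<le> z"
      using dec by auto
  qed (use rest in auto)
  then obtain i where i: "i \<in> I" "\<forall>y\<in>x ` I. y \<le> x i \<longrightarrow> norm y < \<epsilon>"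
    using L \<open>0 < \<epsilon>\<close> unfolding order_continuous_norm_on_def by blast
  then show ?thesis
    using dec by auto
qed

lemma order_continuous_norm_on_iff_nets:
  fixes L :: "'a::banach_lattice set"
  shows "order_continuous_norm_on L \<longleftrightarrow>
    (\<forall>(I :: 'a set) r x. net_down_to_zero_in L I r x \<longrightarrow>
      (\<forall>\<epsilon>>0. \<exists>i\<in>I. \<forall>j\<in>I. r i j \<longrightarrow> norm (x j) < \<epsilon>))" (is "_ \<longleftrightarrow> ?nets")
proof
  show ?nets if "order_continuous_norm_on L"
    using order_continuous_norm_on_net[OF that] by blast
next
  assume nets: ?nets
  show "order_continuous_norm_on L"
    unfolding order_continuous_norm_on_def
  proof (intro allI impI)
    fix D :: "'a set" and \<epsilon> :: real
    assume D: "directed_down_to_zero_in L D" and \<epsilon>: "0 < \<epsilon>"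
    have "net_down_to_zero_in L D (\<lambda>x y. y \<le> x) (\<lambda>x. x)"
      using D unfolding directed_down_to_zero_in_def net_down_to_zero_in_def by auto
    with nets \<epsilon> show "\<exists>d\<in>D. \<forall>x\<in>D. x \<le> d \<longrightarrow> norm x < \<epsilon>"
      by blast
  qed
qed

definition order_continuous_part :: "'a::banach_lattice set"
  where "order_continuous_part =
    (GREATEST I. closed I \<and> order_ideal I \<and> order_continuous_norm_on I)"

text \<open>
  That the greatest such ideal exists is proved via its description by monotone sequences.
\<close>

definition monotone_convergent_part :: "'a::banach_lattice set"
  where "monotone_convergent_part =
    {x. \<forall>u :: nat \<Rightarrow> 'a. monoseq u \<and> range u \<subseteq> {0..\<bar>x\<bar>} \<longrightarrow> convergent u}"

lemma monotone_convergent_partI: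
  fixes x :: "'a::banach_lattice"
  assumes "\<And>u :: nat \<Rightarrow> 'a. incseq u \<Longrightarrow> (\<And>n. 0 \<le> u n) \<Longrightarrow> (\<And>n. u n \<le> \<bar>x\<bar>) \<Longrightarrow> convergent u"
  shows "x \<in> monotone_convergent_part"
  unfolding monotone_convergent_part_def
proof (intro CollectI allI impI, elim conjE)
  fix u :: "nat \<Rightarrow> 'a"
  assume u: "monoseq u" "range u \<subseteq> {0..\<bar>x\<bar>}"
  then have r: "0 \<le> u n" "u n \<le> \<bar>x\<bar>" for n
    by (auto simp: image_subset_iff)
  consider "incseq u" | "decseq u"
    using u(1) by (auto simp: monoseq_iff)
  then show "convergent u"
  proof cases
    case 1
    then show ?thesis using r by (rule assms)
  next
    case 2
    have "convergent (\<lambda>n. \<bar>x\<bar> - u n)"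
      using 2 r by (intro assms) (auto simp: incseq_def decseq_def intro: diff_left_mono)
    with convergent_const[of "\<bar>x\<bar>"] have "convergent (\<lambda>n. \<bar>x\<bar> - (\<bar>x\<bar> - u n))"
      by (rule convergent_diff)
    then show ?thesis by (simp only: diff_diff_eq2 add_diff_cancel_left')
  qed
qed

lemma monotone_convergent_partD:
  fixes x :: "'a::banach_lattice"
  assumes "x \<in> monotone_convergent_part" "monoseq u" "\<And>n. 0 \<le> u n" "\<And>n. u n \<le> \<bar>x\<bar>"
  shows "convergent u"
  using assms unfolding monotone_convergent_part_def by (auto simp: image_subset_iff)

lemma monotone_convergent_part_solid:
  assumes "x \<in> monotone_convergent_part" "\<bar>y\<bar> \<le> \<bar>x\<bar>"
  shows "y \<in> monotone_convergent_part"
  by (rule monotone_convergent_partI)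
     (use assms in \<open>auto intro: monotone_convergent_partD order_trans incseq_imp_monoseq\<close>)

lemma diff_inf_eq_sup_0: "u - inf u y = sup 0 (u - (y :: 'a::lattice_ab_group_add))"
  by (simp add: add_sup_distrib_left)

lemma monotone_convergent_part_add:
  fixes x y :: "'a::banach_lattice"
  assumes "x \<in> monotone_convergent_part" "y \<in> monotone_convergent_part"
  shows "x + y \<in> monotone_convergent_part"
proof (rule monotone_convergent_partI)
  fix u :: "nat \<Rightarrow> 'a"
  assume u: "incseq u" "\<And>n. 0 \<le> u n" "\<And>n. u n \<le> \<bar>x + y\<bar>"
  have le: "u n \<le> \<bar>x\<bar> + \<bar>y\<bar>" for n
    using u(3) abs_triangle_ineq order_trans by blast
  have "convergent (\<lambda>n. inf (u n) \<bar>x\<bar>)"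
    using u by (intro monotone_convergent_partD[OF assms(1)] incseq_imp_monoseq)
      (auto simp: incseq_def intro: le_infI1)
  moreover have "convergent (\<lambda>n. sup 0 (u n - \<bar>x\<bar>))"
  proof (intro monotone_convergent_partD[OF assms(2)] incseq_imp_monoseq)
    show "incseq (\<lambda>n. sup 0 (u n - \<bar>x\<bar>))"
      using u(1) by (auto simp: incseq_def intro: le_supI2 diff_right_mono)
    show "sup 0 (u n - \<bar>x\<bar>) \<le> \<bar>y\<bar>" for n
      using le[of n] by (simp add: diff_le_eq add.commute)
  qed auto
  ultimately have "convergent (\<lambda>n. inf (u n) \<bar>x\<bar> + sup 0 (u n - \<bar>x\<bar>))"
    by (rule convergent_add)
  then show "convergent u"
    by (simp flip: diff_inf_eq_sup_0 del: diff_inf_eq_sup)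
qed

lemma monotone_convergent_part_zero: "0 \<in> monotone_convergent_part"
proof (rule monotone_convergent_partI)
  fix u :: "nat \<Rightarrow> 'a"
  assume "\<And>n. 0 \<le> u n" "\<And>n. u n \<le> \<bar>0\<bar>"
  then have "u = (\<lambda>_. 0)"
    by (auto intro: order.antisym)
  then show "convergent u"
    by (simp add: convergent_const)
qed

lemma monotone_convergent_part_scaleR:
  fixes x :: "'a::banach_lattice"
  assumes x: "x \<in> monotone_convergent_part"
  shows "c *\<^sub>R x \<in> monotone_convergent_part"
proof -
  have "of_nat n *\<^sub>R x \<in> monotone_convergent_part" for n
    by (induction n)
       (auto simp: monotone_convergent_part_zero scaleR_left_distrib
          intro: monotone_convergent_part_add x)
  moreover obtain n where n: "\<bar>c\<bar> \<le> of_nat n"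
    using real_arch_simple by blast
  moreover have "\<bar>c *\<^sub>R x\<bar> \<le> \<bar>of_nat n *\<^sub>R x\<bar>"
  proof -
    have eq: "\<bar>a *\<^sub>R x\<bar> \<le> \<bar>a\<bar> *\<^sub>R \<bar>x\<bar>" for a and x :: 'a
    proof (rule abs_leI)
      show "a *\<^sub>R x \<le> \<bar>a\<bar> *\<^sub>R \<bar>x\<bar>"
        using scaleR_left_mono[of x "\<bar>x\<bar>" a] scaleR_left_mono[of "- x" "\<bar>x\<bar>" "- a"]
        by (cases "0 \<le> a") (auto simp: abs_ge_self abs_ge_minus_self)
      show "- (a *\<^sub>R x) \<le> \<bar>a\<bar> *\<^sub>R \<bar>x\<bar>"
        using scaleR_left_mono[of "- x" "\<bar>x\<bar>" a] scaleR_left_mono[of "x" "\<bar>x\<bar>" "- a"]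
        by (cases "0 \<le> a") (auto simp: abs_ge_self abs_ge_minus_self)
    qed
    have "\<bar>c *\<^sub>R x\<bar> \<le> \<bar>c\<bar> *\<^sub>R \<bar>x\<bar>"
      by (rule eq)
    also have "\<dots> \<le> of_nat n *\<^sub>R \<bar>x\<bar>"
      using n by (intro scaleR_right_mono) auto
    also have "\<dots> \<le> \<bar>of_nat n *\<^sub>R x\<bar>"
    proof (cases "n = 0")
      case False
      have "\<bar>(1 / of_nat n) *\<^sub>R (of_nat n *\<^sub>R x)\<bar> \<le> \<bar>1 / of_nat n\<bar> *\<^sub>R \<bar>of_nat n *\<^sub>R x\<bar>"
        by (rule eq)
      then have "of_nat n *\<^sub>R \<bar>x\<bar> \<le> of_nat n *\<^sub>R (1 / of_nat n) *\<^sub>R \<bar>of_nat n *\<^sub>R x\<bar>"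
        using False by (intro scaleR_left_mono) auto
      then show ?thesis
        using False by simp
    qed simp
    finally show ?thesis .
  qed
  ultimately show ?thesis
    by (blast intro: monotone_convergent_part_solid)
qed

lemma order_ideal_monotone_convergent_part:
  "order_ideal (monotone_convergent_part :: 'a::banach_lattice set)"
  unfolding order_ideal_def subspace_def solid_hull_def
  by (auto intro: monotone_convergent_part_zero monotone_convergent_part_add
      monotone_convergent_part_scaleR monotone_convergent_part_solid)

lemma closed_monotone_convergent_part:
  "closed (monotone_convergent_part :: 'a::banach_lattice set)"
proof -
  have "x \<in> monotone_convergent_part"
    if x: "x \<in> closure monotone_convergent_part" for x :: 'a
  proof (rule monotone_convergent_partI)
    fix u :: "nat \<Rightarrow> 'a"
    assume u: "incseq u" "\<And>n. 0 \<le> u n" "\<And>n. u n \<le> \<bar>x\<bar>"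
    have "Cauchy u"
    proof (rule CauchyI)
      fix e :: real assume e: "0 < e"
      then obtain y where y: "y \<in> monotone_convergent_part" "dist y x < e / 3"
        using x unfolding closure_approachable by (metis divide_pos_pos zero_less_numeral)
      define w where "w n = inf (u n) \<bar>y\<bar>" for n
      have "convergent w"
        unfolding w_def using u
        by (intro monotone_convergent_partD[OF y(1)] incseq_imp_monoseq)
          (auto simp: incseq_def intro: le_infI1)
      then have "Cauchy w"
        by (rule convergent_Cauchy)
      then obtain M where M: "\<forall>m\<ge>M. \<forall>n\<ge>M. norm (w m - w n) < e / 3"
        using e CauchyD[of w "e / 3"] by auto
      have near: "norm (u n - w n) < e / 3" for n
      proof -
        have "u n - w n \<le> \<bar>x - y\<bar>"
        proof -
          have "u n - \<bar>y\<bar> \<le> \<bar>x\<bar> - \<bar>y\<bar>"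
            using u(3) by (rule diff_right_mono)
          also have "\<dots> \<le> \<bar>x - y\<bar>"
            by (rule abs_triangle_ineq2)
          finally show ?thesis
            unfolding w_def diff_inf_eq_sup_0 by simp
        qed
        moreover have "0 \<le> u n - w n"
          unfolding w_def diff_inf_eq_sup_0 by simp
        ultimately have "norm (u n - w n) \<le> norm \<bar>x - y\<bar>"
          by (intro norm_mono_pos)
        also have "\<dots> < e / 3"
          using y(2) by (simp add: dist_norm norm_minus_commute)
        finally show ?thesis .
      qed
      show "\<exists>M. \<forall>m\<ge>M. \<forall>n\<ge>M. norm (u m - u n) < e"
      proof (intro exI allI impI)
        fix m n assume "M \<le> m" "M \<le> n"
        then have "norm (w m - w n) < e / 3"
          using M by blast
        moreover have "norm (u m - u n) \<le> norm (u m - w m) + norm (w m - w n) + norm (u n - w n)"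
        proof -
          have "norm ((u m - w m) + (w m - w n) - (u n - w n))
              \<le> norm (u m - w m) + norm (w m - w n) + norm (u n - w n)"
            by (meson add_mono norm_triangle_ineq norm_triangle_ineq4 order_refl order_trans)
          then show ?thesis by (simp add: algebra_simps)
        qed
        ultimately show "norm (u m - u n) < e"
          using near[of m] near[of n] by linarith
      qed
    qed
    then show "convergent u"
      by (rule Cauchy_convergent)
  qed
  then show ?thesis
    by (meson closure_subset closure_subset_eq subsetI)
qed

lemma order_continuous_norm_on_monotone_convergent_part:
  "order_continuous_norm_on (monotone_convergent_part :: 'a::banach_lattice set)"
  unfolding order_continuous_norm_on_def
proof (intro allI impI)
  fix D :: "'a set" and \<epsilon> :: real
  assume D: "directed_down_to_zero_in monotone_convergent_part D" and \<epsilon>: "0 < \<epsilon>"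
  have DM: "D \<subseteq> monotone_convergent_part" and Dne: "D \<noteq> {}" and Dpos: "\<And>x. x \<in> D \<Longrightarrow> 0 \<le> x"
    and Ddir: "\<And>x y. x \<in> D \<Longrightarrow> y \<in> D \<Longrightarrow> \<exists>z\<in>D. z \<le> x \<and> z \<le> y"
    and Dinf: "\<And>w. w \<in> monotone_convergent_part \<Longrightarrow> (\<And>x. x \<in> D \<Longrightarrow> w \<le> x) \<Longrightarrow> w \<le> 0"
    using D unfolding directed_down_to_zero_in_def by blast+
  have conv: "convergent u" if u: "decseq u" "\<And>n. u n \<in> D" for u
  proof (rule monotone_convergent_partD)
    show "u 0 \<in> monotone_convergent_part" using u DM by blast
    show "monoseq u" using u(1) by (rule decseq_imp_monoseq)
    show "0 \<le> u n" for n using u(2) by (rule Dpos)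
    show "u n \<le> \<bar>u 0\<bar>" for n
      using u(1) Dpos[OF u(2)] by (simp add: decseq_def)
  qed
  have cauchy: "\<exists>d\<in>D. d \<le> c \<and> (\<forall>x\<in>D. x \<le> d \<longrightarrow> norm (d - x) < e)" if c: "c \<in> D" and e: "0 < e"
    for c e
  proof (rule ccontr)
    assume "\<not> ?thesis"
    then have step: "\<exists>x. (x \<in> D \<and> x \<le> c) \<and> x \<le> d \<and> e \<le> norm (d - x)" if "d \<in> D \<and> d \<le> c" for d
      using that by (meson not_less order_trans)
    obtain u where u: "\<And>n. u n \<in> D \<and> u n \<le> c"
      and s: "\<And>n. u (Suc n) \<le> u n \<and> e \<le> norm (u n - u (Suc n))"
      using dependent_nat_choice[of "\<lambda>_ d. d \<in> D \<and> d \<le> c" "\<lambda>_ d x. x \<le> d \<and> e \<le> norm (d - x)"]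
        c step by (metis order_refl)
    have "convergent u"
      using u s by (intro conv) (auto simp: decseq_Suc_iff)
    then have "Cauchy u" by (rule convergent_Cauchy)
    then obtain M where "\<forall>m\<ge>M. \<forall>n\<ge>M. norm (u m - u n) < e"
      using e CauchyD by blast
    then have "norm (u M - u (Suc M)) < e" by simp
    with s[of M] show False by linarith
  qed
  obtain c where c: "c \<in> D" using Dne by blast
  define P where "P n d \<longleftrightarrow> d \<in> D \<and> (\<forall>x\<in>D. x \<le> d \<longrightarrow> norm (d - x) < inverse (of_nat (Suc n)))"
    for n d
  have "\<exists>d. P 0 d"
    using cauchy[OF c, of 1] unfolding P_def by auto
  moreover have "\<exists>y. P (Suc n) y \<and> y \<le> d" if "P n d" for n d
    using cauchy[of d "inverse (of_nat (Suc (Suc n)))"] that unfolding P_def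
    by (metis inverse_positive_iff_positive of_nat_0_less_iff zero_less_Suc)
  ultimately obtain d where Pd: "\<And>n. P n (d n)" and dec: "\<And>n. d (Suc n) \<le> d n"
    using dependent_nat_choice[of P "\<lambda>_ d y. y \<le> d"] by metis
  have "convergent d"
    using Pd dec by (intro conv) (auto simp: decseq_Suc_iff P_def)
  then obtain z where z: "d \<longlonglongrightarrow> z" by (auto simp: convergent_def)
  have z_M: "z \<in> monotone_convergent_part"
    using closed_sequentially[OF closed_monotone_convergent_part _ z] Pd DM
    unfolding P_def by blast
  have lower: "z \<le> x" if x: "x \<in> D" for x
  proof -
    have "norm (pprt (z - x)) \<le> norm (z - d n) + inverse (of_nat (Suc n))" for n
    proof -
      obtain e where e: "e \<in> D" "e \<le> x" "e \<le> d n"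
        using Ddir[OF x, of "d n"] Pd[of n] unfolding P_def by blast
      have "norm (pprt (z - x)) \<le> norm (pprt (z - e))"
        using e by (intro norm_mono_pos pprt_mono diff_left_mono) auto
      also have "\<dots> \<le> norm (z - e)"
        by (rule norm_pprt_le)
      also have "\<dots> \<le> norm (z - d n) + norm (d n - e)"
        using norm_triangle_ineq[of "z - d n" "d n - e"] by simp
      also have "norm (d n - e) \<le> inverse (of_nat (Suc n))"
        using Pd[of n] e unfolding P_def by (intro less_imp_le) blast
      finally show ?thesis by simp
    qed
    moreover have "(\<lambda>n. norm (z - d n) + inverse (of_nat (Suc n))) \<longlonglongrightarrow> norm (z - z) + 0"
      by (intro tendsto_add tendsto_norm tendsto_diff tendsto_const z LIMSEQ_inverse_real_of_nat)
    ultimately have "norm (pprt (z - x)) \<le> 0"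
      using LIMSEQ_le_const by fastforce
    then have "z - x \<le> 0"
      by (simp add: le_zero_iff_zero_pprt)
    then show ?thesis by simp
  qed
  have "z \<le> 0"
    using z_M lower by (rule Dinf)
  have "norm z = 0"
  proof -
    have "norm (pprt (- z)) \<le> norm (d n - z)" for n
    proof -
      have "pprt (- z) \<le> pprt (d n - z)"
        using Dpos Pd[of n] unfolding P_def by (intro pprt_mono) simp
      then have "norm (pprt (- z)) \<le> norm (pprt (d n - z))"
        by (intro norm_mono_pos) auto
      also have "\<dots> \<le> norm (d n - z)"
        by (rule norm_pprt_le)
      finally show ?thesis .
    qed
    moreover have "(\<lambda>n. norm (d n - z)) \<longlonglongrightarrow> norm (z - z)"
      by (intro tendsto_norm tendsto_diff tendsto_const z)
    ultimately have "norm (pprt (- z)) \<le> 0"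
      using LIMSEQ_le_const by fastforce
    then show ?thesis
      using \<open>z \<le> 0\<close> by simp
  qed
  with z have "(\<lambda>n. norm (d n)) \<longlonglongrightarrow> 0"
    using tendsto_norm[OF z] by simp
  then obtain n where n: "norm (d n) < \<epsilon>"
    using order_tendstoD(2)[OF _ \<epsilon>] eventually_happens trivial_limit_sequentially by blast
  show "\<exists>d\<in>D. \<forall>x\<in>D. x \<le> d \<longrightarrow> norm x < \<epsilon>"
  proof (intro bexI ballI impI)
    show "d n \<in> D" using Pd unfolding P_def by blast
    show "norm x < \<epsilon>" if "x \<in> D" "x \<le> d n" for x
      using norm_mono_pos[of x "d n"] that Dpos n by fastforce
  qed
qed

lemma nonpos_if_multiples_bounded:
  fixes w v :: "'a::banach_lattice"
  assumes "\<And>k::nat. of_nat k *\<^sub>R w \<le> v"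
  shows "w \<le> 0"
proof -
  have "norm (pprt w) \<le> inverse (of_nat (Suc k)) * norm v" for k
  proof -
    have "inverse (of_nat (Suc k)) *\<^sub>R of_nat (Suc k) *\<^sub>R w \<le> inverse (of_nat (Suc k)) *\<^sub>R v"
      using assms[of "Suc k"] by (intro scaleR_left_mono) (auto simp del: of_nat_Suc)
    then have "w \<le> inverse (of_nat (Suc k)) *\<^sub>R v"
      by (simp del: of_nat_Suc)
    then have "norm (pprt w) \<le> norm (pprt (inverse (of_nat (Suc k)) *\<^sub>R v))"
      by (intro norm_mono_pos pprt_mono) auto
    also have "\<dots> \<le> norm (inverse (of_nat (Suc k)) *\<^sub>R v)"
      by (rule norm_pprt_le)
    finally show ?thesis by simp
  qed
  moreover have "(\<lambda>k. inverse (of_nat (Suc k)) * norm v) \<longlonglongrightarrow> 0 * norm v"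
    by (intro tendsto_mult LIMSEQ_inverse_real_of_nat tendsto_const)
  ultimately have "norm (pprt w) \<le> 0"
    using LIMSEQ_le_const by fastforce
  then show ?thesis
    by (simp add: le_zero_iff_zero_pprt)
qed

lemma ideal_subset_monotone_convergent_part:
  fixes I :: "'a::banach_lattice set"
  assumes I: "order_ideal I" and oc: "order_continuous_norm_on I"
  shows "I \<subseteq> monotone_convergent_part"
proof
  fix x assume x: "x \<in> I"
  have I_solid: "y \<in> I" if "z \<in> I" "\<bar>y\<bar> \<le> \<bar>z\<bar>" for y z
    using I that unfolding order_ideal_def solid_hull_def by blast
  show "x \<in> monotone_convergent_part"
  proof (rule monotone_convergent_partI)
    fix u :: "nat \<Rightarrow> 'a"
    assume u: "incseq u" "\<And>n. 0 \<le> u n" "\<And>n. u n \<le> \<bar>x\<bar>"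
    define V where "V = {v. v \<le> \<bar>x\<bar> \<and> (\<forall>n. u n \<le> v)}"
    define D where "D = {v - u n | v n. v \<in> V}"
    have VD: "0 \<le> v - u n" "\<bar>v - u n\<bar> \<le> \<bar>x\<bar>" if "v \<in> V" for v n
    proof -
      show 0: "0 \<le> v - u n" using that by (simp add: V_def)
      have "v - u n \<le> \<bar>x\<bar> - 0"
        using that u(2) by (intro diff_mono) (auto simp: V_def)
      with 0 show "\<bar>v - u n\<bar> \<le> \<bar>x\<bar>" by simp
    qed
    have xV: "\<bar>x\<bar> \<in> V" using u(3) by (simp add: V_def)
    have "directed_down_to_zero_in I D"
      unfolding directed_down_to_zero_in_def
    proof (intro conjI ballI impI)
      show "D \<subseteq> I"
        unfolding D_def using VD(2) x by (auto intro: I_solid)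
      show "D \<noteq> {}"
        unfolding D_def using xV by blast
      show "0 \<le> y" if "y \<in> D" for y
        using that VD(1) unfolding D_def by auto
      fix y y' assume "y \<in> D" "y' \<in> D"
      then obtain v n v' n' where y: "y = v - u n" "v \<in> V" and y': "y' = v' - u n'" "v' \<in> V"
        unfolding D_def by blast
      have "inf v v' \<in> V"
        using y y' unfolding V_def by (auto intro: le_infI1)
      moreover have "inf v v' - u (max n n') \<le> y" "inf v v' - u (max n n') \<le> y'"
        unfolding y y' using u(1) by (auto simp: incseq_def intro!: diff_mono)
      ultimately show "\<exists>z\<in>D. z \<le> y \<and> z \<le> y'"
        unfolding D_def by blast
    next
      fix w assume "w \<in> I" and w: "\<forall>y\<in>D. w \<le> y"
      have w': "pprt w \<le> v - u n" if "v \<in> V" for v n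
        unfolding pprt_def using w VD(1) that unfolding D_def by (intro le_supI) auto
      have stepp: "v - pprt w \<in> V" if v: "v \<in> V" for v
      proof -
        have "u n \<le> v - pprt w" for n
          using w'[OF v, of n] by (simp add: algebra_simps)
        moreover have "v - pprt w \<le> \<bar>x\<bar>"
          using v diff_mono[of v "\<bar>x\<bar>" 0 "pprt w"] by (auto simp: V_def)
        ultimately show ?thesis by (simp add: V_def)
      qed
      have "\<bar>x\<bar> - of_nat k *\<^sub>R pprt w \<in> V" for k
      proof (induction k)
        case (Suc k)
        then have "\<bar>x\<bar> - of_nat k *\<^sub>R pprt w - pprt w \<in> V"
          by (rule stepp)
        then show ?case
          by (simp add: scaleR_left_distrib algebra_simps)
      qed (simp add: xV)
      then have "0 \<le> \<bar>x\<bar> - of_nat k *\<^sub>R pprt w" for k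
        using u(2)[of 0] unfolding V_def by (metis (mono_tags, lifting) mem_Collect_eq order_trans)
      then have "pprt w \<le> 0"
        by (intro nonpos_if_multiples_bounded[of _ "\<bar>x\<bar>"]) simp
      then show "w \<le> 0"
        by (simp add: pprt_def)
    qed
    then have small: "\<exists>d\<in>D. norm d < e" if "0 < e" for e
      using oc that unfolding order_continuous_norm_on_def by blast
    have "Cauchy u"
    proof (rule CauchyI')
      fix e :: real assume "0 < e"
      then obtain v N where v: "v \<in> V" "norm (v - u N) < e"
        using small unfolding D_def by blast
      have "norm (u m - u n) < e" if mn: "N \<le> m" "m < n" for m n
      proof -
        have "u n - u m \<le> v - u N"
          using v(1) u(1) mn by (intro diff_mono) (auto simp: V_def incseq_def)
        moreover have "0 \<le> u n - u m"
          using u(1) mn by (simp add: incseq_def)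
        ultimately have "norm (u n - u m) \<le> norm (v - u N)"
          by (intro norm_mono_pos)
        with v(2) show ?thesis
          by (simp add: norm_minus_commute)
      qed
      then show "\<exists>M. \<forall>m\<ge>M. \<forall>n>m. dist (u m) (u n) < e"
        unfolding dist_norm by blast
    qed
    then show "convergent u"
      by (rule Cauchy_convergent)
  qed
qed

lemma order_continuous_part_eq:
  "order_continuous_part = (monotone_convergent_part :: 'a::banach_lattice set)"
  unfolding order_continuous_part_def
  by (rule Greatest_equality)
     (auto simp: closed_monotone_convergent_part order_ideal_monotone_convergent_part
       order_continuous_norm_on_monotone_convergent_part
       dest: ideal_subset_monotone_convergent_part)

theorem order_continuous_part_greatest:
  shows "closed (order_continuous_part :: 'a::banach_lattice set)"
    and "order_ideal (order_continuous_part :: 'a set)"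
    and "order_continuous_norm_on (order_continuous_part :: 'a set)"
    and "closed I \<Longrightarrow> order_ideal I \<Longrightarrow> order_continuous_norm_on I \<Longrightarrow> I \<subseteq> (order_continuous_part :: 'a set)"
  unfolding order_continuous_part_eq
  by (auto simp: closed_monotone_convergent_part order_ideal_monotone_convergent_part
       order_continuous_norm_on_monotone_convergent_part
       dest: ideal_subset_monotone_convergent_part)


section \<open>Discrete ideals\<close>

definition discrete_element :: "'a::banach_lattice \<Rightarrow> bool"
  where "discrete_element x \<longleftrightarrow> 0 < x \<and> order_ideal hull {x} = span {x}"

text \<open>
  Discreteness of an order ideal \<open>L\<close> as a vector lattice of its own. As \<open>L\<close> is an ideal, the ideal
  generated by an element of \<open>L\<close> is the same in \<open>L\<close> as in the whole space.
\<close>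

definition discrete_ideal :: "'a::banach_lattice set \<Rightarrow> bool"
  where "discrete_ideal L \<longleftrightarrow>
    (\<exists>A\<subseteq>L. (\<forall>x\<in>A. discrete_element x) \<and> pairwise lat_disjoint A \<and>
      (\<forall>y\<in>L. (\<forall>x\<in>A. lat_disjoint y x) \<longrightarrow> y = 0))"


section \<open>Operators\<close>

definition weakly_null :: "(nat \<Rightarrow> 'a::real_normed_vector) \<Rightarrow> bool"
  where "weakly_null x \<longleftrightarrow> (\<forall>\<phi> :: 'a \<Rightarrow>\<^sub>L real. (\<lambda>n. blinfun_apply \<phi> (x n)) \<longlonglongrightarrow> 0)"

definition L_weakly_compact :: "'a::banach_lattice set \<Rightarrow> bool"
  where "L_weakly_compact A \<longleftrightarrow> A \<noteq> {} \<and> bounded A \<and>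
    (\<forall>x :: nat \<Rightarrow> 'a. range x \<subseteq> solid_hull A \<and> (\<forall>m n. m \<noteq> n \<longrightarrow> lat_disjoint (x m) (x n)) \<longrightarrow>
      (\<lambda>n. norm (x n)) \<longlonglongrightarrow> 0)"

definition Lwcc :: "('a::banach_lattice \<Rightarrow>\<^sub>L 'b::banach_lattice) \<Rightarrow> bool"
  where "Lwcc T \<longleftrightarrow> (\<forall>x. weakly_null x \<and> L_weakly_compact (range x) \<longrightarrow>
    (\<lambda>n. norm (blinfun_apply T (x n))) \<longlonglongrightarrow> 0)"

definition positive_operator :: "('a::banach_lattice \<Rightarrow>\<^sub>L 'b::banach_lattice) \<Rightarrow> bool"
  where "positive_operator T \<longleftrightarrow> (\<forall>x\<ge>0. 0 \<le> blinfun_apply T x)"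

definition regular_operator :: "('a::banach_lattice \<Rightarrow>\<^sub>L 'b::banach_lattice) \<Rightarrow> bool"
  where "regular_operator T \<longleftrightarrow>
    (\<exists>P Q. positive_operator P \<and> positive_operator Q \<and> T = P - Q)"

lift_definition dual_operator ::
    "('a::real_normed_vector \<Rightarrow>\<^sub>L 'b::real_normed_vector) \<Rightarrow> 'b dual \<Rightarrow>\<^sub>L 'a dual"
  is "\<lambda>T f. Dual (blinfun_of_dual f o\<^sub>L T)"
proof (rule bounded_linear_intro)
  fix T :: "'a \<Rightarrow>\<^sub>L 'b" and f g :: "'b dual" and r :: real
  have app: "dual_apply (Dual (blinfun_of_dual h o\<^sub>L T)) x = dual_apply h (blinfun_apply T x)" for h x
    by (simp add: dual_apply.rep_eq Dual_inverse)
  show "Dual (blinfun_of_dual (f + g) o\<^sub>L T) =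
      Dual (blinfun_of_dual f o\<^sub>L T) + Dual (blinfun_of_dual g o\<^sub>L T)"
    by (rule dual_eqI) (simp add: app dual_apply_add)
  show "Dual (blinfun_of_dual (r *\<^sub>R f) o\<^sub>L T) = r *\<^sub>R Dual (blinfun_of_dual f o\<^sub>L T)"
    by (rule dual_eqI) (simp add: app dual_apply_scaleR)
  show "norm (Dual (blinfun_of_dual f o\<^sub>L T)) \<le> norm f * norm T"
    by transfer (rule norm_blinfun_compose)
qed

lemma dual_operator_apply:
  "dual_apply (blinfun_apply (dual_operator T) f) x = dual_apply f (blinfun_apply T x)"
  by (simp add: dual_operator.rep_eq dual_apply.rep_eq Dual_inverse)

end

theory Submission
  imports Defs "HOL-Library.Diagonal_Subsequence"
begin

text \<open>
  An L-weakly compact set lies in the order continuous part \<open>E\<^sup>a\<close> and, up to an error of small norm,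
  in an order interval of it (\<open>L_weakly_compact_almost_order_bounded\<close>). All questions about L-weakly
  compact weakly null sequences are therefore questions about order intervals.

  If \<open>E\<^sup>a\<close> is discrete, every element of it is a norm limit of finite combinations of atoms, and
  the coordinates along atoms are bounded functionals. A weakly null L-weakly compact sequence then
  tends to zero in norm, and every operator on \<open>E\<close> is Lwcc (\<open>weakly_null_norm_null_if_discrete\<close>).

  Let \<open>F\<close> be order continuous and let \<open>x\<^sub>n\<close> be weakly null and L-weakly compact. If \<open>f \<bar>T x\<^sub>n\<bar>\<close>
  did not tend to zero for some \<open>f \<ge> 0\<close>, functionals \<open>g\<^sub>n\<close> in the order interval from \<open>- f\<close> to \<open>f\<close>
  would attain these values at \<open>T x\<^sub>n\<close>. As \<open>F'\<close> is order continuous, a subsequence of them is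
  weakly Cauchy; differences along it are weakly null and L-weakly compact in \<open>F'\<close>, so \<open>T'\<close> maps them
  to a norm null sequence, which contradicts their values at \<open>T x\<^sub>n\<close>. Hence \<open>\<bar>T x\<^sub>n\<bar>\<close> is weakly null.
  By regularity of \<open>T\<close> it is also almost order bounded, and an order bounded positive weakly null
  sequence in an order continuous lattice is norm null (\<open>Lwcc_if_codomain_order_continuous\<close>).

  Conversely, suppose that \<open>E\<^sup>a\<close> is not discrete and \<open>F\<close> is not order continuous. Some
  \<open>x > 0\<close> in \<open>E\<^sup>a\<close> dominates no atom, and it can be chosen with a functional that is strictly
  positive on the interval from \<open>0\<close> to \<open>x\<close>. Components can then be halved exactly, which gives an
  analogue of the Rademacher functions. From it one obtains weakly null \<open>e\<^sub>n\<close> between \<open>- x\<close> and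
  \<open>x\<close> and weak* null functionals \<open>h\<^sub>n\<close>, dominated by a single one, with \<open>h\<^sub>n e\<^sub>n\<close> bounded away from
  zero (\<open>biorthogonal_weakly_null\<close>). In \<open>F\<close> there are disjoint positive \<open>w\<^sub>n\<close>, order bounded and with
  norms bounded away from zero. The operator \<open>T z = (\<Sum>n. h\<^sub>n z *\<^sub>R w\<^sub>n)\<close> is dominated by an operator
  of rank one, hence regular, and it is not Lwcc. Its adjoint is Lwcc because it factors through
  the coefficient sequences \<open>g w\<^sub>n\<close> in \<open>\<ell>\<^sub>1\<close>, whose tails are uniformly small on L-weakly compact sets
  (\<open>non_Lwcc_operator_exists\<close>).

  Both directions extract Cauchy subsequences from an order interval, in a lattice or in its dual
  (\<open>order_bounded_Cauchy_subseq\<close>). This is weak sequential compactness in a Hilbert space: a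
  positive functional \<open>\<Phi>\<close> makes the ideal generated by \<open>u\<close> a pre-Hilbert space with the square
  of the norm of \<open>x\<close> equal to the value of \<open>\<Phi>\<close> at ``\<open>x\<^sup>2 / u\<close>'', and this expression can be written
  with lattice operations alone, as the supremum of the tangents \<open>2 t x - t\<^sup>2 u\<close>.
\<close>

section \<open>Lattice calculus and limits\<close>

text \<open>
  These rules replace infima by suprema of negatives, whereas the computations below go through
  \<open>pprt\<close> and \<open>inf\<close>.
\<close>

declare diff_inf_eq_sup [simp del] diff_sup_eq_inf [simp del]

lemma scaleR_inf_distrib:
  fixes x y :: "'a::banach_lattice"
  assumes "0 \<le> c"
  shows "c *\<^sub>R inf x y = inf (c *\<^sub>R x) (c *\<^sub>R y)"
proof (cases "c = 0")
  case False
  with assms have c: "0 < c" by simp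
  have "(1 / c) *\<^sub>R inf (c *\<^sub>R x) (c *\<^sub>R y) \<le> inf x y"
  proof (rule le_infI)
    show "(1 / c) *\<^sub>R inf (c *\<^sub>R x) (c *\<^sub>R y) \<le> x"
      using scaleR_left_mono[of "inf (c *\<^sub>R x) (c *\<^sub>R y)" "c *\<^sub>R x" "1 / c"] c by simp
    show "(1 / c) *\<^sub>R inf (c *\<^sub>R x) (c *\<^sub>R y) \<le> y"
      using scaleR_left_mono[of "inf (c *\<^sub>R x) (c *\<^sub>R y)" "c *\<^sub>R y" "1 / c"] c by simp
  qed
  then have "c *\<^sub>R (1 / c) *\<^sub>R inf (c *\<^sub>R x) (c *\<^sub>R y) \<le> c *\<^sub>R inf x y"
    using c by (intro scaleR_left_mono) auto
  then have "inf (c *\<^sub>R x) (c *\<^sub>R y) \<le> c *\<^sub>R inf x y"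
    using c by simp
  moreover have "c *\<^sub>R inf x y \<le> inf (c *\<^sub>R x) (c *\<^sub>R y)"
    using c by (intro le_infI scaleR_left_mono) auto
  ultimately show ?thesis by (rule order.antisym[rotated])
qed simp

lemma scaleR_pprt:
  fixes x :: "'a::banach_lattice"
  assumes "0 \<le> c"
  shows "pprt (c *\<^sub>R x) = c *\<^sub>R pprt x"
proof -
  have "pprt x = - inf (- x) 0" for x :: 'a
    by (simp add: pprt_def neg_inf_eq_sup)
  then show ?thesis
    using scaleR_inf_distrib[OF assms, of "- x" 0] by (simp only: scaleR_minus_right scaleR_zero_right)
qed

lemma lattice_abs_eq: "\<bar>x\<bar> = pprt x + pprt (- x)" for x :: "'a::banach_lattice"
  by (simp add: abs_prts pprt_neg)

lemma lattice_abs_scaleR: "\<bar>c *\<^sub>R x\<bar> = \<bar>c\<bar> *\<^sub>R \<bar>x\<bar>" for x :: "'a::banach_lattice"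
proof (cases "0 \<le> c")
  case True
  then show ?thesis
    using scaleR_pprt[OF True, of x] scaleR_pprt[OF True, of "- x"]
    by (simp add: lattice_abs_eq scaleR_add_right)
next
  case False
  then have "\<bar>(- c) *\<^sub>R x\<bar> = (- c) *\<^sub>R \<bar>x\<bar>"
    using scaleR_pprt[of "- c" x] scaleR_pprt[of "- c" "- x"]
    by (simp add: lattice_abs_eq scaleR_add_right)
  then show ?thesis using False by simp
qed

lemma minus_inf_eq_pprt: "x - inf x y = pprt (x - y)" for x y :: "'a::banach_lattice"
  unfolding diff_inf_eq_sup_0 pprt_def by (rule sup_commute)

lemma inf_eq_minus_pprt: "inf x y = x - pprt (x - y)" for x y :: "'a::banach_lattice"
  using minus_inf_eq_pprt[of x y] by (simp add: algebra_simps)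

lemma pprt_le_iff: "pprt x \<le> y \<longleftrightarrow> x \<le> y \<and> 0 \<le> y" for x y :: "'a::banach_lattice"
  by (simp add: pprt_def)

lemma self_le_pprt: "x \<le> pprt x" for x :: "'a::banach_lattice"
  by (simp add: pprt_def)

lemma pprt_le_abs: "pprt x \<le> \<bar>x\<bar>" for x :: "'a::banach_lattice"
  by (simp add: pprt_le_iff abs_ge_self)

lemma inf_pprt_pprt_uminus: "inf (pprt x) (pprt (- x)) = 0" for x :: "'a::banach_lattice"
proof -
  have "inf (pprt x) (pprt (- x)) = pprt x - pprt (pprt x - pprt (- x))"
    by (rule inf_eq_minus_pprt)
  then show ?thesis by (simp only: pprt_diff) simp
qed

lemma pprt_minus_pprt_minus_le: "\<bar>pprt x - pprt y\<bar> \<le> \<bar>x - y\<bar>" for x y :: "'a::banach_lattice"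
proof -
  have le: "pprt a - pprt b \<le> \<bar>a - b\<bar>" for a b :: 'a
  proof -
    have "a \<le> pprt b + \<bar>a - b\<bar>"
      using add_mono[OF self_le_pprt[of b] abs_ge_self[of "a - b"]] by simp
    then have "pprt a \<le> pprt b + \<bar>a - b\<bar>"
      by (simp add: pprt_le_iff)
    then show ?thesis by (simp add: algebra_simps)
  qed
  show ?thesis
    using le[of x y] le[of y x] by (intro abs_leI) (simp_all add: abs_minus_commute)
qed

lemma tendsto_pprt:
  fixes X :: "nat \<Rightarrow> 'a::banach_lattice"
  assumes "X \<longlonglongrightarrow> x"
  shows "(\<lambda>n. pprt (X n)) \<longlonglongrightarrow> pprt x"
proof -
  have "(\<lambda>n. norm (X n - x)) \<longlonglongrightarrow> 0"
    using assms by (simp add: tendsto_norm_zero LIM_zero)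
  moreover have "\<forall>\<^sub>F n in sequentially. norm (pprt (X n) - pprt x) \<le> norm (X n - x)"
    by (intro always_eventually allI norm_mono_abs pprt_minus_pprt_minus_le)
  ultimately have "(\<lambda>n. pprt (X n) - pprt x) \<longlonglongrightarrow> 0"
    by (rule Lim_null_comparison[rotated])
  then show ?thesis
    by (rule LIM_zero_cancel)
qed

lemma tendsto_inf:
  fixes X Y :: "nat \<Rightarrow> 'a::banach_lattice"
  assumes "X \<longlonglongrightarrow> x" "Y \<longlonglongrightarrow> y"
  shows "(\<lambda>n. inf (X n) (Y n)) \<longlonglongrightarrow> inf x y"
  unfolding inf_eq_minus_pprt by (intro tendsto_diff tendsto_pprt assms)

lemma tendsto_lattice_abs:
  fixes X :: "nat \<Rightarrow> 'a::banach_lattice"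
  assumes "X \<longlonglongrightarrow> x"
  shows "(\<lambda>n. \<bar>X n\<bar>) \<longlonglongrightarrow> \<bar>x\<bar>"
  unfolding lattice_abs_eq by (intro tendsto_add tendsto_minus tendsto_pprt assms)

lemma lattice_LIMSEQ_le:
  fixes X Y :: "nat \<Rightarrow> 'a::banach_lattice"
  assumes X: "X \<longlonglongrightarrow> x" and Y: "Y \<longlonglongrightarrow> y" and le: "\<And>n. N \<le> n \<Longrightarrow> X n \<le> Y n"
  shows "x \<le> y"
proof -
  have "(\<lambda>n. pprt (X n - Y n)) \<longlonglongrightarrow> pprt (x - y)"
    by (intro tendsto_pprt tendsto_diff X Y)
  moreover have "\<forall>\<^sub>F n in sequentially. pprt (X n - Y n) = 0"
    using eventually_ge_at_top[of N] by eventually_elim (use le in simp)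
  ultimately have "(\<lambda>n::nat. 0) \<longlonglongrightarrow> pprt (x - y)"
    by (rule Lim_transform_eventually)
  then have "pprt (x - y) = 0"
    by (simp add: LIMSEQ_const_iff)
  then show ?thesis
    by (simp flip: le_zero_iff_zero_pprt)
qed

lemma incseq_le_limit:
  fixes X :: "nat \<Rightarrow> 'a::banach_lattice"
  assumes "incseq X" "X \<longlonglongrightarrow> x"
  shows "X n \<le> x"
  by (rule lattice_LIMSEQ_le[OF tendsto_const assms(2), of n]) (use assms(1) in \<open>simp add: incseq_def\<close>)

lemma decseq_ge_limit:
  fixes X :: "nat \<Rightarrow> 'a::banach_lattice"
  assumes "decseq X" "X \<longlonglongrightarrow> x"
  shows "x \<le> X n"
  by (rule lattice_LIMSEQ_le[OF assms(2) tendsto_const, of n]) (use assms(1) in \<open>simp add: decseq_def\<close>)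

lemma inf_add_le:
  fixes x y z :: "'a::banach_lattice"
  assumes "0 \<le> x" "0 \<le> y" "0 \<le> z"
  shows "inf x (y + z) \<le> inf x y + inf x z"
proof -
  have "inf x (y + z) \<le> x + x" "inf x (y + z) \<le> x + z" "inf x (y + z) \<le> y + x" "inf x (y + z) \<le> y + z"
    using assms by (auto intro: le_infI1 le_infI2 add_increasing add_increasing2)
  then show ?thesis
    by (simp add: add_inf_distrib_left add_inf_distrib_right)
qed

lemma inf_scaleR_le:
  fixes x y :: "'a::banach_lattice"
  assumes "0 \<le> x" "0 \<le> y" "0 \<le> c"
  shows "inf x (c *\<^sub>R y) \<le> max 1 c *\<^sub>R inf x y"
proof -
  have "inf x (c *\<^sub>R y) \<le> inf (max 1 c *\<^sub>R x) (max 1 c *\<^sub>R y)"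
    using assms scaleR_right_mono[of 1 "max 1 c" x]
    by (intro inf_mono scaleR_right_mono) auto
  then show ?thesis
    by (simp add: scaleR_inf_distrib)
qed

lemma inf_scaleR_eq_0:
  fixes x y :: "'a::banach_lattice"
  assumes "inf x y = 0" "0 \<le> c"
  shows "inf x (c *\<^sub>R y) = 0"
proof -
  have xy: "0 \<le> x" "0 \<le> y"
    using inf_le1[of x y] inf_le2[of x y] assms(1) by auto
  then have "inf x (c *\<^sub>R y) \<le> 0"
    using inf_scaleR_le[of x y c] assms by simp
  then show ?thesis
    using xy assms(2) by (intro order.antisym le_infI scaleR_nonneg_nonneg) auto
qed

lemma inf_eq_0_mono:
  fixes x y :: "'a::banach_lattice"
  assumes "inf x y = 0" "0 \<le> a" "a \<le> x" "0 \<le> b" "b \<le> y"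
  shows "inf a b = 0"
  using assms inf_mono[of a x b y] by (intro order.antisym) auto

lemma inf_sum_le:
  fixes x :: "'a::banach_lattice"
  assumes "finite K" "0 \<le> x" "\<And>k. k \<in> K \<Longrightarrow> 0 \<le> y k"
  shows "inf x (\<Sum>k\<in>K. y k) \<le> (\<Sum>k\<in>K. inf x (y k))"
  using assms(1,3)
proof (induction K)
  case (insert k K)
  have "inf x (y k + sum y K) \<le> inf x (y k) + inf x (sum y K)"
    using insert assms(2) by (intro inf_add_le sum_nonneg) auto
  also have "\<dots> \<le> inf x (y k) + (\<Sum>k\<in>K. inf x (y k))"
    using insert by (intro add_left_mono) auto
  finally show ?case using insert by simp
qed (simp add: assms inf_absorb2)

lemma inf_sum_eq_0:
  fixes x :: "'a::banach_lattice"
  assumes "finite K" "0 \<le> x" "\<And>k. k \<in> K \<Longrightarrow> inf x (y k) = 0"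
  shows "inf x (\<Sum>k\<in>K. y k) = 0"
proof -
  have y: "0 \<le> y k" if "k \<in> K" for k
    using assms(3)[OF that] inf_le2[of x "y k"] by simp
  have "inf x (\<Sum>k\<in>K. y k) \<le> (\<Sum>k\<in>K. inf x (y k))"
    using assms y by (intro inf_sum_le) auto
  also have "\<dots> = 0"
    using assms by simp
  finally show ?thesis
    using assms y by (intro order.antisym le_infI sum_nonneg) auto
qed

lemma add_le_of_disjoint:
  fixes x y z :: "'a::banach_lattice"
  assumes "inf x y = 0" "x \<le> z" "y \<le> z"
  shows "x + y \<le> z"
  using assms add_eq_inf_sup[of x y] by simp

lemma sum_le_of_disjoint:
  fixes x :: "'i \<Rightarrow> 'a::banach_lattice"
  assumes "finite K" "pairwise (\<lambda>i j. inf (x i) (x j) = 0) K"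
    "\<And>i. i \<in> K \<Longrightarrow> 0 \<le> x i" "\<And>i. i \<in> K \<Longrightarrow> x i \<le> z" "0 \<le> z"
  shows "(\<Sum>i\<in>K. x i) \<le> z"
  using assms(1-4)
proof (induction K)
  case (insert k K)
  have "inf (x k) (\<Sum>i\<in>K. x i) = 0"
    using insert by (intro inf_sum_eq_0) (auto simp: pairwise_insert)
  moreover have "(\<Sum>i\<in>K. x i) \<le> z"
    using insert by (auto simp: pairwise_insert)
  ultimately show ?case
    using insert by (simp add: add_le_of_disjoint)
qed (simp add: assms)

lemma abs_minus_of_disjoint:
  fixes x y :: "'a::banach_lattice"
  assumes "inf x y = 0"
  shows "\<bar>x - y\<bar> = x + y"
proof -
  have "pprt (x - y) = x" "pprt (y - x) = y"
    using minus_inf_eq_pprt[of x y] minus_inf_eq_pprt[of y x] assms by (simp_all add: inf_commute)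
  then show ?thesis by (simp add: lattice_abs_eq)
qed

text \<open>
  The positive parts of \<open>x\<close> and \<open>y\<close> together are disjoint from their negative parts together.
\<close>

lemma abs_add_of_disjoint:
  fixes x y :: "'a::banach_lattice"
  assumes "inf \<bar>x\<bar> \<bar>y\<bar> = 0"
  shows "\<bar>x + y\<bar> = \<bar>x\<bar> + \<bar>y\<bar>"
proof -
  define p where "p = pprt x + pprt y"
  define q where "q = pprt (- x) + pprt (- y)"
  have dis: "inf a b = 0" if "0 \<le> a" "a \<le> \<bar>x\<bar>" "0 \<le> b" "b \<le> \<bar>y\<bar>" for a b
    using inf_eq_0_mono[OF assms that] .
  have m: "pprt z \<le> \<bar>z\<bar>" "pprt (- z) \<le> \<bar>z\<bar>" for z :: 'a
    using pprt_le_abs[of z] pprt_le_abs[of "- z"] by auto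
  have "inf (pprt x) q \<le> inf (pprt x) (pprt (- x)) + inf (pprt x) (pprt (- y))"
    unfolding q_def by (intro inf_add_le) auto
  also have "\<dots> = 0"
    using dis[of "pprt x" "pprt (- y)"] m by (simp add: inf_pprt_pprt_uminus)
  finally have 1: "inf q (pprt x) \<le> 0" by (simp add: inf_commute)
  have "inf (pprt y) q \<le> inf (pprt y) (pprt (- x)) + inf (pprt y) (pprt (- y))"
    unfolding q_def by (intro inf_add_le) auto
  also have "\<dots> = 0"
    using dis[of "pprt (- x)" "pprt y"] m by (simp add: inf_pprt_pprt_uminus inf_commute)
  finally have 2: "inf q (pprt y) \<le> 0" by (simp add: inf_commute)
  have q: "0 \<le> q" "0 \<le> p" unfolding q_def p_def by (auto intro: add_nonneg_nonneg)
  have "inf q p \<le> inf q (pprt x) + inf q (pprt y)"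
    unfolding p_def by (intro inf_add_le q) auto
  also have "\<dots> \<le> 0 + 0"
    by (intro add_mono 1 2)
  finally have "inf p q = 0"
    using q by (intro order.antisym) (auto simp: inf_commute)
  then have "\<bar>p - q\<bar> = p + q"
    by (rule abs_minus_of_disjoint)
  moreover have "p - q = x + y"
    using pprt_diff[of x] pprt_diff[of y] unfolding p_def q_def by (metis add_diff_add)
  ultimately show ?thesis
    unfolding p_def q_def by (simp add: lattice_abs_eq algebra_simps)
qed

lemma pprt_minus_ge: "0 \<le> c \<Longrightarrow> pprt b \<le> pprt (b - c) + c" for b c :: "'a::banach_lattice"
  using self_le_pprt[of "b - c"] by (simp add: pprt_le_iff diff_le_eq add_nonneg_nonneg)

lemma le_add_pprt_minus: "a \<le> u + pprt (a - u)" for a u :: "'a::banach_lattice"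
  using self_le_pprt[of "a - u"] by (simp add: algebra_simps)

lemma small_factor:
  fixes B e :: real
  assumes "0 \<le> B" "0 < e"
  obtains d where "0 < d" "d * B \<le> e"
proof (rule that[of "e / (B + 1)"])
  show "e / (B + 1) * B \<le> e"
    using assms by (simp add: divide_le_eq algebra_simps)
qed (use assms in simp)

lemma not_tendsto_zero_subseq:
  fixes X :: "nat \<Rightarrow> 'a::real_normed_vector"
  assumes "\<not> X \<longlonglongrightarrow> 0"
  obtains e r where "0 < e" "strict_mono r" "\<And>n::nat. e \<le> norm (X (r n))"
proof -
  obtain e where e: "0 < e" and inf: "\<forall>N. \<exists>n\<ge>N. e \<le> norm (X n)"
    using assms by (auto simp: LIMSEQ_iff not_less)
  have "infinite {n. e \<le> norm (X n)}"
    using inf unfolding infinite_nat_iff_unbounded_le by blast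
  then obtain r :: "nat \<Rightarrow> nat" where "strict_mono r" "\<forall>n. r n \<in> {n. e \<le> norm (X n)}"
    by (rule infinite_enumerate[THEN exE]) auto
  with e show ?thesis by (intro that[of e r]) auto
qed

lemma tendsto_zero_by_subseqs:
  fixes X :: "nat \<Rightarrow> 'a::real_normed_vector"
  assumes "\<And>r :: nat \<Rightarrow> nat. strict_mono r \<Longrightarrow> \<exists>s. strict_mono s \<and> (\<lambda>n. X (r (s n))) \<longlonglongrightarrow> 0"
  shows "X \<longlonglongrightarrow> 0"
proof (rule ccontr)
  assume "\<not> ?thesis"
  then obtain e r where er: "0 < e" "strict_mono r" "\<And>n::nat. e \<le> norm (X (r n))"
    by (rule not_tendsto_zero_subseq) blast
  obtain s where "strict_mono s" "(\<lambda>n. X (r (s n))) \<longlonglongrightarrow> 0"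
    using assms er(2) by blast
  then have "e \<le> norm (0::'a)"
    using er(3) by (intro LIMSEQ_le_const[OF tendsto_norm]) auto
  with er(1) show False by simp
qed

lemma nonneg_term_le_suminf:
  fixes f :: "nat \<Rightarrow> 'a::banach_lattice"
  assumes "summable f" "\<And>n. 0 \<le> f n"
  shows "f n \<le> suminf f"
proof -
  have "f n \<le> (\<Sum>i<Suc n. f i)"
    using assms(2) by (simp add: sum_nonneg)
  also have "\<dots> \<le> suminf f"
  proof (rule incseq_le_limit)
    show "incseq (\<lambda>n. \<Sum>i<n. f i)"
      using assms(2) by (intro incseq_SucI) simp
    show "(\<lambda>n. \<Sum>i<n. f i) \<longlonglongrightarrow> suminf f"
      by (rule summable_LIMSEQ[OF assms(1)])
  qed
  finally show ?thesis .
qed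

lemma summable_geometric_scaleR:
  fixes a :: "nat \<Rightarrow> 'a::banach"
  assumes "\<And>n. norm (a n) \<le> M"
  shows "summable (\<lambda>n. (1 / 2) ^ n *\<^sub>R a n)"
proof (rule summable_comparison_test)
  show "\<exists>N. \<forall>n\<ge>N. norm ((1 / 2) ^ n *\<^sub>R a n) \<le> (1 / 2) ^ n * M"
    using assms by (auto intro!: mult_left_mono)
  show "summable (\<lambda>n. (1 / 2) ^ n * M)"
    by (intro summable_mult2 summable_geometric) simp
qed

section \<open>L-weak compactness and the order continuous part\<close>

text \<open>
  Upper bounds for the members of \<open>S\<close> are taken from these sums: by rule induction they lie in every
  order ideal that contains \<open>S\<close>.
\<close>

inductive_set abs_sums :: "'a::banach_lattice set \<Rightarrow> 'a set" for S where
  zero: "0 \<in> abs_sums S"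
| add: "\<sigma> \<in> abs_sums S \<Longrightarrow> s \<in> S \<Longrightarrow> \<sigma> + \<bar>s\<bar> \<in> abs_sums S"

lemma abs_sums_nonneg: "\<sigma> \<in> abs_sums S \<Longrightarrow> 0 \<le> \<sigma>"
  by (induction rule: abs_sums.induct) auto

lemma solid_hull_abs_le: "s \<in> S \<Longrightarrow> \<bar>y\<bar> \<le> \<bar>s\<bar> \<Longrightarrow> y \<in> solid_hull S"
  unfolding solid_hull_def by blast

text \<open>
  If the conclusion fails, there are \<open>x\<^sub>n\<close> in \<open>S\<close> such that \<open>\<bar>x\<^sub>n\<bar>\<close> exceeds \<open>4 ^ n\<close> times the sum of
  its predecessors by more than \<open>e\<close> in norm. Let \<open>b\<close> be the sum of all \<open>\<bar>x\<^sub>n\<bar> / 2 ^ n\<close>. If \<open>b / 2 ^ n\<close> is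
  subtracted as well, the excesses still do not tend to zero, and they become disjoint: for
  \<open>m < n\<close>, the \<open>n\<close>-th one is at most \<open>pprt x\<close> and the \<open>m\<close>-th one at most a multiple of
  \<open>pprt (- x)\<close>, where \<open>x = \<bar>x\<^sub>n\<bar> - 4 ^ n *\<^sub>R \<bar>x\<^sub>m\<bar>\<close>.
\<close>

lemma almost_order_bounded_if_disjoint_null:
  fixes S :: "'a::banach_lattice set"
  assumes bdd: "\<And>s. s \<in> S \<Longrightarrow> norm s \<le> M"
    and null: "\<And>z :: nat \<Rightarrow> 'a. (\<And>n. z n \<in> solid_hull S) \<Longrightarrow>
      (\<And>m n. m \<noteq> n \<Longrightarrow> lat_disjoint (z m) (z n)) \<Longrightarrow> (\<lambda>n. norm (z n)) \<longlonglongrightarrow> 0"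
    and e: "0 < e"
  shows "\<exists>\<sigma>\<in>abs_sums S. \<exists>C\<ge>0. \<forall>s\<in>S. norm (pprt (\<bar>s\<bar> - C *\<^sub>R \<sigma>)) \<le> e"
proof (rule ccontr)
  assume "\<not> ?thesis"
  then have H: "\<exists>s\<in>S. e < norm (pprt (\<bar>s\<bar> - C *\<^sub>R \<sigma>))" if "\<sigma> \<in> abs_sums S" "0 \<le> C" for \<sigma> C
    using that by (meson not_le)
  define P where "P n p \<longleftrightarrow> fst p \<in> S \<and> snd p \<in> abs_sums S \<and>
    e < norm (pprt (\<bar>fst p\<bar> - 4 ^ n *\<^sub>R snd p))" for n :: nat and p :: "'a \<times> 'a"
  have "\<exists>p. P 0 p"
  proof -
    obtain s where "s \<in> S" "e < norm (pprt (\<bar>s\<bar> - 4 ^ 0 *\<^sub>R 0))"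
      using H[OF abs_sums.zero, of "4 ^ 0"] by auto
    then show ?thesis
      unfolding P_def by (intro exI[of _ "(s, 0)"]) (simp only: fst_conv snd_conv abs_sums.zero simp_thms)
  qed
  moreover have "\<exists>q. P (Suc n) q \<and> snd q = snd p + \<bar>fst p\<bar>" if "P n p" for n p
  proof -
    have \<sigma>: "snd p + \<bar>fst p\<bar> \<in> abs_sums S"
      using that unfolding P_def by (intro abs_sums.add) auto
    obtain s where "s \<in> S" "e < norm (pprt (\<bar>s\<bar> - 4 ^ Suc n *\<^sub>R (snd p + \<bar>fst p\<bar>)))"
      using H[OF \<sigma>, of "4 ^ Suc n"] by auto
    with \<sigma> show ?thesis unfolding P_def
      by (intro exI[of _ "(s, snd p + \<bar>fst p\<bar>)"]) (simp only: fst_conv snd_conv simp_thms)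
  qed
  ultimately obtain p where p: "\<And>n. P n (p n)" and rec: "\<And>n. snd (p (Suc n)) = snd (p n) + \<bar>fst (p n)\<bar>"
    using dependent_nat_choice[of P "\<lambda>_ p q. snd q = snd p + \<bar>fst p\<bar>"] by blast
  define a where "a n = \<bar>fst (p n)\<bar>" for n
  define \<sigma> where "\<sigma> n = snd (p n)" for n
  have a: "0 \<le> a n" "fst (p n) \<in> S" "norm (a n) \<le> M" for n
    using p[of n] bdd unfolding P_def a_def by auto
  have \<sigma>0: "0 \<le> \<sigma> n" for n
    using p[of n] unfolding P_def \<sigma>_def by (auto intro: abs_sums_nonneg)
  have large: "e < norm (pprt (a n - 4 ^ n *\<^sub>R \<sigma> n))" for n
    using p[of n] unfolding P_def a_def \<sigma>_def by blast
  have \<sigma>Suc: "\<sigma> (Suc n) = \<sigma> n + a n" for n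
    using rec unfolding \<sigma>_def a_def .
  have "incseq \<sigma>"
    by (intro incseq_SucI) (simp add: \<sigma>Suc a)
  have a_le: "a m \<le> \<sigma> n" if "m < n" for m n
  proof -
    have "a m \<le> \<sigma> (Suc m)" by (simp add: \<sigma>Suc \<sigma>0)
    also have "\<dots> \<le> \<sigma> n" using \<open>incseq \<sigma>\<close> that by (auto simp: incseq_def)
    finally show ?thesis .
  qed
  have summ: "summable (\<lambda>n. (1 / 2) ^ n *\<^sub>R a n)"
    using a(3) by (rule summable_geometric_scaleR)
  define b where "b = (\<Sum>n. (1 / 2) ^ n *\<^sub>R a n)"
  have b_ge: "(1 / 2) ^ n *\<^sub>R a n \<le> b" for n
    unfolding b_def using a by (intro nonneg_term_le_suminf summ scaleR_nonneg_nonneg) auto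
  have b0: "0 \<le> b"
    using b_ge[of 0] a(1)[of 0] by simp
  define z where "z n = pprt (a n - 4 ^ n *\<^sub>R \<sigma> n - (1 / 2) ^ n *\<^sub>R b)" for n
  have z0: "0 \<le> z n" for n by (simp add: z_def)
  have z_le: "z n \<le> a n" for n
  proof -
    have "a n - 4 ^ n *\<^sub>R \<sigma> n - (1 / 2) ^ n *\<^sub>R b \<le> a n - 0 - 0"
      using \<sigma>0[of n] b0 by (intro diff_mono scaleR_nonneg_nonneg) auto
    then show ?thesis using a(1)[of n] unfolding z_def by (simp add: pprt_le_iff)
  qed
  have dis: "inf (z m) (z n) = 0" if mn: "m < n" for m n
  proof -
    define x where "x = a n - 4 ^ n *\<^sub>R a m"
    have 1: "z n \<le> pprt x"
    proof -
      have "4 ^ n *\<^sub>R a m \<le> 4 ^ n *\<^sub>R \<sigma> n"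
        using a_le[OF mn] by (intro scaleR_left_mono) auto
      moreover have "0 \<le> (1 / 2) ^ n *\<^sub>R b"
        using b0 by (intro scaleR_nonneg_nonneg) auto
      ultimately have "a n - 4 ^ n *\<^sub>R \<sigma> n - (1 / 2) ^ n *\<^sub>R b \<le> a n - 4 ^ n *\<^sub>R a m - 0"
        by (intro diff_mono) auto
      then show ?thesis unfolding z_def x_def by (intro pprt_mono) simp
    qed
    have 2: "z m \<le> (1 / 2) ^ (m + n) *\<^sub>R pprt (- x)"
    proof -
      have "(1 / 2) ^ m *\<^sub>R ((1 / 2) ^ n *\<^sub>R a n) \<le> (1 / 2) ^ m *\<^sub>R b"
        by (intro scaleR_left_mono b_ge) auto
      moreover have "0 \<le> 4 ^ m *\<^sub>R \<sigma> m"
        using \<sigma>0 by (intro scaleR_nonneg_nonneg) auto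
      moreover have "a m \<le> (1 / 2) ^ (m + n) *\<^sub>R 4 ^ n *\<^sub>R a m"
      proof -
        have "(2::real) ^ (m + n) \<le> 2 ^ (2 * n)"
          using mn by (intro power_increasing) auto
        moreover have "(4::real) ^ n = 2 ^ (2 * n)"
          by (simp add: power_mult)
        ultimately have "1 \<le> (1 / 2) ^ (m + n) * (4::real) ^ n"
          by (simp add: power_divide)
        from scaleR_right_mono[OF this a(1)] show ?thesis by simp
      qed
      ultimately have "a m - 4 ^ m *\<^sub>R \<sigma> m - (1 / 2) ^ m *\<^sub>R b
          \<le> (1 / 2) ^ (m + n) *\<^sub>R 4 ^ n *\<^sub>R a m - 0 - (1 / 2) ^ m *\<^sub>R ((1 / 2) ^ n *\<^sub>R a n)"
        by (intro diff_mono)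
      also have "\<dots> = (1 / 2) ^ (m + n) *\<^sub>R (- x)"
        unfolding x_def by (simp add: scaleR_diff_right power_add)
      finally have "z m \<le> pprt ((1 / 2) ^ (m + n) *\<^sub>R (- x))"
        unfolding z_def by (rule pprt_mono)
      also have "\<dots> = (1 / 2) ^ (m + n) *\<^sub>R pprt (- x)"
        by (rule scaleR_pprt) simp
      finally show ?thesis .
    qed
    have "inf (pprt x) ((1 / 2) ^ (m + n) *\<^sub>R pprt (- x)) = 0"
      by (intro inf_scaleR_eq_0 inf_pprt_pprt_uminus) simp
    from inf_eq_0_mono[OF this z0 1 z0 2] show ?thesis by (simp add: inf_commute)
  qed
  have "(\<lambda>n. norm (z n)) \<longlonglongrightarrow> 0"
  proof (rule null)
    show "z n \<in> solid_hull S" for n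
      using a(2)[of n] by (rule solid_hull_abs_le) (use z0[of n] z_le[of n] in \<open>simp add: a_def\<close>)
    show "lat_disjoint (z m) (z n)" if "m \<noteq> n" for m n
      using dis[of m n] dis[of n m] that z0
      by (cases "m < n") (auto simp: lat_disjoint_def inf_commute)
  qed
  moreover have "(\<lambda>n. norm ((1 / 2) ^ n *\<^sub>R b)) \<longlonglongrightarrow> 0"
  proof -
    have "(\<lambda>n. (1 / 2) ^ n * norm b) \<longlonglongrightarrow> 0 * norm b"
      by (intro tendsto_mult tendsto_const LIMSEQ_realpow_zero) auto
    then show ?thesis by simp
  qed
  ultimately have "(\<lambda>n. norm (z n) + norm ((1 / 2) ^ n *\<^sub>R b)) \<longlonglongrightarrow> 0 + 0"
    by (rule tendsto_add)
  moreover have "e \<le> norm (z n) + norm ((1 / 2) ^ n *\<^sub>R b)" for n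
  proof -
    have "pprt (a n - 4 ^ n *\<^sub>R \<sigma> n) \<le> z n + (1 / 2) ^ n *\<^sub>R b"
      unfolding z_def using b0 by (intro pprt_minus_ge scaleR_nonneg_nonneg) auto
    then have "norm (pprt (a n - 4 ^ n *\<^sub>R \<sigma> n)) \<le> norm (z n + (1 / 2) ^ n *\<^sub>R b)"
      by (intro norm_mono_pos) auto
    then show ?thesis
      using large[of n] norm_triangle_ineq[of "z n" "(1 / 2) ^ n *\<^sub>R b"] by linarith
  qed
  ultimately have "e \<le> 0 + 0"
    using LIMSEQ_le_const by blast
  with e show False by simp
qed

text \<open>
  For \<open>N = 1\<close> the hypothesis says that the terms are pairwise disjoint. The induction on \<open>N\<close> uses that
  the meets with a fixed term satisfy the hypothesis for a smaller \<open>N\<close>, hence tend to zero. So the terms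
  are asymptotically disjoint from every finite sum of them, whereas up to a small error each is
  below a multiple of one such sum.
\<close>

lemma N_wise_disjoint_null:
  fixes x :: "'a::banach_lattice" and e :: "nat \<Rightarrow> 'a"
  assumes null: "\<And>z :: nat \<Rightarrow> 'a. (\<And>n. \<bar>z n\<bar> \<le> x) \<Longrightarrow>
      (\<And>m n. m \<noteq> n \<Longrightarrow> lat_disjoint (z m) (z n)) \<Longrightarrow> (\<lambda>n. norm (z n)) \<longlonglongrightarrow> 0"
    and e: "\<And>k. 0 \<le> e k" "\<And>k. e k \<le> x"
    and N: "\<And>K w. finite K \<Longrightarrow> card K = Suc N \<Longrightarrow> 0 \<le> w \<Longrightarrow> (\<And>k. k \<in> K \<Longrightarrow> w \<le> e k) \<Longrightarrow> w = 0"
  shows "e \<longlonglongrightarrow> 0"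
  using e N
proof (induction N arbitrary: e)
  case 0
  have "e k = 0" for k
    using 0(3)[of "{k}" "e k"] 0(1)[of k] by auto
  then have "e = (\<lambda>_. 0)" by auto
  then show ?case by simp
next
  case (Suc N)
  have single: "(\<lambda>k. inf (e k) (e j)) \<longlonglongrightarrow> 0" for j
  proof -
    have "(\<lambda>k. inf (e (k + Suc j)) (e j)) \<longlonglongrightarrow> 0"
    proof (rule Suc.IH)
      show "0 \<le> inf (e (k + Suc j)) (e j)" "inf (e (k + Suc j)) (e j) \<le> x" for k
        using Suc.prems(1,2) by (auto intro: le_infI1)
      fix K :: "nat set" and w
      assume K: "finite K" "card K = Suc N" and w: "0 \<le> w" "\<And>k. k \<in> K \<Longrightarrow> w \<le> inf (e (k + Suc j)) (e j)"
      obtain k0 where k0: "k0 \<in> K" using K by fastforce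
      show "w = 0"
      proof (rule Suc.prems(3)[of "insert j ((\<lambda>k. k + Suc j) ` K)"])
        have "card ((\<lambda>k. k + Suc j) ` K) = Suc N"
          using K by (subst card_image) (auto simp: inj_on_def)
        then show "card (insert j ((\<lambda>k. k + Suc j) ` K)) = Suc (Suc N)"
          using K by (subst card_insert_disjoint) auto
        show "w \<le> e k" if "k \<in> insert j ((\<lambda>k. k + Suc j) ` K)" for k
          using that w(2) w(2)[OF k0] by auto
      qed (use K w in auto)
    qed
    then show ?thesis by (rule LIMSEQ_offset)
  qed
  have against: "(\<lambda>k. inf (e k) \<sigma>) \<longlonglongrightarrow> 0" if "\<sigma> \<in> abs_sums (range e)" for \<sigma>
    using that
  proof induction
    case zero
    then show ?case using Suc.prems(1) by (simp add: inf_absorb2)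
  next
    case (add \<sigma> s)
    then obtain j where s: "s = e j" by blast
    have \<sigma>: "0 \<le> \<sigma>" using add(1) by (rule abs_sums_nonneg)
    have "(\<lambda>k. inf (e k) \<sigma> + inf (e k) (e j)) \<longlonglongrightarrow> 0 + 0"
      by (intro tendsto_add add.IH single)
    then have "(\<lambda>k. norm (inf (e k) \<sigma> + inf (e k) (e j))) \<longlonglongrightarrow> 0"
      by (simp add: tendsto_norm_zero)
    moreover have "\<forall>\<^sub>F k in sequentially.
        norm (inf (e k) (\<sigma> + \<bar>s\<bar>)) \<le> norm (inf (e k) \<sigma> + inf (e k) (e j))"
      using Suc.prems(1) \<sigma> s
      by (intro always_eventually allI norm_mono_pos) (auto intro: inf_add_le add_nonneg_nonneg)
    ultimately show ?case
      by (rule Lim_null_comparison[rotated])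
  qed
  show ?case
  proof (rule ccontr)
    assume "\<not> ?case"
    then obtain d r where d: "0 < d" "strict_mono r" "\<And>n::nat. d \<le> norm (e (r n))"
      by (rule not_tendsto_zero_subseq) blast
    have "\<exists>\<sigma>\<in>abs_sums (range e). \<exists>C\<ge>0. \<forall>s\<in>range e. norm (pprt (\<bar>s\<bar> - C *\<^sub>R \<sigma>)) \<le> d / 2"
    proof (rule almost_order_bounded_if_disjoint_null)
      show "norm s \<le> norm x" if "s \<in> range e" for s
        using that Suc.prems(1,2) by (auto intro: norm_mono_pos)
      fix z :: "nat \<Rightarrow> 'a"
      assume z: "\<And>n. z n \<in> solid_hull (range e)" "\<And>m n. m \<noteq> n \<Longrightarrow> lat_disjoint (z m) (z n)"
      show "(\<lambda>n. norm (z n)) \<longlonglongrightarrow> 0"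
      proof (rule null)
        fix n
        obtain k where "\<bar>z n\<bar> \<le> \<bar>e k\<bar>"
          using z(1)[of n] unfolding solid_hull_def by blast
        also have "\<dots> \<le> x" using Suc.prems(1,2) by simp
        finally show "\<bar>z n\<bar> \<le> x" .
      qed (use z in auto)
    qed (use d in auto)
    then obtain \<sigma> C where \<sigma>: "\<sigma> \<in> abs_sums (range e)" "0 \<le> C"
      "\<And>k. norm (pprt (e k - C *\<^sub>R \<sigma>)) \<le> d / 2"
      using Suc.prems(1) by auto
    have \<sigma>0: "0 \<le> \<sigma>" using \<sigma>(1) by (rule abs_sums_nonneg)
    have "norm (e k) \<le> max 1 C * norm (inf (e k) \<sigma>) + d / 2" for k
    proof -
      have "e k = inf (e k) (C *\<^sub>R \<sigma>) + pprt (e k - C *\<^sub>R \<sigma>)"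
        by (simp add: inf_eq_minus_pprt)
      then have "norm (e k) \<le> norm (inf (e k) (C *\<^sub>R \<sigma>)) + norm (pprt (e k - C *\<^sub>R \<sigma>))"
        by (metis norm_triangle_ineq)
      also have "norm (inf (e k) (C *\<^sub>R \<sigma>)) \<le> norm (max 1 C *\<^sub>R inf (e k) \<sigma>)"
        using Suc.prems(1) \<sigma>(2) \<sigma>0
        by (intro norm_mono_pos inf_scaleR_le le_infI scaleR_nonneg_nonneg) auto
      also have "\<dots> = max 1 C * norm (inf (e k) \<sigma>)"
        by simp
      finally show ?thesis using \<sigma>(3)[of k] by linarith
    qed
    then have "d \<le> max 1 C * norm (inf (e (r n)) \<sigma>) + d / 2" for n
      using d(3)[of n] order_trans by blast
    moreover have "(\<lambda>n. max 1 C * norm (inf (e (r n)) \<sigma>) + d / 2) \<longlonglongrightarrow> max 1 C * 0 + d / 2"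
      using LIMSEQ_subseq_LIMSEQ[OF against[OF \<sigma>(1)] d(2)]
      by (intro tendsto_intros tendsto_norm_zero) (simp add: o_def)
    ultimately have "d \<le> max 1 C * 0 + d / 2"
      by (intro LIMSEQ_le_const) auto
    with d(1) show False by simp
  qed
qed

text \<open>
  The increments of an increasing sequence that is not Cauchy stay large in norm along a subsequence,
  but their sums are at most \<open>\<bar>x\<bar>\<close>. Hence they exceed \<open>\<eta> *\<^sub>R \<bar>x\<bar>\<close> at most \<open>1 / \<eta>\<close> at a time, and what is
  above \<open>\<eta> *\<^sub>R \<bar>x\<bar>\<close> forms a sequence without common lower bounds for many terms.
\<close>

lemma mem_monotone_convergent_part_if_disjoint_null:
  fixes x :: "'a::banach_lattice"
  assumes null: "\<And>z :: nat \<Rightarrow> 'a. (\<And>n. \<bar>z n\<bar> \<le> \<bar>x\<bar>) \<Longrightarrow>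
      (\<And>m n. m \<noteq> n \<Longrightarrow> lat_disjoint (z m) (z n)) \<Longrightarrow> (\<lambda>n. norm (z n)) \<longlonglongrightarrow> 0"
  shows "x \<in> monotone_convergent_part"
proof (rule monotone_convergent_partI)
  fix u :: "nat \<Rightarrow> 'a"
  assume u: "incseq u" "\<And>n. 0 \<le> u n" "\<And>n. u n \<le> \<bar>x\<bar>"
  show "convergent u"
  proof (rule ccontr)
    assume "\<not> convergent u"
    then have "\<not> Cauchy u" using Cauchy_convergent by blast
    then obtain c where c: "0 < c" "\<And>M. \<exists>m\<ge>M. \<exists>n\<ge>M. c \<le> norm (u m - u n)"
      unfolding Cauchy_iff by (auto simp: not_less)
    \<comment> \<open>The triangle inequality through \<open>u M\<close> costs a factor two.\<close>
    have jump: "\<exists>n>M. c / 2 \<le> norm (u n - u M)" for M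
    proof (rule ccontr)
      assume "\<not> ?thesis"
      then have small: "norm (u n - u M) < c / 2" if "M \<le> n" for n
        using that c(1) by (cases "n = M") (auto simp: not_le)
      obtain m n where mn: "M \<le> m" "M \<le> n" "c \<le> norm (u m - u n)"
        using c(2) by blast
      have "norm (u m - u n) \<le> norm (u m - u M) + norm (u n - u M)"
        using norm_triangle_ineq4[of "u m - u M" "u n - u M"] by simp
      then show False using small[OF mn(1)] small[OF mn(2)] mn(3) by linarith
    qed
    then obtain g where g: "\<And>M. M < g M" "\<And>M. c / 2 \<le> norm (u (g M) - u M)"
      by metis
    define r where "r n = (g ^^ n) 0" for n
    have r: "r n < r (Suc n)" "c / 2 \<le> norm (u (r (Suc n)) - u (r n))" for n
      using g by (auto simp: r_def)
    define d where "d n = u (r (Suc n)) - u (r n)" for n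
    have "0 < c / 4" using c(1) by simp
    \<comment> \<open>The part of an increment below \<open>\<eta> *\<^sub>R \<bar>x\<bar>\<close> has at most half of its norm, which is at least \<open>c / 2\<close>.\<close>
    then obtain \<eta> where \<eta>: "0 < \<eta>" and \<eta>x: "\<eta> * norm x \<le> c / 4"
      by (rule small_factor[OF norm_ge_zero[of x]])
    define e where "e n = pprt (d n - \<eta> *\<^sub>R \<bar>x\<bar>)" for n
    have d0: "0 \<le> d n" for n
      using u(1) r(1)[of n] by (auto simp: d_def incseq_def)
    have dsum: "(\<Sum>k\<in>K. d k) \<le> \<bar>x\<bar>" if K: "finite K" for K
    proof -
      obtain m where "K \<subseteq> {..<m}" using K finite_nat_iff_bounded[of K] by auto
      then have "(\<Sum>k\<in>K. d k) \<le> (\<Sum>k<m. d k)"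
        by (intro sum_mono2) (auto simp: d0)
      also have "\<dots> = u (r m) - u (r 0)"
        unfolding d_def by (rule sum_lessThan_telescope)
      also have "\<dots> \<le> \<bar>x\<bar> - 0" by (intro diff_mono u)
      finally show ?thesis by simp
    qed
    obtain N where N: "1 / \<eta> \<le> real N" using real_arch_simple by blast
    have "e \<longlonglongrightarrow> 0"
    proof (rule N_wise_disjoint_null[of "\<bar>x\<bar>" e N])
      show "e k \<le> \<bar>x\<bar>" for k
      proof -
        have "d k - \<eta> *\<^sub>R \<bar>x\<bar> \<le> \<bar>x\<bar> - 0"
          using dsum[of "{k}"] \<eta> by (intro diff_mono scaleR_nonneg_nonneg) auto
        then show ?thesis unfolding e_def by (simp add: pprt_le_iff)
      qed
    next
      fix K :: "nat set" and w
      assume K: "finite K" "card K = Suc N" and w: "0 \<le> w" "\<And>k. k \<in> K \<Longrightarrow> w \<le> e k"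
      define b where "b k = d k - \<eta> *\<^sub>R \<bar>x\<bar>" for k
      have "(\<Sum>k\<in>K. b k) = (\<Sum>k\<in>K. d k) - (real (Suc N) * \<eta>) *\<^sub>R \<bar>x\<bar>"
        unfolding b_def by (simp add: sum_subtractf K scaleR_left_distrib algebra_simps sum_constant_scaleR)
      also have "\<dots> \<le> \<bar>x\<bar> - 1 *\<^sub>R \<bar>x\<bar>"
      proof (intro diff_mono dsum K scaleR_right_mono)
        have "1 \<le> real N * \<eta>" using N \<eta> by (simp add: field_simps)
        then show "1 \<le> real (Suc N) * \<eta>" using \<eta> by (simp add: algebra_simps)
      qed auto
      finally have "(\<Sum>k\<in>K. pprt (b k) - pprt (- b k)) \<le> 0"
        by (simp only: pprt_diff) simp
      then have le: "(\<Sum>k\<in>K. pprt (b k)) \<le> (\<Sum>k\<in>K. pprt (- b k))"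
        by (simp add: sum_subtractf)
      obtain k where k: "k \<in> K" using K by (metis card.empty ex_in_conv nat.distinct(1))
      have "w \<le> e k" by (rule w(2)[OF k])
      also have "\<dots> \<le> (\<Sum>k\<in>K. e k)"
        using sum_mono2[of K "{k}" e] K k by (auto simp: e_def)
      also have "\<dots> \<le> (\<Sum>k\<in>K. pprt (- b k))"
        using le by (simp add: e_def b_def)
      finally have "w = inf w (\<Sum>k\<in>K. pprt (- b k))"
        by (simp add: inf_absorb1)
      also have "\<dots> = 0"
      proof (intro inf_sum_eq_0 K w)
        fix k assume "k \<in> K"
        then have "w \<le> pprt (b k)" using w(2) unfolding e_def b_def by blast
        then show "inf w (pprt (- b k)) = 0"
          using inf_eq_0_mono[OF inf_pprt_pprt_uminus w(1), of "b k" "pprt (- b k)"] by simp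
      qed
      finally show "w = 0" .
    qed (use null in \<open>auto simp: e_def\<close>)
    moreover have "c / 4 \<le> norm (e n)" for n
    proof -
      have "d n \<le> e n + \<eta> *\<^sub>R \<bar>x\<bar>"
        unfolding e_def using le_add_pprt_minus[of "d n" "\<eta> *\<^sub>R \<bar>x\<bar>"] by (simp add: add.commute)
      then have "norm (d n) \<le> norm (e n + \<eta> *\<^sub>R \<bar>x\<bar>)"
        using d0 by (intro norm_mono_pos)
      also have "\<dots> \<le> norm (e n) + norm (\<eta> *\<^sub>R \<bar>x\<bar>)"
        by (rule norm_triangle_ineq)
      finally show ?thesis
        using r(2)[of n] \<eta> \<eta>x unfolding d_def by simp
    qed
    ultimately have "c / 4 \<le> norm (0::'a)"
      by (intro LIMSEQ_le_const[OF tendsto_norm]) auto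
    with c(1) show False by simp
  qed
qed

text \<open>
  Partial sums of disjoint elements below \<open>\<bar>x\<bar>\<close> are again below \<open>\<bar>x\<bar>\<close>, so they converge.
\<close>

lemma abs_le_part_disjoint_null:
  fixes x :: "'a::banach_lattice"
  assumes x: "x \<in> monotone_convergent_part" and z: "\<And>n :: nat. \<bar>z n\<bar> \<le> \<bar>x\<bar>"
    and dis: "\<And>m n. m \<noteq> n \<Longrightarrow> lat_disjoint (z m) (z n)"
  shows "z \<longlonglongrightarrow> 0"
proof -
  define s where "s n = (\<Sum>i<n. \<bar>z i\<bar>)" for n
  have "convergent s"
  proof (rule monotone_convergent_partD[OF x])
    show "monoseq s"
      by (intro incseq_imp_monoseq incseq_SucI) (simp add: s_def)
    show "0 \<le> s n" for n
      unfolding s_def by (intro sum_nonneg) auto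
    show "s n \<le> \<bar>x\<bar>" for n
      unfolding s_def using z dis
      by (intro sum_le_of_disjoint) (auto simp: pairwise_def lat_disjoint_def)
  qed
  then obtain l where l: "s \<longlonglongrightarrow> l" by (auto simp: convergent_def)
  have "(\<lambda>n. s (Suc n) - s n) \<longlonglongrightarrow> l - l"
    by (intro tendsto_diff l LIMSEQ_Suc)
  then have "(\<lambda>n. \<bar>z n\<bar>) \<longlonglongrightarrow> 0"
    by (simp add: s_def)
  then have "(\<lambda>n. norm \<bar>z n\<bar>) \<longlonglongrightarrow> 0"
    by (rule tendsto_norm_zero)
  then show ?thesis
    by (simp add: tendsto_norm_zero_iff)
qed

lemma L_weakly_compact_order_bounded:
  fixes x :: "'a::banach_lattice"
  assumes x: "x \<in> monotone_convergent_part" and A: "A \<noteq> {}" "\<And>a. a \<in> A \<Longrightarrow> \<bar>a\<bar> \<le> \<bar>x\<bar>"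
  shows "L_weakly_compact A"
  unfolding L_weakly_compact_def
proof (intro conjI allI impI)
  show "bounded A"
    unfolding bounded_iff using A(2) by (intro exI[of _ "norm x"]) (auto intro: norm_mono_abs)
  fix z :: "nat \<Rightarrow> 'a"
  assume z: "range z \<subseteq> solid_hull A \<and> (\<forall>m n. m \<noteq> n \<longrightarrow> lat_disjoint (z m) (z n))"
  have "z \<longlonglongrightarrow> 0"
  proof (rule abs_le_part_disjoint_null[OF x])
    fix n
    obtain a where "a \<in> A" "\<bar>z n\<bar> \<le> \<bar>a\<bar>"
      using z unfolding solid_hull_def by blast
    then show "\<bar>z n\<bar> \<le> \<bar>x\<bar>" using A(2) order_trans by blast
  qed (use z in auto)
  then show "(\<lambda>n. norm (z n)) \<longlonglongrightarrow> 0"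
    by (rule tendsto_norm_zero)
qed (rule A)

lemma L_weakly_compact_subset_part:
  fixes A :: "'a::banach_lattice set"
  assumes "L_weakly_compact A"
  shows "A \<subseteq> monotone_convergent_part"
proof
  fix a assume a: "a \<in> A"
  show "a \<in> monotone_convergent_part"
  proof (rule mem_monotone_convergent_part_if_disjoint_null)
    fix z :: "nat \<Rightarrow> 'a"
    assume z: "\<And>n. \<bar>z n\<bar> \<le> \<bar>a\<bar>" "\<And>m n. m \<noteq> n \<Longrightarrow> lat_disjoint (z m) (z n)"
    have "range z \<subseteq> solid_hull A"
      using a z(1) by (auto intro: solid_hull_abs_le)
    with z(2) show "(\<lambda>n. norm (z n)) \<longlonglongrightarrow> 0"
      using assms unfolding L_weakly_compact_def by blast
  qed
qed

text \<open>
  The order interval can be taken in the order continuous part because that part is an ideal which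
  contains \<open>A\<close>.
\<close>

lemma L_weakly_compact_almost_order_bounded:
  fixes A :: "'a::banach_lattice set"
  assumes A: "L_weakly_compact A" and "0 < e"
  obtains u where "u \<in> monotone_convergent_part" "0 \<le> u" "\<And>a. a \<in> A \<Longrightarrow> norm (pprt (\<bar>a\<bar> - u)) \<le> e"
proof -
  obtain M where M: "\<And>a. a \<in> A \<Longrightarrow> norm a \<le> M"
    using A unfolding L_weakly_compact_def bounded_iff by blast
  have "\<exists>\<sigma>\<in>abs_sums A. \<exists>C\<ge>0. \<forall>a\<in>A. norm (pprt (\<bar>a\<bar> - C *\<^sub>R \<sigma>)) \<le> e"
    by (rule almost_order_bounded_if_disjoint_null[OF M])
       (use A \<open>0 < e\<close> in \<open>auto simp: L_weakly_compact_def image_subset_iff\<close>)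
  then obtain \<sigma> C where \<sigma>: "\<sigma> \<in> abs_sums A" "0 \<le> C" "\<And>a. a \<in> A \<Longrightarrow> norm (pprt (\<bar>a\<bar> - C *\<^sub>R \<sigma>)) \<le> e"
    by blast
  have "\<sigma> \<in> monotone_convergent_part"
    using \<sigma>(1)
  proof induction
    case (add \<sigma> s)
    then have "s \<in> monotone_convergent_part"
      using L_weakly_compact_subset_part[OF A] by blast
    then have "\<bar>s\<bar> \<in> monotone_convergent_part"
      by (rule monotone_convergent_part_solid) simp
    with add.IH show ?case by (rule monotone_convergent_part_add)
  qed (rule monotone_convergent_part_zero)
  with \<sigma> show ?thesis
    by (intro that[of "C *\<^sub>R \<sigma>"] monotone_convergent_part_scaleR scaleR_nonneg_nonneg
        abs_sums_nonneg[of \<sigma> A])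
qed

lemma order_continuous_norm_on_UNIV_iff:
  "order_continuous_norm_on (UNIV :: 'a::banach_lattice set) \<longleftrightarrow> monotone_convergent_part = (UNIV :: 'a set)"
proof
  assume "order_continuous_norm_on (UNIV :: 'a set)"
  moreover have "order_ideal (UNIV :: 'a set)"
    by (auto simp: order_ideal_def)
  ultimately show "monotone_convergent_part = (UNIV :: 'a set)"
    using ideal_subset_monotone_convergent_part by blast
next
  assume "monotone_convergent_part = (UNIV :: 'a set)"
  then show "order_continuous_norm_on (UNIV :: 'a set)"
    using order_continuous_norm_on_monotone_convergent_part by metis
qed

section \<open>Positive functionals on Banach lattices\<close>

definition sublinear :: "('a::real_vector \<Rightarrow> real) \<Rightarrow> bool"
  where "sublinear p \<longleftrightarrow> (\<forall>x y. p (x + y) \<le> p x + p y) \<and> (\<forall>c>0. \<forall>x. p (c *\<^sub>R x) = c * p x)"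

lemma sublinear_zero:
  assumes "sublinear p"
  shows "p 0 = 0"
proof -
  have "p (2 *\<^sub>R 0) = 2 * p 0"
    using assms by (simp only: sublinear_def zero_less_numeral)
  then show ?thesis by simp
qed

text \<open>
  The two families of interest are chains of sublinear functions, in Zorn's lemma, and the family
  indexed by \<open>t\<close> in the next lemma, whose members are not sublinear one by one.
\<close>

lemma sublinear_INF:
  fixes g :: "'i \<Rightarrow> 'a::real_vector \<Rightarrow> real"
  assumes I: "I \<noteq> {}" and below: "\<And>i x. i \<in> I \<Longrightarrow> b x \<le> g i x"
    and add: "\<And>i j x y. i \<in> I \<Longrightarrow> j \<in> I \<Longrightarrow> \<exists>k\<in>I. g k (x + y) \<le> g i x + g j y"
    and scale: "\<And>i c x. i \<in> I \<Longrightarrow> 0 < c \<Longrightarrow> \<exists>j\<in>I. g j (c *\<^sub>R x) \<le> c * g i x"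
  shows "sublinear (\<lambda>x. INF i\<in>I. g i x)" "\<And>i x. i \<in> I \<Longrightarrow> (INF i\<in>I. g i x) \<le> g i x"
proof -
  define u where "u x = (INF i\<in>I. g i x)" for x
  have le: "u x \<le> g i x" if "i \<in> I" for i x
    unfolding u_def using below that by (intro cINF_lower bdd_belowI2[of _ "b x"])
  then show "\<And>i x. i \<in> I \<Longrightarrow> (INF i\<in>I. g i x) \<le> g i x" by (simp add: u_def)
  have ge: "r \<le> u x" if "\<And>i. i \<in> I \<Longrightarrow> r \<le> g i x" for r x
    unfolding u_def using that I by (intro cINF_greatest)
  have "u (x + y) \<le> u x + u y" for x y
  proof -
    have "u (x + y) - u y \<le> u x"
    proof (rule ge)
      fix i assume i: "i \<in> I"
      have "u (x + y) - g i x \<le> u y"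
      proof (rule ge)
        fix j assume "j \<in> I"
        then obtain k where "k \<in> I" "g k (x + y) \<le> g i x + g j y"
          using add i by blast
        with le[of k "x + y"] show "u (x + y) - g i x \<le> g j y" by linarith
      qed
      then show "u (x + y) - u y \<le> g i x" by simp
    qed
    then show ?thesis by simp
  qed
  moreover have scale_le: "u (c *\<^sub>R x) \<le> c * u x" if c: "0 < c" for c x
  proof -
    have "u (c *\<^sub>R x) / c \<le> u x"
    proof (rule ge)
      fix i assume "i \<in> I"
      then obtain j where "j \<in> I" "g j (c *\<^sub>R x) \<le> c * g i x"
        using scale c by blast
      with le[of j "c *\<^sub>R x"] c show "u (c *\<^sub>R x) / c \<le> g i x"
        by (simp add: divide_le_eq mult.commute)
    qed
    with c show ?thesis by (simp add: divide_le_eq mult.commute)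
  qed
  moreover have "c * u x \<le> u (c *\<^sub>R x)" if c: "0 < c" for c x
    using scale_le[of "1 / c" "c *\<^sub>R x"] c by (simp add: le_divide_eq mult.commute)
  ultimately show "sublinear (\<lambda>x. INF i\<in>I. g i x)"
    unfolding sublinear_def u_def[symmetric] by (auto intro: order.antisym)
qed

text \<open>
  The infimum makes \<open>p\<close> linear along \<open>y\<close>: the slope \<open>p y\<close> is extended to negative multiples of \<open>y\<close>.
\<close>

lemma sublinear_straighten:
  fixes p :: "'a::real_vector \<Rightarrow> real"
  assumes p: "sublinear p"
  shows "sublinear (\<lambda>x. INF t\<in>{0..}. p (x + t *\<^sub>R y) - t * p y)"
    and "0 \<le> t \<Longrightarrow> (INF t\<in>{0..}. p (x + t *\<^sub>R y) - t * p y) \<le> p (x + t *\<^sub>R y) - t * p y"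
proof -
  have add: "p (x + z) \<le> p x + p z" for x z
    using p unfolding sublinear_def by blast
  have scale: "p (c *\<^sub>R x) = c * p x" if "0 \<le> c" for c x
    using p sublinear_zero[OF p] that unfolding sublinear_def by (cases "c = 0") auto
  have 1: "- p (- x) \<le> p (x + t *\<^sub>R y) - t * p y" if "t \<in> {0..}" for t x
    using add[of "x + t *\<^sub>R y" "- x"] scale[of t y] that by simp
  have 2: "\<exists>k\<in>{0..}. p (x + z + k *\<^sub>R y) - k * p y \<le> p (x + s *\<^sub>R y) - s * p y + (p (z + t *\<^sub>R y) - t * p y)"
    if "s \<in> {0..}" "t \<in> {0..}" for s t x z
    using that add[of "x + s *\<^sub>R y" "z + t *\<^sub>R y"] by (intro bexI[of _ "s + t"]) (auto simp: algebra_simps)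
  have 3: "\<exists>s\<in>{0..}. p (c *\<^sub>R x + s *\<^sub>R y) - s * p y \<le> c * (p (x + t *\<^sub>R y) - t * p y)"
    if "t \<in> {0..}" "0 < c" for t c x
    using that scale[of c "x + t *\<^sub>R y"] by (intro bexI[of _ "c * t"]) (auto simp: algebra_simps)
  show "sublinear (\<lambda>x. INF t\<in>{0..}. p (x + t *\<^sub>R y) - t * p y)"
    by (rule sublinear_INF(1)[where b = "\<lambda>x. - p (- x)"]) (use 1 2 3 in auto)
  show "(INF t\<in>{0..}. p (x + t *\<^sub>R y) - t * p y) \<le> p (x + t *\<^sub>R y) - t * p y" if "0 \<le> t"
    by (rule sublinear_INF(2)[where b = "\<lambda>x. - p (- x)" and g = "\<lambda>t x. p (x + t *\<^sub>R y) - t * p y"])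
       (use 1 2 3 that in auto)
qed

lemma minimal_sublinear_exists:
  fixes p :: "'a::real_vector \<Rightarrow> real"
  assumes p: "sublinear p"
  obtains m where "sublinear m" "\<And>x. m x \<le> p x" "\<And>q. sublinear q \<Longrightarrow> (\<And>x. q x \<le> m x) \<Longrightarrow> q = m"
proof -
  define A where "A = {q. sublinear q \<and> (\<forall>x. q x \<le> p x)}"
  define P where "P q r \<longleftrightarrow> (\<forall>x. r x \<le> q x)" for q r :: "'a \<Rightarrow> real"
  have po: "partial_order_on A (relation_of P A)"
    by (rule partial_order_on_relation_ofI) (auto simp: P_def fun_eq_iff intro: order_trans order.antisym)
  have "\<exists>m\<in>A. \<forall>a\<in>A. P m a \<longrightarrow> a = m"
  proof (rule predicate_Zorn[OF po])
    fix C assume C: "C \<in> Chains (relation_of P A)"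
    have rel: "(q, r) \<in> relation_of P A \<or> (r, q) \<in> relation_of P A" if "q \<in> C" "r \<in> C" for q r
      using C that by (simp add: Chains_def)
    have CA: "q \<in> A" if "q \<in> C" for q
      using rel[OF that that] by (simp add: relation_of_def)
    have cmp: "P q r \<or> P r q" if "q \<in> C" "r \<in> C" for q r
      using rel[OF that] by (auto simp: relation_of_def)
    show "\<exists>u\<in>A. \<forall>a\<in>C. P a u"
    proof (cases "C = {}")
      case True
      then show ?thesis using p by (intro bexI[of _ p]) (auto simp: A_def)
    next
      case False
      have sub: "q (x + y) \<le> q x + q y" "0 < c \<Longrightarrow> q (c *\<^sub>R x) = c * q x" "q x \<le> p x" "q 0 = 0"
        if "q \<in> C" for q x y c
        using CA[OF that] sublinear_zero[of q] unfolding A_def sublinear_def by auto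
      have 1: "- p (- x) \<le> q x" if "q \<in> C" for q x
        using sub(1)[OF that, of x "- x"] sub(3)[OF that, of "- x"] sub(4)[OF that] by simp
      have 2: "\<exists>k\<in>C. k (x + y) \<le> q x + r y" if qr: "q \<in> C" "r \<in> C" for q r x y
        using cmp[OF qr]
      proof
        assume "P q r"
        then have "r (x + y) \<le> q x + r y"
          using sub(1)[OF qr(2), of x y] unfolding P_def by (smt (verit))
        then show ?thesis using qr by blast
      next
        assume "P r q"
        then have "q (x + y) \<le> q x + r y"
          using sub(1)[OF qr(1), of x y] unfolding P_def by (smt (verit))
        then show ?thesis using qr by blast
      qed
      have 3: "\<exists>r\<in>C. r (c *\<^sub>R x) \<le> c * q x" if "q \<in> C" "0 < c" for q c x
        using sub(2)[OF that] that by (intro bexI[of _ q]) auto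
      have inf: "sublinear (\<lambda>x. INF q\<in>C. q x)" "\<And>q x. q \<in> C \<Longrightarrow> (INF q\<in>C. q x) \<le> q x"
        by (rule sublinear_INF[where I = C and g = "\<lambda>q. q" and b = "\<lambda>x. - p (- x)"];
            use False 1 2 3 in blast)+
      obtain q0 where "q0 \<in> C" using False by blast
      then have "(INF q\<in>C. q x) \<le> p x" for x
        using inf(2)[of q0 x] sub(3)[of q0 x] by linarith
      then have "(\<lambda>x. INF q\<in>C. q x) \<in> A"
        using inf(1) by (simp add: A_def)
      moreover have "\<forall>a\<in>C. P a (\<lambda>x. INF q\<in>C. q x)"
        using inf(2) unfolding P_def by blast
      ultimately show ?thesis by blast
    qed
  qed
  then obtain m where m: "m \<in> A" "\<forall>a\<in>A. P m a \<longrightarrow> a = m" by blast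
  show ?thesis
  proof (rule that)
    fix q assume q: "sublinear q" "\<And>x. q x \<le> m x"
    then have "q \<in> A" using m(1) order_trans unfolding A_def by blast
    then show "q = m" using m(2) q(2) by (auto simp: P_def)
  qed (use m(1) in \<open>auto simp: A_def\<close>)
qed

text \<open>
  By minimality straightening along \<open>y\<close> changes nothing, which yields additivity.
\<close>

lemma minimal_sublinear_linear:
  fixes m :: "'a::real_vector \<Rightarrow> real"
  assumes m: "sublinear m" and min: "\<And>q. sublinear q \<Longrightarrow> (\<And>x. q x \<le> m x) \<Longrightarrow> q = m"
  shows "linear m"
proof -
  have "m x + m y \<le> m (x + y)" for x y
  proof -
    let ?q = "\<lambda>x. INF t\<in>{0..}. m (x + t *\<^sub>R y) - t * m y"
    have "?q x \<le> m x" for x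
      using sublinear_straighten(2)[OF m order_refl, of x y] by simp
    then have "?q = m"
      by (intro min sublinear_straighten(1) m)
    from fun_cong[OF this, of x] show ?thesis
      using sublinear_straighten(2)[OF m zero_le_one, of x y] by simp
  qed
  then have add: "m (x + y) = m x + m y" for x y
    using m by (auto simp: sublinear_def intro: order.antisym)
  have neg: "m (- x) = - m x" for x
    using add[of x "- x"] sublinear_zero[OF m] by simp
  have "m (c *\<^sub>R x) = c * m x" for c x
  proof -
    consider "c = 0" | "0 < c" | "0 < - c" by linarith
    then show ?thesis
    proof cases
      case 3
      then have "m ((- c) *\<^sub>R x) = - c * m x"
        using m unfolding sublinear_def by blast
      then show ?thesis using neg[of "c *\<^sub>R x"] by simp
    qed (use m sublinear_zero[OF m] in \<open>auto simp: sublinear_def\<close>)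
  qed
  with add show ?thesis by (intro linearI) auto
qed

text \<open>
  Straightening along \<open>s\<close> forces the value at \<open>- s\<close> to be at most \<open>- p s\<close>; a minimal sublinear function
  below the result is linear.
\<close>

theorem hahn_banach_sublinear:
  fixes p :: "'a::real_vector \<Rightarrow> real"
  assumes p: "sublinear p"
  obtains f where "linear f" "\<And>x. f x \<le> p x" "f s = p s"
proof -
  let ?q = "\<lambda>x. INF t\<in>{0..}. p (x + t *\<^sub>R s) - t * p s"
  obtain m where m: "sublinear m" "\<And>x. m x \<le> ?q x" "\<And>q. sublinear q \<Longrightarrow> (\<And>x. q x \<le> m x) \<Longrightarrow> q = m"
    using minimal_sublinear_exists[OF sublinear_straighten(1)[OF p, of s]] by blast
  have lin: "linear m" by (rule minimal_sublinear_linear[OF m(1,3)])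
  have le: "m x \<le> p x" for x
    using m(2)[of x] sublinear_straighten(2)[OF p order_refl, of x s] by simp
  have "m (- s) \<le> - p s"
    using m(2)[of "- s"] sublinear_straighten(2)[OF p zero_le_one, of "- s" s] sublinear_zero[OF p] by simp
  then have "p s \<le> m s" using linear_neg[OF lin, of s] by simp
  with le show ?thesis by (intro that[OF lin le] order.antisym)
qed

definition dual_of :: "('a::real_normed_vector \<Rightarrow> real) \<Rightarrow> 'a dual"
  where "dual_of f = Dual (Blinfun f)"

lemma dual_of_apply: "bounded_linear f \<Longrightarrow> dual_apply (dual_of f) x = f x"
  unfolding dual_of_def dual_apply.rep_eq Dual_inverse[OF UNIV_I]
  by (simp add: bounded_linear_Blinfun_apply)

lemma norming_functional:
  fixes s :: "'a::real_normed_vector"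
  obtains \<phi> :: "'a dual" where "norm \<phi> \<le> 1" "dual_apply \<phi> s = norm s"
proof -
  have "sublinear (norm :: 'a \<Rightarrow> real)"
    by (auto simp: sublinear_def norm_triangle_ineq)
  then obtain f :: "'a \<Rightarrow> real" where f: "linear f" "\<And>x. f x \<le> norm x" "f s = norm s"
    using hahn_banach_sublinear[where s = s] by blast
  have abs: "\<bar>f x\<bar> \<le> norm x" for x
    using f(2)[of x] f(2)[of "- x"] linear_neg[OF f(1), of x] by simp
  have "bounded_linear f"
    by (rule bounded_linear_intro[where K = 1])
       (use abs linear_add[OF f(1)] linear_scale[OF f(1)] in auto)
  then have ap: "dual_apply (dual_of f) x = f x" for x by (rule dual_of_apply)
  show ?thesis
    by (rule that[of "dual_of f"]) (use abs f(3) in \<open>auto simp: ap intro!: norm_dual_bound\<close>)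
qed

lemma dual_apply_mono: "f \<le> g \<Longrightarrow> 0 \<le> x \<Longrightarrow> dual_apply f x \<le> dual_apply g x"
  for f g :: "'a::banach_lattice dual"
  by (simp add: less_eq_dual_def)

lemma dual_apply_nonneg: "0 \<le> f \<Longrightarrow> 0 \<le> x \<Longrightarrow> 0 \<le> dual_apply f x"
  for f :: "'a::banach_lattice dual"
  using dual_apply_mono[of 0 f x] by simp

lemma dual_apply_mono_right: "0 \<le> f \<Longrightarrow> x \<le> y \<Longrightarrow> dual_apply f x \<le> dual_apply f y"
  for f :: "'a::banach_lattice dual"
  using dual_apply_nonneg[of f "y - x"] by (simp add: dual_apply_diff_right)

lemma dual_leI: "(\<And>x. 0 \<le> x \<Longrightarrow> dual_apply f x \<le> dual_apply g x) \<Longrightarrow> f \<le> g"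
  for f g :: "'a::banach_lattice dual"
  by (simp add: less_eq_dual_def)

lemma dual_apply_sum_right: "dual_apply f (\<Sum>i\<in>K. x i) = (\<Sum>i\<in>K. dual_apply f (x i))"
  by (rule linear_sum[OF bounded_linear.linear[OF bounded_linear_dual_apply]])

lemma dual_abs_leI:
  fixes f g :: "'a::banach_lattice dual"
  assumes "\<And>x. 0 \<le> x \<Longrightarrow> \<bar>dual_apply g x\<bar> \<le> dual_apply f x"
  shows "\<bar>g\<bar> \<le> f"
  using assms by (intro abs_leI dual_leI) (auto simp: dual_apply_minus abs_le_iff)

lemma dual_abs_apply_le:
  fixes f g :: "'a::banach_lattice dual"
  assumes g: "\<bar>g\<bar> \<le> f"
  shows "\<bar>dual_apply g x\<bar> \<le> dual_apply f \<bar>x\<bar>"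
proof -
  have *: "\<bar>dual_apply g y\<bar> \<le> dual_apply f y" if "0 \<le> y" for y
    using dual_apply_mono[OF order_trans[OF abs_ge_self g] that]
      dual_apply_mono[OF order_trans[OF abs_ge_minus_self g] that] by (simp add: dual_apply_minus)
  have "dual_apply g x = dual_apply g (pprt x) - dual_apply g (pprt (- x))"
    by (simp only: pprt_diff flip: dual_apply_diff_right)
  also have "\<bar>\<dots>\<bar> \<le> dual_apply f (pprt x) + dual_apply f (pprt (- x))"
    using *[of "pprt x"] *[of "pprt (- x)"] by simp
  also have "\<dots> = dual_apply f \<bar>x\<bar>"
    by (simp add: lattice_abs_eq dual_apply_add_right)
  finally show ?thesis .
qed

text \<open>
  The modulus of a norming functional is still norming.
\<close>

lemma positive_norming_functional:
  fixes s :: "'a::banach_lattice"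
  assumes s: "0 \<le> s"
  obtains \<phi> :: "'a dual" where "0 \<le> \<phi>" "norm \<phi> \<le> 1" "dual_apply \<phi> s = norm s"
proof -
  obtain \<phi> :: "'a dual" where \<phi>: "norm \<phi> \<le> 1" "dual_apply \<phi> s = norm s"
    by (rule norming_functional)
  have n: "norm \<bar>\<phi>\<bar> \<le> 1" using \<phi> by simp
  have "norm s \<le> dual_apply \<bar>\<phi>\<bar> s"
    using dual_apply_mono[OF abs_ge_self s, of \<phi>] \<phi>(2) by simp
  moreover have "dual_apply \<bar>\<phi>\<bar> s \<le> norm s"
    using norm_dual_apply[of "\<bar>\<phi>\<bar>" s] mult_right_mono[OF n norm_ge_zero[of s]] by linarith
  ultimately show ?thesis
    using n by (intro that[of "\<bar>\<phi>\<bar>"]) auto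
qed

definition dual_eval :: "'a::real_normed_vector \<Rightarrow> 'a dual dual"
  where "dual_eval x = dual_of (\<lambda>f. dual_apply f x)"

lemma dual_eval_apply [simp]: "dual_apply (dual_eval x) f = dual_apply f x"
  unfolding dual_eval_def
proof (rule dual_of_apply, rule bounded_linear_intro[where K = "norm x"])
  show "norm (dual_apply f x) \<le> norm f * norm x" for f
    using norm_dual_apply[of f x] by simp
qed (auto simp: dual_apply_add dual_apply_scaleR)

lemma dual_eval_nonneg: "0 \<le> x \<Longrightarrow> 0 \<le> dual_eval x" for x :: "'a::banach_lattice"
  by (rule dual_leI) (simp add: dual_apply_nonneg)

text \<open>A functional is determined by an additive and positively homogeneous map on the cone.\<close>

definition cone_functional :: "('a::banach_lattice \<Rightarrow> real) \<Rightarrow> 'a dual"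
  where "cone_functional s = dual_of (\<lambda>x. s (pprt x) - s (pprt (- x)))"

lemma cone_functional_apply:
  fixes s :: "'a::banach_lattice \<Rightarrow> real"
  assumes add: "\<And>x y. 0 \<le> x \<Longrightarrow> 0 \<le> y \<Longrightarrow> s (x + y) = s x + s y"
    and scale: "\<And>c x. 0 < c \<Longrightarrow> 0 \<le> x \<Longrightarrow> s (c *\<^sub>R x) = c * s x"
    and bound: "\<And>x. 0 \<le> x \<Longrightarrow> \<bar>s x\<bar> \<le> C * norm x"
    and x: "0 \<le> x"
  shows "dual_apply (cone_functional s) x = s x"
proof -
  let ?p = "\<lambda>x. s (pprt x) - s (pprt (- x))"
  have zero: "s 0 = 0"
    using scale[of 2 0] by simp
  have C: "\<bar>s x\<bar> \<le> \<bar>C\<bar> * norm x" if "0 \<le> x" for x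
    using bound[OF that] mult_right_mono[OF abs_ge_self[of C] norm_ge_zero[of x]] by linarith
  have aux: "?p z = s a - s b" if "0 \<le> a" "0 \<le> b" "a - b = z" for a b z
  proof -
    have "pprt z + b = a + pprt (- z)"
      using pprt_diff[of z] that(3) by (simp add: algebra_simps)
    then have "s (pprt z + b) = s (a + pprt (- z))" by simp
    then show ?thesis using that by (simp add: add)
  qed
  have "bounded_linear ?p"
  proof (rule bounded_linear_intro[where K = "2 * \<bar>C\<bar>"])
    fix x y :: 'a and r :: real
    have "?p (x + y) = s (pprt x + pprt y) - s (pprt (- x) + pprt (- y))"
    proof (rule aux)
      have "pprt x + pprt y - (pprt (- x) + pprt (- y)) = pprt x - pprt (- x) + (pprt y - pprt (- y))"
        by (simp add: algebra_simps)
      then show "pprt x + pprt y - (pprt (- x) + pprt (- y)) = x + y"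
        by (simp only: pprt_diff)
    qed (auto intro: add_nonneg_nonneg)
    then show "?p (x + y) = ?p x + ?p y" by (simp add: add)
    have scale0: "s (c *\<^sub>R z) = c * s z" if "0 \<le> c" "0 \<le> z" for c z
      using scale[of c z] that zero by (cases "c = 0") auto
    show "?p (r *\<^sub>R x) = r *\<^sub>R ?p x"
    proof (cases "0 \<le> r")
      case True
      have "pprt (- (r *\<^sub>R x)) = r *\<^sub>R pprt (- x)"
        using scaleR_pprt[OF True, of "- x"] by simp
      then show ?thesis
        using True by (simp add: scaleR_pprt scale0 right_diff_distrib)
    next
      case False
      have "pprt (- (r *\<^sub>R x)) = (- r) *\<^sub>R pprt x" "pprt (r *\<^sub>R x) = (- r) *\<^sub>R pprt (- x)"
        using scaleR_pprt[of "- r" x] scaleR_pprt[of "- r" "- x"] False by simp_all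
      moreover have "s ((- r) *\<^sub>R pprt z) = (- r) * s (pprt z)" for z
        using False by (intro scale0) auto
      ultimately show ?thesis
        by (simp add: right_diff_distrib)
    qed
    have "\<bar>s (pprt x)\<bar> \<le> \<bar>C\<bar> * norm x" "\<bar>s (pprt (- x))\<bar> \<le> \<bar>C\<bar> * norm x"
      using C[of "pprt x"] C[of "pprt (- x)"] mult_left_mono[OF norm_pprt_le[of x] abs_ge_zero[of C]]
        mult_left_mono[OF norm_pprt_uminus_le[of x] abs_ge_zero[of C]] by auto
    then show "norm (?p x) \<le> norm x * (2 * \<bar>C\<bar>)"
      by (simp add: algebra_simps)
  qed
  then show ?thesis
    unfolding cone_functional_def using x by (simp add: dual_of_apply zero)
qed

text \<open>The component of \<open>f\<close> that lives on the band generated by \<open>w\<close>.\<close>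

definition component_on :: "'a::banach_lattice \<Rightarrow> 'a dual \<Rightarrow> 'a \<Rightarrow> real"
  where "component_on w f x = (SUP k\<in>{0..}. dual_apply f (inf x (k *\<^sub>R w)))"

definition dual_component :: "'a::banach_lattice \<Rightarrow> 'a dual \<Rightarrow> 'a dual"
  where "dual_component w f = cone_functional (component_on w f)"

context
  fixes w :: "'a::banach_lattice" and f :: "'a dual"
  assumes w: "0 \<le> w" and f: "0 \<le> f"
begin

lemma component_on_upper:
  assumes "0 \<le> k"
  shows "dual_apply f (inf x (k *\<^sub>R w)) \<le> component_on w f x"
  unfolding component_on_def
proof (rule cSUP_upper)
  show "bdd_above ((\<lambda>k. dual_apply f (inf x (k *\<^sub>R w))) ` {0..})"
    by (rule bdd_aboveI2[where M = "dual_apply f x"]) (auto intro: dual_apply_mono_right f)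
qed (use assms in auto)

lemma component_on_least:
  assumes "\<And>k. 0 \<le> k \<Longrightarrow> dual_apply f (inf x (k *\<^sub>R w)) \<le> b"
  shows "component_on w f x \<le> b"
  unfolding component_on_def by (rule cSUP_least) (use assms in auto)

lemma component_on_le: "component_on w f x \<le> dual_apply f x"
  by (rule component_on_least) (auto intro: dual_apply_mono_right f)

lemma component_on_nonneg: "0 \<le> x \<Longrightarrow> 0 \<le> component_on w f x"
  using component_on_upper[of 0 x] by (simp add: inf_absorb2 dual_apply_zero_right)

lemma component_on_add:
  assumes x: "0 \<le> x" and y: "0 \<le> y"
  shows "component_on w f (x + y) = component_on w f x + component_on w f y"
proof (rule antisym)
  show "component_on w f (x + y) \<le> component_on w f x + component_on w f y"
  proof (rule component_on_least)
    fix k :: real assume k: "0 \<le> k"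
    have kw: "0 \<le> k *\<^sub>R w" using k w by (rule scaleR_nonneg_nonneg)
    have "inf (k *\<^sub>R w) (x + y) \<le> inf (k *\<^sub>R w) x + inf (k *\<^sub>R w) y"
      by (rule inf_add_le[OF kw x y])
    then have "dual_apply f (inf (x + y) (k *\<^sub>R w))
        \<le> dual_apply f (inf x (k *\<^sub>R w)) + dual_apply f (inf y (k *\<^sub>R w))"
      using dual_apply_mono_right[OF f] by (simp add: inf_commute flip: dual_apply_add_right)
    with component_on_upper[OF k, of x] component_on_upper[OF k, of y]
    show "dual_apply f (inf (x + y) (k *\<^sub>R w)) \<le> component_on w f x + component_on w f y"
      by linarith
  qed
  have "component_on w f x \<le> component_on w f (x + y) - component_on w f y"
  proof (rule component_on_least)
    fix k :: real assume k: "0 \<le> k"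
    have "component_on w f y \<le> component_on w f (x + y) - dual_apply f (inf x (k *\<^sub>R w))"
    proof (rule component_on_least)
      fix l :: real assume l: "0 \<le> l"
      have "inf x (k *\<^sub>R w) + inf y (l *\<^sub>R w) \<le> inf (x + y) ((k + l) *\<^sub>R w)"
        unfolding scaleR_left_distrib by (intro le_infI add_mono) auto
      then have "dual_apply f (inf x (k *\<^sub>R w) + inf y (l *\<^sub>R w)) \<le> dual_apply f (inf (x + y) ((k + l) *\<^sub>R w))"
        by (rule dual_apply_mono_right[OF f])
      also have "\<dots> \<le> component_on w f (x + y)"
        using k l by (intro component_on_upper) auto
      finally show "dual_apply f (inf y (l *\<^sub>R w)) \<le> component_on w f (x + y) - dual_apply f (inf x (k *\<^sub>R w))"
        by (simp add: dual_apply_add_right)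
    qed
    then show "dual_apply f (inf x (k *\<^sub>R w)) \<le> component_on w f (x + y) - component_on w f y"
      by linarith
  qed
  then show "component_on w f x + component_on w f y \<le> component_on w f (x + y)" by linarith
qed

lemma component_on_scaleR:
  assumes "0 < c"
  shows "component_on w f (c *\<^sub>R x) = c * component_on w f x"
proof -
  have le: "component_on w f (c *\<^sub>R x) \<le> c * component_on w f x" if c: "0 < c" for c x
  proof (rule component_on_least)
    fix k :: real assume k: "0 \<le> k"
    have "inf (c *\<^sub>R x) (k *\<^sub>R w) = c *\<^sub>R inf x ((k / c) *\<^sub>R w)"
      using c by (simp add: scaleR_inf_distrib)
    moreover have "c * dual_apply f (inf x ((k / c) *\<^sub>R w)) \<le> c * component_on w f x"
      using c k by (intro mult_left_mono component_on_upper) auto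
    ultimately show "dual_apply f (inf (c *\<^sub>R x) (k *\<^sub>R w)) \<le> c * component_on w f x"
      by (simp add: dual_apply_scaleR_right)
  qed
  have "component_on w f ((1 / c) *\<^sub>R c *\<^sub>R x) \<le> (1 / c) * component_on w f (c *\<^sub>R x)"
    using assms by (intro le) auto
  then have "c * component_on w f x \<le> component_on w f (c *\<^sub>R x)"
    using assms by (simp add: field_simps)
  with le[OF assms] show ?thesis by (simp add: order.antisym)
qed

lemma dual_component_apply: "0 \<le> x \<Longrightarrow> dual_apply (dual_component w f) x = component_on w f x"
  unfolding dual_component_def
proof (rule cone_functional_apply[where C = "norm f"])
  show "\<bar>component_on w f x\<bar> \<le> norm f * norm x" if "0 \<le> x" for x
    using component_on_nonneg[OF that] component_on_le[of x] norm_dual_apply[of f x] by linarith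
qed (auto simp: component_on_add component_on_scaleR)

lemma dual_component_nonneg: "0 \<le> dual_component w f"
  by (rule dual_leI) (simp add: dual_component_apply component_on_nonneg)

lemma dual_component_le: "dual_component w f \<le> f"
  by (rule dual_leI) (simp add: dual_component_apply component_on_le)

lemma dual_component_eq:
  assumes "0 \<le> x" "x \<le> k *\<^sub>R w" "0 \<le> k"
  shows "dual_apply (dual_component w f) x = dual_apply f x"
  using component_on_upper[OF assms(3), of x] component_on_le[of x] assms
  by (simp add: dual_component_apply inf_absorb1)

lemma dual_component_disjoint:
  assumes "inf x w = 0"
  shows "dual_apply (dual_component w f) x = 0"
proof -
  have x: "0 \<le> x" using inf_le1[of x w] assms by simp
  have "component_on w f x \<le> 0"
    by (rule component_on_least) (use assms in \<open>simp add: inf_scaleR_eq_0 dual_apply_zero_right\<close>)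
  with component_on_nonneg[OF x] x show ?thesis by (simp add: dual_component_apply)
qed

text \<open>
  The component of \<open>f\<close> on \<open>w\<close> is carried by the ideal generated by \<open>w\<close>, so functionals
  dominated by it are controlled by their value at \<open>w\<close>.
\<close>

lemma dual_component_carried:
  assumes x: "0 \<le> x" and e: "0 < e"
  obtains k where "0 \<le> k"
    "\<And>c g. 0 \<le> g \<Longrightarrow> g \<le> c *\<^sub>R dual_component w f \<Longrightarrow> 0 \<le> c \<Longrightarrow>
      dual_apply g x \<le> k * dual_apply g w + c * e"
proof -
  have "\<exists>k\<ge>0. component_on w f x - e < dual_apply f (inf x (k *\<^sub>R w))"
  proof (rule ccontr)
    assume "\<not> ?thesis"
    then have "component_on w f x \<le> component_on w f x - e"
      by (intro component_on_least) (auto simp: not_less)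
    with e show False by simp
  qed
  then obtain k where k: "0 \<le> k" "component_on w f x - e < dual_apply f (inf x (k *\<^sub>R w))"
    by blast
  have kw: "0 \<le> k *\<^sub>R w" using k w by (intro scaleR_nonneg_nonneg)
  show ?thesis
  proof (rule that[OF k(1)])
    fix c and g :: "'a dual" assume g: "0 \<le> g" "g \<le> c *\<^sub>R dual_component w f" and c: "0 \<le> c"
    let ?y = "inf x (k *\<^sub>R w)"
    have y: "0 \<le> ?y" "?y \<le> x" "?y \<le> k *\<^sub>R w" using x kw by auto
    have "dual_apply (dual_component w f) ?y = dual_apply f ?y"
      by (rule dual_component_eq[OF y(1,3) k(1)])
    then have rest: "dual_apply (dual_component w f) (x - ?y) \<le> e"
      using k(2) x by (simp add: dual_apply_diff_right dual_component_apply)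
    have "dual_apply g x = dual_apply g ?y + dual_apply g (x - ?y)"
      by (simp add: dual_apply_diff_right)
    also have "dual_apply g ?y \<le> dual_apply g (k *\<^sub>R w)"
      by (rule dual_apply_mono_right[OF g(1) y(3)])
    also have "dual_apply g (x - ?y) \<le> c * dual_apply (dual_component w f) (x - ?y)"
      using dual_apply_mono[OF g(2), of "x - ?y"] y(2) by (simp add: dual_apply_scaleR)
    also have "\<dots> \<le> c * e"
      using rest c by (rule mult_left_mono)
    finally show "dual_apply g x \<le> k * dual_apply g w + c * e"
      by (simp add: dual_apply_scaleR_right)
  qed
qed

end

text \<open>
  A functional attaining \<open>f \<bar>y\<bar>\<close> at \<open>y\<close>: the component of \<open>f\<close> on \<open>pprt y\<close> minus that on \<open>pprt (- y)\<close>.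
\<close>

lemma dual_sign_functional:
  fixes f :: "'a::banach_lattice dual" and y :: 'a
  assumes f: "0 \<le> f"
  obtains g where "\<bar>g\<bar> \<le> f" "dual_apply g y = dual_apply f \<bar>y\<bar>"
proof -
  define p q where "p = dual_component (pprt y) f" and "q = dual_component (pprt (- y)) f"
  have y0: "0 \<le> pprt y" "0 \<le> pprt (- y)" by auto
  have le: "dual_apply p x \<le> dual_apply f x" "dual_apply q x \<le> dual_apply f x"
    "0 \<le> dual_apply p x" "0 \<le> dual_apply q x" if "0 \<le> x" for x
    using that dual_component_le[OF y0(1) f] dual_component_le[OF y0(2) f]
      dual_component_nonneg[OF y0(1) f] dual_component_nonneg[OF y0(2) f]
    unfolding p_def q_def by (auto intro: dual_apply_mono dual_apply_nonneg)
  show ?thesis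
  proof (rule that)
    show "\<bar>p - q\<bar> \<le> f"
      by (rule dual_abs_leI) (use le in \<open>fastforce simp: dual_apply_diff abs_le_iff\<close>)
    have "dual_apply p (pprt y) = dual_apply f (pprt y)" "dual_apply q (pprt (- y)) = dual_apply f (pprt (- y))"
      unfolding p_def q_def by (rule dual_component_eq[where k = 1]; use f in simp)+
    moreover have "dual_apply p (pprt (- y)) = 0" "dual_apply q (pprt y) = 0"
      unfolding p_def q_def using inf_pprt_pprt_uminus[of y]
      by (auto intro!: dual_component_disjoint f simp: inf_commute)
    moreover have "dual_apply g y = dual_apply g (pprt y) - dual_apply g (pprt (- y))" for g
      by (simp only: pprt_diff flip: dual_apply_diff_right)
    ultimately show "dual_apply (p - q) y = dual_apply f \<bar>y\<bar>"
      by (simp add: dual_apply_diff lattice_abs_eq dual_apply_add_right)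
  qed
qed

section \<open>Weakly Cauchy subsequences of order bounded sequences\<close>

text \<open>
  The value of \<open>\<Phi>\<close> at ``\<open>x\<^sup>2 / u\<close>''. For real numbers with \<open>u > 0\<close>, \<open>x\<^sup>2 / u\<close> is the supremum of
  \<open>2 t x - t\<^sup>2 u\<close> over all \<open>t\<close>; finite sets of \<open>t\<close> keep the suprema inside the lattice.
\<close>

definition square_over :: "'a::banach_lattice dual \<Rightarrow> 'a \<Rightarrow> 'a \<Rightarrow> real"
  where "square_over \<Phi> u x = (SUP S\<in>{S. finite S \<and> S \<noteq> {}}.
    dual_apply \<Phi> (Sup_fin ((\<lambda>t. (2 * t) *\<^sub>R x - t\<^sup>2 *\<^sub>R u) ` S)))"

definition ideal_of :: "'a::banach_lattice \<Rightarrow> 'a set"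
  where "ideal_of u = {x. \<exists>c\<ge>0. \<bar>x\<bar> \<le> c *\<^sub>R u}"

lemma ideal_of_add: "x \<in> ideal_of u \<Longrightarrow> y \<in> ideal_of u \<Longrightarrow> x + y \<in> ideal_of u"
proof -
  assume "x \<in> ideal_of u" "y \<in> ideal_of u"
  then obtain c d where cd: "0 \<le> c" "0 \<le> d" "\<bar>x\<bar> \<le> c *\<^sub>R u" "\<bar>y\<bar> \<le> d *\<^sub>R u"
    unfolding ideal_of_def by blast
  have "\<bar>x + y\<bar> \<le> \<bar>x\<bar> + \<bar>y\<bar>" by (rule abs_triangle_ineq)
  also have "\<dots> \<le> (c + d) *\<^sub>R u"
    unfolding scaleR_left_distrib using cd by (intro add_mono)
  finally show ?thesis using cd unfolding ideal_of_def by (auto intro!: exI[of _ "c + d"])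
qed

lemma ideal_of_scaleR: "x \<in> ideal_of u \<Longrightarrow> a *\<^sub>R x \<in> ideal_of u"
proof -
  assume "x \<in> ideal_of u"
  then obtain c where c: "0 \<le> c" "\<bar>x\<bar> \<le> c *\<^sub>R u" unfolding ideal_of_def by blast
  have "\<bar>a *\<^sub>R x\<bar> \<le> \<bar>a\<bar> *\<^sub>R c *\<^sub>R u"
    unfolding lattice_abs_scaleR using c(2) by (intro scaleR_left_mono) auto
  then show ?thesis using c unfolding ideal_of_def by (auto intro!: exI[of _ "\<bar>a\<bar> * c"])
qed

lemma ideal_of_uminus: "x \<in> ideal_of u \<Longrightarrow> - x \<in> ideal_of u"
  using ideal_of_scaleR[of x u "-1"] by simp

lemma ideal_of_diff: "x \<in> ideal_of u \<Longrightarrow> y \<in> ideal_of u \<Longrightarrow> x - y \<in> ideal_of u"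
  using ideal_of_add[of x u "- y"] ideal_of_uminus[of y u] by simp

lemma ideal_of_zero: "0 \<in> ideal_of u"
  unfolding ideal_of_def by (auto intro: exI[of _ 0])

lemmas ideal_of_intros = ideal_of_add ideal_of_scaleR ideal_of_uminus ideal_of_diff ideal_of_zero

context
  fixes \<Phi> :: "'a::banach_lattice dual" and u :: 'a
  assumes \<Phi>: "0 \<le> \<Phi>" and u: "0 \<le> u"
begin

abbreviation (input) tangent :: "'a \<Rightarrow> real \<Rightarrow> 'a"
  where "tangent x t \<equiv> (2 * t) *\<^sub>R x - t\<^sup>2 *\<^sub>R u"

abbreviation (input) sq :: "'a \<Rightarrow> real"
  where "sq \<equiv> square_over \<Phi> u"

lemma tangent_le:
  assumes x: "\<bar>x\<bar> \<le> c *\<^sub>R u"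
  shows "tangent x t \<le> c\<^sup>2 *\<^sub>R u"
proof -
  have "(2 * t) *\<^sub>R x \<le> \<bar>(2 * t) *\<^sub>R x\<bar>" by (rule abs_ge_self)
  also have "\<dots> \<le> \<bar>2 * t\<bar> *\<^sub>R c *\<^sub>R u"
    unfolding lattice_abs_scaleR using x by (intro scaleR_left_mono) auto
  finally have "tangent x t \<le> (2 * \<bar>t\<bar> * c) *\<^sub>R u - t\<^sup>2 *\<^sub>R u"
    by (simp add: abs_mult)
  also have "\<dots> = (2 * \<bar>t\<bar> * c - t\<^sup>2) *\<^sub>R u"
    by (simp add: scaleR_left_diff_distrib)
  also have "\<dots> \<le> c\<^sup>2 *\<^sub>R u"
  proof (rule scaleR_right_mono[OF _ u])
    have "0 \<le> (\<bar>t\<bar> - c)\<^sup>2" by simp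
    then show "2 * \<bar>t\<bar> * c - t\<^sup>2 \<le> c\<^sup>2"
      by (simp add: power2_diff)
  qed
  finally show ?thesis .
qed

lemma Sup_fin_tangent_le:
  assumes x: "\<bar>x\<bar> \<le> c *\<^sub>R u" and S: "finite S" "S \<noteq> {}"
  shows "dual_apply \<Phi> (Sup_fin (tangent x ` S)) \<le> c\<^sup>2 * dual_apply \<Phi> u"
proof -
  have "Sup_fin (tangent x ` S) \<le> c\<^sup>2 *\<^sub>R u"
    using S tangent_le[OF x] by (intro Sup_fin.boundedI) auto
  from dual_apply_mono_right[OF \<Phi> this] show ?thesis
    by (simp add: dual_apply_scaleR_right)
qed

lemma square_over_upper:
  assumes x: "x \<in> ideal_of u" and S: "finite S" "S \<noteq> {}"
  shows "dual_apply \<Phi> (Sup_fin (tangent x ` S)) \<le> sq x"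
proof -
  obtain c where c: "\<bar>x\<bar> \<le> c *\<^sub>R u" using x unfolding ideal_of_def by blast
  show ?thesis
    unfolding square_over_def
  proof (rule cSUP_upper)
    show "bdd_above ((\<lambda>S. dual_apply \<Phi> (Sup_fin (tangent x ` S))) ` {S. finite S \<and> S \<noteq> {}})"
      by (rule bdd_aboveI2[where M = "c\<^sup>2 * dual_apply \<Phi> u"]) (auto intro: Sup_fin_tangent_le[OF c])
  qed (use S in auto)
qed

lemma square_over_least:
  assumes "\<And>S. finite S \<Longrightarrow> S \<noteq> {} \<Longrightarrow> dual_apply \<Phi> (Sup_fin (tangent x ` S)) \<le> b"
  shows "sq x \<le> b"
  unfolding square_over_def by (rule cSUP_least) (use assms in \<open>auto intro: exI[of _ "{0}"]\<close>)

lemma square_over_le: "\<bar>x\<bar> \<le> c *\<^sub>R u \<Longrightarrow> sq x \<le> c\<^sup>2 * dual_apply \<Phi> u"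
  by (rule square_over_least) (rule Sup_fin_tangent_le)

lemma square_over_nonneg: "x \<in> ideal_of u \<Longrightarrow> 0 \<le> sq x"
  using square_over_upper[of x "{0}"] by (simp add: dual_apply_zero_right)

text \<open>
  The sum of the tangent of \<open>x + y\<close> at \<open>s\<close> and that of \<open>x - y\<close> at \<open>t\<close> is twice the sum of the tangent of
  \<open>x\<close> at \<open>(s + t) / 2\<close> and that of \<open>y\<close> at \<open>(s - t) / 2\<close>.
\<close>

lemma square_over_parallelogram_le:
  assumes x: "x \<in> ideal_of u" and y: "y \<in> ideal_of u"
  shows "sq (x + y) + sq (x - y) \<le> 2 * sq x + 2 * sq y"
proof -
  have "sq (x + y) \<le> 2 * sq x + 2 * sq y - sq (x - y)"
  proof (rule square_over_least)
    fix S :: "real set" assume S: "finite S" "S \<noteq> {}"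
    have "sq (x - y) \<le> 2 * sq x + 2 * sq y - dual_apply \<Phi> (Sup_fin (tangent (x + y) ` S))"
    proof (rule square_over_least)
      fix T :: "real set" assume T: "finite T" "T \<noteq> {}"
      define P where "P = (\<lambda>(s, t). (s + t) / 2) ` (S \<times> T)"
      define Q where "Q = (\<lambda>(s, t). (s - t) / 2) ` (S \<times> T)"
      have PQ: "finite P" "P \<noteq> {}" "finite Q" "Q \<noteq> {}"
        using S T unfolding P_def Q_def by auto
      define p where "p = Sup_fin (tangent x ` P)"
      define q where "q = Sup_fin (tangent y ` Q)"
      have le: "tangent (x + y) s + tangent (x - y) t \<le> 2 *\<^sub>R p + 2 *\<^sub>R q" if "s \<in> S" "t \<in> T" for s t
      proof -
        have "tangent (x + y) s + tangent (x - y) t =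
            2 *\<^sub>R tangent x ((s + t) / 2) + 2 *\<^sub>R tangent y ((s - t) / 2)"
        proof -
          \<comment> \<open>Collect the coefficients of \<open>u\<close>, which agree since \<open>(s + t)\<^sup>2 + (s - t)\<^sup>2 = 2 * (s\<^sup>2 + t\<^sup>2)\<close>.\<close>
          define A B where "A = 2 * ((s + t) / 2)\<^sup>2" and "B = 2 * ((s - t) / 2)\<^sup>2"
          have "A + B = s\<^sup>2 + t\<^sup>2"
            unfolding A_def B_def by (simp add: power2_eq_square field_simps)
          then have AB: "s\<^sup>2 *\<^sub>R u + t\<^sup>2 *\<^sub>R u = A *\<^sub>R u + B *\<^sub>R u"
            by (simp flip: scaleR_left_distrib)
          have dbl: "2 *\<^sub>R tangent z c = (4 * c) *\<^sub>R z - (2 * c\<^sup>2) *\<^sub>R u" for z c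
            by (simp add: scaleR_diff_right)
          have c: "4 * ((s + t) / 2) = 2 * s + 2 * t" "4 * ((s - t) / 2) = 2 * s - 2 * t"
            by simp_all
          have "2 *\<^sub>R tangent x ((s + t) / 2) + 2 *\<^sub>R tangent y ((s - t) / 2) =
              (2 * s + 2 * t) *\<^sub>R x + (2 * s - 2 * t) *\<^sub>R y - (A *\<^sub>R u + B *\<^sub>R u)"
            unfolding dbl c A_def B_def by (simp add: algebra_simps)
          also have "\<dots> = tangent (x + y) s + tangent (x - y) t"
            unfolding AB[symmetric] by (simp add: algebra_simps)
          finally show ?thesis by (rule sym)
        qed
        also have "\<dots> \<le> 2 *\<^sub>R p + 2 *\<^sub>R q"
          unfolding p_def q_def using that PQ
          by (intro add_mono scaleR_left_mono Sup_fin.coboundedI imageI finite_imageI)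
             (auto simp: P_def Q_def)
        finally show ?thesis .
      qed
      have "Sup_fin (tangent (x + y) ` S) \<le> 2 *\<^sub>R p + 2 *\<^sub>R q - Sup_fin (tangent (x - y) ` T)"
      proof (rule Sup_fin.boundedI)
        fix a assume "a \<in> tangent (x + y) ` S"
        then obtain s where s: "s \<in> S" "a = tangent (x + y) s" by blast
        have "Sup_fin (tangent (x - y) ` T) \<le> 2 *\<^sub>R p + 2 *\<^sub>R q - a"
        proof (rule Sup_fin.boundedI)
          fix b assume "b \<in> tangent (x - y) ` T"
          then obtain t where t: "t \<in> T" "b = tangent (x - y) t" by blast
          show "b \<le> 2 *\<^sub>R p + 2 *\<^sub>R q - a"
            using le[OF s(1) t(1)] unfolding s t by (simp add: le_diff_eq add.commute)
        qed (use T in auto)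
        then show "a \<le> 2 *\<^sub>R p + 2 *\<^sub>R q - Sup_fin (tangent (x - y) ` T)"
          by (simp add: le_diff_eq add.commute)
      qed (use S in auto)
      from dual_apply_mono_right[OF \<Phi> this]
      have "dual_apply \<Phi> (Sup_fin (tangent (x + y) ` S)) + dual_apply \<Phi> (Sup_fin (tangent (x - y) ` T))
          \<le> 2 * dual_apply \<Phi> p + 2 * dual_apply \<Phi> q"
        by (simp add: dual_apply_diff_right dual_apply_add_right dual_apply_scaleR_right)
      then show "dual_apply \<Phi> (Sup_fin (tangent (x - y) ` T))
          \<le> 2 * sq x + 2 * sq y - dual_apply \<Phi> (Sup_fin (tangent (x + y) ` S))"
        using square_over_upper[OF x PQ(1,2)] square_over_upper[OF y PQ(3,4)]
        unfolding p_def q_def by linarith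
    qed
    then show "dual_apply \<Phi> (Sup_fin (tangent (x + y) ` S)) \<le> 2 * sq x + 2 * sq y - sq (x - y)"
      by linarith
  qed
  then show ?thesis by linarith
qed

lemma square_over_double:
  assumes x: "x \<in> ideal_of u"
  shows "sq (2 *\<^sub>R x) = 4 * sq x"
proof (rule antisym)
  have 2: "2 *\<^sub>R x \<in> ideal_of u" using x by (rule ideal_of_scaleR)
  have eq: "tangent (2 *\<^sub>R x) (2 * t) = 4 *\<^sub>R tangent x t" for t
    by (simp add: scaleR_diff_right power2_eq_square)
  show "sq (2 *\<^sub>R x) \<le> 4 * sq x"
  proof (rule square_over_least)
    fix S :: "real set" assume S: "finite S" "S \<noteq> {}"
    define T where "T = (\<lambda>t. t / 2) ` S"
    have T: "finite T" "T \<noteq> {}" using S unfolding T_def by auto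
    have "Sup_fin (tangent (2 *\<^sub>R x) ` S) \<le> 4 *\<^sub>R Sup_fin (tangent x ` T)"
    proof (rule Sup_fin.boundedI)
      fix a assume "a \<in> tangent (2 *\<^sub>R x) ` S"
      then obtain s where s: "s \<in> S" "a = tangent (2 *\<^sub>R x) s" by blast
      then have "a = 4 *\<^sub>R tangent x (s / 2)" using eq[of "s / 2"] by simp
      also have "\<dots> \<le> 4 *\<^sub>R Sup_fin (tangent x ` T)"
        using T s by (intro scaleR_left_mono Sup_fin.coboundedI imageI finite_imageI) (auto simp: T_def)
      finally show "a \<le> 4 *\<^sub>R Sup_fin (tangent x ` T)" .
    qed (use S in auto)
    from dual_apply_mono_right[OF \<Phi> this] square_over_upper[OF x T]
    show "dual_apply \<Phi> (Sup_fin (tangent (2 *\<^sub>R x) ` S)) \<le> 4 * sq x"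
      by (simp add: dual_apply_scaleR_right)
  qed
  have "sq x \<le> sq (2 *\<^sub>R x) / 4"
  proof (rule square_over_least)
    fix S :: "real set" assume S: "finite S" "S \<noteq> {}"
    define T where "T = (\<lambda>t. 2 * t) ` S"
    have T: "finite T" "T \<noteq> {}" using S unfolding T_def by auto
    have "Sup_fin (tangent x ` S) \<le> (1 / 4) *\<^sub>R Sup_fin (tangent (2 *\<^sub>R x) ` T)"
    proof (rule Sup_fin.boundedI)
      fix a assume "a \<in> tangent x ` S"
      then obtain s where s: "s \<in> S" "a = tangent x s" by blast
      then have "a = (1 / 4) *\<^sub>R tangent (2 *\<^sub>R x) (2 * s)" using eq[of s] by simp
      also have "\<dots> \<le> (1 / 4) *\<^sub>R Sup_fin (tangent (2 *\<^sub>R x) ` T)"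
        using T s by (intro scaleR_left_mono Sup_fin.coboundedI imageI finite_imageI) (auto simp: T_def)
      finally show "a \<le> (1 / 4) *\<^sub>R Sup_fin (tangent (2 *\<^sub>R x) ` T)" .
    qed (use S in auto)
    from dual_apply_mono_right[OF \<Phi> this] square_over_upper[OF 2 T]
    show "dual_apply \<Phi> (Sup_fin (tangent x ` S)) \<le> sq (2 *\<^sub>R x) / 4"
      by (simp add: dual_apply_scaleR_right)
  qed
  then show "4 * sq x \<le> sq (2 *\<^sub>R x)" by linarith
qed

text \<open>
  The reverse inequality is the one already proved, for \<open>x + y\<close> and \<open>x - y\<close>.
\<close>

lemma square_over_parallelogram:
  assumes x: "x \<in> ideal_of u" and y: "y \<in> ideal_of u"
  shows "sq (x + y) + sq (x - y) = 2 * sq x + 2 * sq y"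
proof -
  have "x + y + (x - y) = 2 *\<^sub>R x" "x + y - (x - y) = 2 *\<^sub>R y"
    by (simp_all add: scaleR_2)
  then have "4 * sq x + 4 * sq y \<le> 2 * sq (x + y) + 2 * sq (x - y)"
    using square_over_parallelogram_le[of "x + y" "x - y"] x y
    by (simp add: ideal_of_intros square_over_double)
  with square_over_parallelogram_le[OF x y] show ?thesis by linarith
qed

lemma square_over_zero: "sq 0 = 0"
  using square_over_double[OF ideal_of_zero] by simp

lemma square_over_uminus: "y \<in> ideal_of u \<Longrightarrow> sq (- y) = sq y"
  using square_over_parallelogram[OF ideal_of_zero, of y] by (simp add: square_over_zero)

text \<open>Four times the inner product, by polarisation.\<close>

definition polar :: "'a \<Rightarrow> 'a \<Rightarrow> real"
  where "polar x y = sq (x + y) - sq (x - y)"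

lemma polar_commute: "x \<in> ideal_of u \<Longrightarrow> y \<in> ideal_of u \<Longrightarrow> polar x y = polar y x"
  using square_over_uminus[of "x - y"] by (simp add: polar_def ideal_of_intros add.commute)

lemma polar_uminus: "x \<in> ideal_of u \<Longrightarrow> y \<in> ideal_of u \<Longrightarrow> polar (- x) y = - polar x y"
proof -
  assume xy: "x \<in> ideal_of u" "y \<in> ideal_of u"
  have "- x + y = - (x - y)" "- x - y = - (x + y)" by simp_all
  then show ?thesis
    unfolding polar_def using xy by (simp only: square_over_uminus ideal_of_intros)
qed

text \<open>
  The argument of Jordan and von Neumann.
\<close>

lemma polar_add:
  assumes "x \<in> ideal_of u" "y \<in> ideal_of u" "z \<in> ideal_of u"
  shows "polar (x + y) z = polar x z + polar y z"
proof -
  note par = square_over_parallelogram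
  have 1: "polar (a + b) z + polar (a - b) z = 2 * polar a z"
    if ab: "a \<in> ideal_of u" "b \<in> ideal_of u" for a b
  proof -
    have "a + z + b = a + b + z" "a + z - b = a - b + z" "a - z + b = a + b - z" "a - z - b = a - b - z"
      by (simp_all add: algebra_simps)
    with par[of "a + z" b] par[of "a - z" b] assms(3) ab show ?thesis
      by (simp add: ideal_of_intros polar_def)
  qed
  have "polar (- (x - y)) z = - polar (x - y) z"
    using assms by (intro polar_uminus ideal_of_intros)
  then have "polar (y - x) z = - polar (x - y) z" by simp
  with 1[OF assms(1,2)] 1[OF assms(2,1)] show ?thesis by (simp add: add.commute)
qed

lemma polar_diff:
  assumes "x \<in> ideal_of u" "y \<in> ideal_of u" "z \<in> ideal_of u"
  shows "polar (x - y) z = polar x z - polar y z"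
  using polar_add[of x "- y" z] polar_uminus[of y z] assms by (simp add: ideal_of_intros)

lemma square_over_add:
  assumes "x \<in> ideal_of u" "y \<in> ideal_of u"
  shows "sq (x + y) = sq x + sq y + polar x y / 2"
  using square_over_parallelogram[OF assms] by (simp add: polar_def field_simps)

text \<open>
  The supremum of the tangents at \<open>t\<close> and \<open>- t\<close> is \<open>2 t \<bar>z\<bar> - t\<^sup>2 u\<close>; the bound is optimal for
  \<open>t = \<Phi> \<bar>z\<bar> / \<Phi> u\<close>.
\<close>

lemma square_over_Cauchy_Schwarz:
  assumes z: "z \<in> ideal_of u"
  shows "(dual_apply \<Phi> \<bar>z\<bar>)\<^sup>2 \<le> sq z * dual_apply \<Phi> u"
proof -
  define \<alpha> where "\<alpha> = dual_apply \<Phi> \<bar>z\<bar>"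
  define \<beta> where "\<beta> = dual_apply \<Phi> u"
  have \<alpha>0: "0 \<le> \<alpha>" and \<beta>0: "0 \<le> \<beta>"
    unfolding \<alpha>_def \<beta>_def by (auto intro: dual_apply_nonneg \<Phi> u)
  have quad: "2 * t * \<alpha> - t\<^sup>2 * \<beta> \<le> sq z" if t: "0 \<le> t" for t
  proof -
    let ?m = "Sup_fin (tangent z ` {t, - t})"
    have "tangent z t \<le> ?m" "tangent z (- t) \<le> ?m"
      by (intro Sup_fin.coboundedI; simp)+
    then have "(2 * t) *\<^sub>R z \<le> ?m + t\<^sup>2 *\<^sub>R u" "- ((2 * t) *\<^sub>R z) \<le> ?m + t\<^sup>2 *\<^sub>R u"
      by (simp_all only: diff_le_eq power2_minus mult_minus_right scaleR_minus_left)
    then have "\<bar>(2 * t) *\<^sub>R z\<bar> \<le> ?m + t\<^sup>2 *\<^sub>R u" by (rule abs_leI)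
    then have "(2 * t) *\<^sub>R \<bar>z\<bar> \<le> ?m + t\<^sup>2 *\<^sub>R u"
      using t by (simp add: lattice_abs_scaleR)
    from dual_apply_mono_right[OF \<Phi> this]
    have "2 * t * \<alpha> \<le> dual_apply \<Phi> ?m + t\<^sup>2 * \<beta>"
      by (simp only: dual_apply_add_right dual_apply_scaleR_right \<alpha>_def \<beta>_def)
    moreover have "dual_apply \<Phi> ?m \<le> sq z"
      by (rule square_over_upper[OF z]) auto
    ultimately show ?thesis by linarith
  qed
  show ?thesis
  proof (cases "\<beta> = 0")
    case True
    obtain c where "\<bar>z\<bar> \<le> c *\<^sub>R u" using z unfolding ideal_of_def by blast
    from dual_apply_mono_right[OF \<Phi> this] True \<alpha>0 have "\<alpha> = 0"
      by (simp add: dual_apply_scaleR_right \<alpha>_def \<beta>_def)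
    then show ?thesis using True by (simp add: \<alpha>_def \<beta>_def)
  next
    case False
    with \<beta>0 have \<beta>: "0 < \<beta>" by simp
    have "2 * (\<alpha> / \<beta>) * \<alpha> - (\<alpha> / \<beta>)\<^sup>2 * \<beta> \<le> sq z"
      using \<alpha>0 \<beta> by (intro quad) auto
    moreover have "2 * (\<alpha> / \<beta>) * \<alpha> - (\<alpha> / \<beta>)\<^sup>2 * \<beta> = \<alpha>\<^sup>2 / \<beta>"
      using \<beta> by (simp add: power2_eq_square field_simps)
    ultimately show ?thesis
      using \<beta> unfolding \<alpha>_def[symmetric] \<beta>_def[symmetric] by (simp add: divide_le_eq)
  qed
qed

text \<open>
  Late members of \<open>d\<close> are nearly orthogonal to any sum of earlier ones, so one can add up \<open>i\<close> members to a
  sum \<open>S\<close> whose square grows only like \<open>i\<close>, while \<open>\<psi> S \<ge> e * i\<close>. By the Cauchy--Schwarz inequality the averages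
  \<open>S / i\<close> tend to zero in the seminorm \<open>\<Phi> \<bar>_\<bar>\<close>.
\<close>

lemma Banach_Saks_averages:
  fixes d :: "nat \<Rightarrow> 'a" and \<psi> :: "'a dual"
  assumes d_le: "\<And>M. \<bar>d M\<bar> \<le> 2 *\<^sub>R u" and d_ge: "\<And>M. e \<le> dual_apply \<psi> (d M)"
    and orth: "\<And>j. (\<lambda>M. polar (d M) (d j)) \<longlonglongrightarrow> 0"
  obtains h :: "nat \<Rightarrow> 'a" where "\<And>n. \<bar>h n\<bar> \<le> 2 *\<^sub>R u" "(\<lambda>n. dual_apply \<Phi> \<bar>h n\<bar>) \<longlonglongrightarrow> 0"
    "\<And>n. e \<le> dual_apply \<psi> (h n)"
proof -
  define \<beta> where "\<beta> = dual_apply \<Phi> u"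
  have \<beta>0: "0 \<le> \<beta>" unfolding \<beta>_def by (intro dual_apply_nonneg \<Phi> u)
  have d: "\<bar>d M\<bar> \<le> 2 *\<^sub>R u" "d M \<in> ideal_of u" "e \<le> dual_apply \<psi> (d M)" for M
    using d_le[of M] d_ge[of M] unfolding ideal_of_def by (auto intro!: exI[of _ 2])
  define P where "P i S \<longleftrightarrow> S \<in> ideal_of u \<and> \<bar>S\<bar> \<le> (2 * real i) *\<^sub>R u \<and> e * real i \<le> dual_apply \<psi> S \<and>
    sq S \<le> real i * (4 * \<beta> + 1) \<and> (\<lambda>M. polar (d M) S) \<longlonglongrightarrow> 0" for i :: nat and S
  have "\<exists>S. P i S" for i
  proof (induction i)
    case 0
    have "P 0 0"
      unfolding P_def by (simp add: ideal_of_zero dual_apply_zero_right square_over_zero polar_def)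
    then show ?case by blast
  next
    case (Suc i)
    then obtain S where S: "S \<in> ideal_of u" "\<bar>S\<bar> \<le> (2 * real i) *\<^sub>R u" "e * real i \<le> dual_apply \<psi> S"
      "sq S \<le> real i * (4 * \<beta> + 1)" "(\<lambda>M. polar (d M) S) \<longlonglongrightarrow> 0"
      unfolding P_def by blast
    have "\<forall>\<^sub>F M in sequentially. polar (d M) S < 1"
      using S(5) by (rule order_tendstoD) simp
    then obtain M where M: "polar (d M) S < 1"
      using eventually_happens trivial_limit_sequentially by blast
    have "P (Suc i) (S + d M)"
      unfolding P_def
    proof (intro conjI)
      show "S + d M \<in> ideal_of u" by (intro ideal_of_intros S d)
      have Suc2: "2 * real (Suc i) = 2 * real i + 2" by simp
      show "\<bar>S + d M\<bar> \<le> (2 * real (Suc i)) *\<^sub>R u"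
        unfolding Suc2 scaleR_left_distrib
        by (rule order_trans[OF abs_triangle_ineq add_mono[OF S(2) d(1)]])
      show "e * real (Suc i) \<le> dual_apply \<psi> (S + d M)"
        using S(3) d(3)[of M] by (simp add: dual_apply_add_right algebra_simps)
      have "sq (S + d M) = sq S + sq (d M) + polar (d M) S / 2"
        using square_over_add[OF S(1) d(2)] polar_commute[OF S(1) d(2)] by simp
      also have "\<dots> \<le> real i * (4 * \<beta> + 1) + 2\<^sup>2 * \<beta> + 1"
        using S(4) M square_over_le[OF d(1), of M] by (simp add: \<beta>_def)
      finally show "sq (S + d M) \<le> real (Suc i) * (4 * \<beta> + 1)"
        by (simp add: algebra_simps)
      have "(\<lambda>N. polar (d N) S + polar (d N) (d M)) \<longlonglongrightarrow> 0 + 0"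
        by (intro tendsto_add S(5) orth)
      moreover have "polar (d N) (S + d M) = polar (d N) S + polar (d N) (d M)" for N
        using polar_add[OF S(1) d(2) d(2), of M N] polar_commute[of "S + d M" "d N"]
          polar_commute[of S "d N"] polar_commute[of "d M" "d N"] S(1) d(2)
        by (simp add: ideal_of_intros)
      ultimately show "(\<lambda>N. polar (d N) (S + d M)) \<longlonglongrightarrow> 0" by simp
    qed
    then show ?case by blast
  qed
  then obtain S where S: "\<And>i. P i (S i)" by metis
  define h where "h i = (1 / real (Suc i)) *\<^sub>R S (Suc i)" for i
  have h_le: "\<bar>h i\<bar> \<le> 2 *\<^sub>R u" for i
  proof -
    have "\<bar>h i\<bar> = (1 / real (Suc i)) *\<^sub>R \<bar>S (Suc i)\<bar>"
      unfolding h_def by (simp add: lattice_abs_scaleR)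
    also have "\<dots> \<le> (1 / real (Suc i)) *\<^sub>R (2 * real (Suc i)) *\<^sub>R u"
      using S[of "Suc i"] unfolding P_def by (intro scaleR_left_mono) auto
    also have "\<dots> = 2 *\<^sub>R u" by (simp del: of_nat_Suc)
    finally show ?thesis .
  qed
  have h_lim: "(\<lambda>i. dual_apply \<Phi> \<bar>h i\<bar>) \<longlonglongrightarrow> 0"
  proof -
    define K where "K = (4 * \<beta> + 1) * \<beta>"
    have bd: "dual_apply \<Phi> \<bar>h i\<bar> \<le> sqrt (K * inverse (real (Suc i)))" for i
    proof (rule real_le_rsqrt)
      have "(dual_apply \<Phi> \<bar>S (Suc i)\<bar>)\<^sup>2 \<le> sq (S (Suc i)) * \<beta>"
        unfolding \<beta>_def using S[of "Suc i"] by (intro square_over_Cauchy_Schwarz) (simp add: P_def)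
      also have "\<dots> \<le> real (Suc i) * (4 * \<beta> + 1) * \<beta>"
        using S[of "Suc i"] \<beta>0 unfolding P_def by (intro mult_right_mono) blast+
      finally have "(dual_apply \<Phi> \<bar>S (Suc i)\<bar>)\<^sup>2 \<le> real (Suc i) * K"
        by (simp add: K_def mult.assoc)
      then have "(1 / real (Suc i))\<^sup>2 * (dual_apply \<Phi> \<bar>S (Suc i)\<bar>)\<^sup>2 \<le> (1 / real (Suc i))\<^sup>2 * (real (Suc i) * K)"
        by (rule mult_left_mono) simp
      also have "\<dots> = K * inverse (real (Suc i))"
        by (simp add: power2_eq_square field_simps del: of_nat_Suc)
      finally show "(dual_apply \<Phi> \<bar>h i\<bar>)\<^sup>2 \<le> K * inverse (real (Suc i))"
        by (simp add: h_def lattice_abs_scaleR dual_apply_scaleR_right power_mult_distrib power_divide)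
    qed
    have "(\<lambda>i. sqrt (K * inverse (real (Suc i)))) \<longlonglongrightarrow> sqrt (K * 0)"
      by (intro tendsto_real_sqrt tendsto_mult tendsto_const LIMSEQ_inverse_real_of_nat)
    then have lim: "(\<lambda>i. sqrt (K * inverse (real (Suc i)))) \<longlonglongrightarrow> 0" by simp
    show ?thesis
      by (rule tendsto_sandwich[OF _ _ tendsto_const lim])
         (auto intro!: always_eventually dual_apply_nonneg \<Phi> bd simp del: of_nat_Suc)
  qed
  have "e \<le> dual_apply \<psi> (h i)" for i
  proof -
    have "e * real (Suc i) \<le> dual_apply \<psi> (S (Suc i))"
      using S[of "Suc i"] unfolding P_def by blast
    then show ?thesis
      by (simp add: h_def dual_apply_scaleR_right field_simps del: of_nat_Suc)
  qed
  from that[OF h_le h_lim this] show ?thesis .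
qed

text \<open>
  Take a diagonal subsequence along which the inner products with every \<open>g m\<close> converge. Differences of
  late terms become orthogonal to any fixed term. If \<open>\<psi>\<close> is not Cauchy along the subsequence, there are
  such differences on which \<open>\<psi>\<close> is at least some \<open>e > 0\<close>; their Banach--Saks averages contradict the
  hypothesis on \<open>\<psi>\<close>.
\<close>

theorem order_bounded_Cauchy_subseq:
  fixes g :: "nat \<Rightarrow> 'a"
  assumes g: "\<And>n. \<bar>g n\<bar> \<le> u"
  obtains r :: "nat \<Rightarrow> nat" where "strict_mono r"
    "\<And>\<psi> :: 'a dual. (\<And>h :: nat \<Rightarrow> 'a. (\<And>n. \<bar>h n\<bar> \<le> 2 *\<^sub>R u) \<Longrightarrow>
        (\<lambda>n. dual_apply \<Phi> \<bar>h n\<bar>) \<longlonglongrightarrow> 0 \<Longrightarrow> (\<lambda>n. dual_apply \<psi> (h n)) \<longlonglongrightarrow> 0) \<Longrightarrow>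
      Cauchy (\<lambda>n. dual_apply \<psi> (g (r n)))"
proof -
  define \<beta> where "\<beta> = dual_apply \<Phi> u"
  have \<beta>0: "0 \<le> \<beta>" unfolding \<beta>_def by (intro dual_apply_nonneg \<Phi> u)
  have ideal: "x \<in> ideal_of u" if "\<bar>x\<bar> \<le> c *\<^sub>R u" "0 \<le> c" for x c
    using that unfolding ideal_of_def by blast
  have gI: "g n \<in> ideal_of u" for n using g[of n] by (intro ideal[of _ 1]) auto
  have diff2: "\<bar>x - y\<bar> \<le> 2 *\<^sub>R u" "\<bar>x + y\<bar> \<le> 2 *\<^sub>R u" if "\<bar>x\<bar> \<le> u" "\<bar>y\<bar> \<le> u" for x y
    using add_mono[OF that] abs_triangle_ineq4[of x y] abs_triangle_ineq[of x y]
    by (auto simp: scaleR_2 intro: order_trans)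
  interpret subseqs "\<lambda>m s. convergent (\<lambda>k. polar (g (s k)) (g m))"
  proof
    fix m and s :: "nat \<Rightarrow> nat"
    have "norm (polar (g (s k)) (g m)) \<le> 4 * \<beta>" for k
    proof -
      have "0 \<le> sq (g (s k) + g m)" "0 \<le> sq (g (s k) - g m)"
        by (intro square_over_nonneg ideal_of_intros gI)+
      moreover have "sq (g (s k) + g m) \<le> 2\<^sup>2 * \<beta>" "sq (g (s k) - g m) \<le> 2\<^sup>2 * \<beta>"
        unfolding \<beta>_def by (intro square_over_le diff2 g)+
      ultimately show ?thesis by (simp add: polar_def)
    qed
    then have "bounded (range (\<lambda>k. polar (g (s k)) (g m)))"
      unfolding bounded_iff by blast
    then obtain l r where "strict_mono r" "((\<lambda>k. polar (g (s k)) (g m)) \<circ> r) \<longlonglongrightarrow> l"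
      using bounded_imp_convergent_subsequence by blast
    then show "\<exists>r. strict_mono r \<and> convergent (\<lambda>k. polar (g ((s \<circ> r) k)) (g m))"
      by (auto simp: convergent_def o_def)
  qed
  define r where "r = diagseq"
  have conv: "convergent (\<lambda>k. polar (g (r k)) (g m))" for m
  proof -
    have "convergent (\<lambda>k. polar (g ((diagseq \<circ> ((+) (Suc m))) k)) (g m))"
    proof (rule diagseq_holds)
      fix q s :: "nat \<Rightarrow> nat" and n
      assume "strict_mono q" "convergent (\<lambda>k. polar (g (s k)) (g n))"
      then show "convergent (\<lambda>k. polar (g ((s \<circ> q) k)) (g n))"
        using convergent_subseq_convergent[of "\<lambda>k. polar (g (s k)) (g n)" q] by (simp add: o_def)
    qed
    then obtain l where "(\<lambda>k. polar (g (r (k + Suc m))) (g m)) \<longlonglongrightarrow> l"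
      by (auto simp: convergent_def r_def o_def add.commute)
    then have "(\<lambda>k. polar (g (r k)) (g m)) \<longlonglongrightarrow> l" by (rule LIMSEQ_offset)
    then show ?thesis by (auto simp: convergent_def)
  qed
  show ?thesis
  proof (rule that)
    show "strict_mono r" unfolding r_def by (rule subseq_diagseq)
    fix \<psi> :: "'a dual"
    assume \<psi>: "\<And>h :: nat \<Rightarrow> 'a. (\<And>n. \<bar>h n\<bar> \<le> 2 *\<^sub>R u) \<Longrightarrow>
        (\<lambda>n. dual_apply \<Phi> \<bar>h n\<bar>) \<longlonglongrightarrow> 0 \<Longrightarrow> (\<lambda>n. dual_apply \<psi> (h n)) \<longlonglongrightarrow> 0"
    show "Cauchy (\<lambda>n. dual_apply \<psi> (g (r n)))"
    proof (rule ccontr)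
      assume "\<not> ?thesis"
      then obtain e where e: "0 < e"
        and "\<And>M. \<exists>m\<ge>M. \<exists>n\<ge>M. e \<le> \<bar>dual_apply \<psi> (g (r m)) - dual_apply \<psi> (g (r n))\<bar>"
        unfolding Cauchy_iff by (auto simp: not_less)
      then have "\<exists>p. M \<le> fst p \<and> M \<le> snd p \<and>
          e \<le> dual_apply \<psi> (g (r (fst p))) - dual_apply \<psi> (g (r (snd p)))" for M
        by (smt (verit) fst_conv snd_conv)
      then obtain p where p: "\<And>M. M \<le> fst (p M)" "\<And>M. M \<le> snd (p M)"
          "\<And>M. e \<le> dual_apply \<psi> (g (r (fst (p M)))) - dual_apply \<psi> (g (r (snd (p M))))"
        by metis
      define d where "d M = g (r (fst (p M))) - g (r (snd (p M)))" for M
      have d: "\<bar>d M\<bar> \<le> 2 *\<^sub>R u" "d M \<in> ideal_of u" "e \<le> dual_apply \<psi> (d M)" for M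
        unfolding d_def using p(3)[of M]
        by (auto intro!: diff2 g ideal_of_intros gI simp: dual_apply_diff_right)
      have top: "filterlim (\<lambda>M. fst (p M)) at_top sequentially" "filterlim (\<lambda>M. snd (p M)) at_top sequentially"
        using p(1,2) by (auto intro!: filterlim_at_top_mono[OF filterlim_ident])
      have orth: "(\<lambda>M. polar (d M) (g m)) \<longlonglongrightarrow> 0" for m
      proof -
        obtain l where l: "(\<lambda>k. polar (g (r k)) (g m)) \<longlonglongrightarrow> l"
          using conv by (auto simp: convergent_def)
        have "(\<lambda>M. polar (g (r (fst (p M)))) (g m) - polar (g (r (snd (p M)))) (g m)) \<longlonglongrightarrow> l - l"
          by (intro tendsto_diff filterlim_compose[OF l] top)
        then show ?thesis by (simp add: d_def polar_diff gI)
      qed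
      have orth_d: "(\<lambda>M. polar (d M) (d j)) \<longlonglongrightarrow> 0" for j
      proof -
        have "(\<lambda>M. polar (d M) (g (r (fst (p j)))) - polar (d M) (g (r (snd (p j))))) \<longlonglongrightarrow> 0 - 0"
          by (intro tendsto_diff orth)
        moreover have "polar (d M) (d j) = polar (d M) (g (r (fst (p j)))) - polar (d M) (g (r (snd (p j))))" for M
        proof -
          have "polar (d M) (d j) = polar (d j) (d M)" by (intro polar_commute d)
          also have "\<dots> = polar (g (r (fst (p j)))) (d M) - polar (g (r (snd (p j)))) (d M)"
            unfolding d_def[of j] by (intro polar_diff gI d)
          also have "\<dots> = polar (d M) (g (r (fst (p j)))) - polar (d M) (g (r (snd (p j))))"
            by (simp add: polar_commute gI d)
          finally show ?thesis .
        qed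
        ultimately show ?thesis by simp
      qed
      obtain h :: "nat \<Rightarrow> 'a" where h: "\<And>n. \<bar>h n\<bar> \<le> 2 *\<^sub>R u" "(\<lambda>n. dual_apply \<Phi> \<bar>h n\<bar>) \<longlonglongrightarrow> 0"
        "\<And>n. e \<le> dual_apply \<psi> (h n)"
        by (rule Banach_Saks_averages[OF d(1,3) orth_d]) (rule that)
      have "(\<lambda>n. dual_apply \<psi> (h n)) \<longlonglongrightarrow> 0" by (rule \<psi>[OF h(1,2)])
      then have "e \<le> 0" using h(3) LIMSEQ_le_const by blast
      with e show False by simp
    qed
  qed
qed

end

section \<open>Norm convergence in the order continuous part\<close>

text \<open>
  A greedy construction: each step moves up, in norm, at least half as far as is possible within \<open>S\<close>. The
  steps tend to zero since the sequence converges, so nothing in \<open>S\<close> lies above the limit.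
\<close>

lemma maximal_in_order_interval:
  fixes x :: "'a::banach_lattice"
  assumes x: "x \<in> monotone_convergent_part" and S: "S \<subseteq> {0..\<bar>x\<bar>}" "S \<noteq> {}"
    and closed: "\<And>u l. incseq u \<Longrightarrow> (\<And>n :: nat. u n \<in> S) \<Longrightarrow> u \<longlonglongrightarrow> l \<Longrightarrow> l \<in> S"
  obtains z where "z \<in> S" "\<And>w. w \<in> S \<Longrightarrow> z \<le> w \<Longrightarrow> w = z"
proof -
  have "\<exists>y\<in>S. z \<le> y \<and> (\<forall>w\<in>S. z \<le> w \<longrightarrow> norm (w - z) \<le> 2 * norm (y - z))" if z: "z \<in> S" for z
  proof -
    define D where "D = (\<lambda>w. norm (w - z)) ` {w \<in> S. z \<le> w}"
    have "bdd_above D"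
    proof (rule bdd_aboveI)
      fix d assume "d \<in> D"
      then obtain w where w: "w \<in> S" "z \<le> w" "d = norm (w - z)" unfolding D_def by blast
      have "w - z \<le> \<bar>x\<bar> - 0"
        using w z S(1) by (intro diff_mono) auto
      then show "d \<le> norm x"
        using w norm_mono_pos[of "w - z" "\<bar>x\<bar>"] by simp
    qed
    then have upper: "d \<le> Sup D" if "d \<in> D" for d using that by (rule cSup_upper[rotated])
    have zD: "0 \<in> D" unfolding D_def using z by (intro image_eqI[of _ _ z]) auto
    show ?thesis
    proof (cases "Sup D \<le> 0")
      case True
      have "norm (w - z) \<le> 0" if "w \<in> S" "z \<le> w" for w
      proof -
        have "norm (w - z) \<le> Sup D" using that by (intro upper) (auto simp: D_def)
        with True show ?thesis by linarith
      qed
      then show ?thesis using z by (intro bexI[of _ z]) auto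
    next
      case False
      then have "Sup D / 2 < Sup D" by simp
      then obtain d where "d \<in> D" "Sup D / 2 < d"
        using less_cSupD[of D "Sup D / 2"] zD by blast
      then obtain y where y: "y \<in> S" "z \<le> y" "Sup D / 2 < norm (y - z)"
        unfolding D_def by blast
      have "norm (w - z) \<le> 2 * norm (y - z)" if "w \<in> S" "z \<le> w" for w
      proof -
        have "norm (w - z) \<le> Sup D" using that by (intro upper) (auto simp: D_def)
        with y(3) show ?thesis by linarith
      qed
      with y show ?thesis by blast
    qed
  qed
  then obtain f where f: "\<And>z. z \<in> S \<Longrightarrow> f z \<in> S" "\<And>z. z \<in> S \<Longrightarrow> z \<le> f z"
    "\<And>z w. z \<in> S \<Longrightarrow> w \<in> S \<Longrightarrow> z \<le> w \<Longrightarrow> norm (w - z) \<le> 2 * norm (f z - z)"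
    by metis
  obtain z0 where "z0 \<in> S" using S(2) by blast
  define u where "u n = (f ^^ n) z0" for n
  have uS: "u n \<in> S" for n
    by (induction n) (simp_all add: u_def \<open>z0 \<in> S\<close> f)
  have uSuc: "u (Suc n) = f (u n)" for n by (simp add: u_def)
  have inc: "incseq u" by (intro incseq_SucI) (simp add: uSuc f uS)
  have uB: "0 \<le> u n" "u n \<le> \<bar>x\<bar>" for n using uS[of n] S(1) by auto
  have "convergent u"
    by (rule monotone_convergent_partD[OF x incseq_imp_monoseq[OF inc] uB])
  then obtain l where l: "u \<longlonglongrightarrow> l" by (auto simp: convergent_def)
  show ?thesis
  proof (rule that[of l])
    show "l \<in> S" by (rule closed[OF inc uS l])
    fix w assume w: "w \<in> S" "l \<le> w"
    have "norm (w - l) \<le> 2 * norm (u (Suc n) - u n)" for n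
    proof -
      have ul: "u n \<le> l" by (rule incseq_le_limit[OF inc l])
      have "norm (w - l) \<le> norm (w - u n)"
        using w ul by (intro norm_mono_pos diff_left_mono) auto
      also have "\<dots> \<le> 2 * norm (u (Suc n) - u n)"
        unfolding uSuc using w ul by (intro f(3) uS) auto
      finally show ?thesis .
    qed
    moreover have "(\<lambda>n. 2 * norm (u (Suc n) - u n)) \<longlonglongrightarrow> 2 * norm (l - l)"
      by (intro tendsto_intros l LIMSEQ_Suc)
    ultimately have "norm (w - l) \<le> 2 * norm (l - l)"
      using LIMSEQ_le_const by blast
    then show "w = l" by simp
  qed
qed

lemma subseq_small:
  fixes a :: "nat \<Rightarrow> real"
  assumes "a \<longlonglongrightarrow> 0"
  obtains r :: "nat \<Rightarrow> nat" where "strict_mono r" "\<And>n. a (r n) \<le> (1 / 2) ^ n"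
proof -
  have ev: "\<exists>N. \<forall>n\<ge>N. a n < (1 / 2) ^ k" for k :: nat
    using order_tendstoD(2)[OF assms, of "(1 / 2) ^ k"] by (simp add: eventually_sequentially)
  have 1: "\<exists>n. a n \<le> (1 / 2) ^ (0::nat)"
    using ev[of 0] by (meson less_imp_le order_refl)
  have 2: "\<exists>m. a m \<le> (1 / 2) ^ Suc k \<and> n < m" for k n
  proof -
    obtain N where "\<forall>n\<ge>N. a n < (1 / 2) ^ Suc k" using ev by blast
    then have "a (max N (Suc n)) \<le> (1 / 2) ^ Suc k" by (simp add: less_imp_le)
    then show ?thesis by (intro exI[of _ "max N (Suc n)"]) auto
  qed
  obtain r where "\<And>k. a (r k) \<le> (1 / 2) ^ k" "\<And>k. r k < r (Suc k)"
    using dependent_nat_choice[of "\<lambda>k n. a n \<le> (1 / 2) ^ k" "\<lambda>_ n m. n < m"] 1 2 by blast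
  then show ?thesis by (intro that[of r]) (auto simp: strict_mono_Suc_iff)
qed

definition finite_sups :: "(nat \<Rightarrow> 'a::lattice) \<Rightarrow> 'a set"
  where "finite_sups y = (\<lambda>K. Sup_fin (y ` K)) ` {K. finite K \<and> K \<noteq> {}}"

text \<open>
  Along a subsequence with \<open>\<Phi> (y n) \<le> (1 / 2) ^ n\<close>, the suprema of the tails exist as norm limits of
  finite suprema. They decrease to a limit on which \<open>\<Phi>\<close> vanishes. Only limits of finite suprema of the
  given sequence arise in this way, so \<open>\<Phi>\<close> has to be strictly positive on those only.
\<close>

lemma norm_null_subseq:
  fixes v :: "'a::banach_lattice"
  assumes v: "v \<in> monotone_convergent_part" and y: "\<And>n. 0 \<le> y n" "\<And>n. y n \<le> v"
    and \<Phi>: "0 \<le> \<Phi>" "(\<lambda>n. dual_apply \<Phi> (y n)) \<longlonglongrightarrow> 0"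
    and strict: "\<And>w. 0 \<le> w \<Longrightarrow> w \<le> v \<Longrightarrow> w \<in> closure (finite_sups y) \<Longrightarrow> dual_apply \<Phi> w = 0 \<Longrightarrow> w = 0"
  obtains r :: "nat \<Rightarrow> nat" where "strict_mono r" "(\<lambda>n. y (r n)) \<longlonglongrightarrow> 0"
proof -
  obtain r :: "nat \<Rightarrow> nat" where r: "strict_mono r" "\<And>n. dual_apply \<Phi> (y (r n)) \<le> (1 / 2) ^ n"
    using subseq_small[OF \<Phi>(2)] by blast
  have v0: "0 \<le> v" using y[of 0] by (rule order_trans)
  define s where "s m j = Sup_fin (y ` r ` {m..m + j})" for m j
  have s_le: "s m j \<le> c" if "\<And>k. m \<le> k \<Longrightarrow> k \<le> m + j \<Longrightarrow> y (r k) \<le> c" for m j c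
    unfolding s_def using that by (intro Sup_fin.boundedI) auto
  have s_ge: "y (r k) \<le> s m j" if "m \<le> k" "k \<le> m + j" for m j k
    unfolding s_def using that by (intro Sup_fin.coboundedI) auto
  have s0: "0 \<le> s m j" for m j using y(1)[of "r m"] s_ge[of m m j] by simp
  have s_fin: "s m j \<in> finite_sups y" for m j
    unfolding s_def finite_sups_def by (intro image_eqI[of _ _ "r ` {m..m + j}"]) auto
  have s_\<Phi>: "dual_apply \<Phi> (s m j) \<le> 2 * (1 / 2) ^ m" for m j
  proof -
    have "s m j \<le> (\<Sum>k\<in>{m..m + j}. y (r k))"
      using sum_mono2[of "{m..m + j}" "{k}" "\<lambda>k. y (r k)" for k] y(1) by (intro s_le) auto
    from dual_apply_mono_right[OF \<Phi>(1) this]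
    have "dual_apply \<Phi> (s m j) \<le> (\<Sum>k\<in>{m..m + j}. dual_apply \<Phi> (y (r k)))"
      by (simp add: dual_apply_sum_right)
    also have "\<dots> \<le> (\<Sum>k\<in>{m..m + j}. (1 / 2) ^ k)"
      by (intro sum_mono r)
    also have "\<dots> = (\<Sum>k\<in>{0..j}. (1 / 2) ^ m * (1 / 2) ^ k)"
      using sum.shift_bounds_cl_nat_ivl[of "\<lambda>k. (1 / 2 :: real) ^ k" 0 m j]
      by (simp add: power_add add.commute mult.commute)
    also have "\<dots> = (1 / 2) ^ m * (\<Sum>k<Suc j. (1 / 2) ^ k)"
      by (simp only: sum_distrib_left atLeast0AtMost lessThan_Suc_atMost)
    also have "\<dots> \<le> (1 / 2) ^ m * 2"
      by (intro mult_left_mono) (simp_all only: geometric_sum, auto simp: field_simps)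
    finally show ?thesis by simp
  qed
  have "convergent (s m)" for m
  proof (rule monotone_convergent_partD[OF v])
    show "monoseq (s m)"
      by (intro incseq_imp_monoseq incseq_SucI s_le s_ge) auto
    show "s m n \<le> \<bar>v\<bar>" for n
      using v0 by (intro s_le) (simp add: y)
  qed (rule s0)
  then obtain w where w: "\<And>m. s m \<longlonglongrightarrow> w m" unfolding convergent_def by metis
  have inc: "incseq (s m)" for m by (intro incseq_SucI s_le s_ge) auto
  have w0: "0 \<le> w m" for m
    using s0 by (intro lattice_LIMSEQ_le[OF tendsto_const w[of m]])
  have wv: "w m \<le> v" for m
    by (intro lattice_LIMSEQ_le[OF w[of m] tendsto_const] s_le y)
  have w_\<Phi>: "dual_apply \<Phi> (w m) \<le> 2 * (1 / 2) ^ m" for m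
  proof (rule LIMSEQ_le_const2)
    show "(\<lambda>j. dual_apply \<Phi> (s m j)) \<longlonglongrightarrow> dual_apply \<Phi> (w m)"
      by (rule bounded_linear.tendsto[OF bounded_linear_dual_apply w])
  qed (use s_\<Phi> in auto)
  have dec: "decseq w"
  proof (rule decseq_SucI)
    fix m
    have "s (Suc m) j \<le> s m (Suc j)" for j by (intro s_le s_ge) auto
    then show "w (Suc m) \<le> w m"
      by (intro lattice_LIMSEQ_le[OF w LIMSEQ_Suc[OF w]])
  qed
  have "convergent w"
    by (rule monotone_convergent_partD[OF v]) (use w0 wv v0 dec in \<open>auto intro: decseq_imp_monoseq\<close>)
  then obtain l where l: "w \<longlonglongrightarrow> l" by (auto simp: convergent_def)
  have "l = 0"
  proof (rule strict)
    show "0 \<le> l" using w0 by (intro lattice_LIMSEQ_le[OF tendsto_const l])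
    show "l \<le> v" by (intro lattice_LIMSEQ_le[OF l tendsto_const] wv)
    have "w m \<in> closure (finite_sups y)" for m
      using w[of m] s_fin unfolding closure_sequential by blast
    then show "l \<in> closure (finite_sups y)"
      using closed_sequentially[OF closed_closure _ l] by blast
    have "dual_apply \<Phi> l \<le> 2 * (1 / 2) ^ m" for m
      using dual_apply_mono_right[OF \<Phi>(1) decseq_ge_limit[OF dec l, of m]] w_\<Phi>[of m] by linarith
    moreover have "(\<lambda>m. 2 * (1 / 2) ^ m :: real) \<longlonglongrightarrow> 2 * 0"
      by (intro tendsto_mult tendsto_const LIMSEQ_realpow_zero) auto
    ultimately have "dual_apply \<Phi> l \<le> 2 * 0" using LIMSEQ_le_const by blast
    then show "dual_apply \<Phi> l = 0"
      using dual_apply_nonneg[OF \<Phi>(1) \<open>0 \<le> l\<close>] by simp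
  qed
  show ?thesis
  proof (rule that[OF r(1)])
    have "y (r m) \<le> w m" for m
      using incseq_le_limit[OF inc w, of m 0] s_ge[of m m 0] by simp
    then have "\<forall>\<^sub>F m in sequentially. norm (y (r m)) \<le> norm (w m)"
      by (intro always_eventually allI norm_mono_pos y)
    moreover have "(\<lambda>m. norm (w m)) \<longlonglongrightarrow> 0"
      using tendsto_norm[OF l] \<open>l = 0\<close> by simp
    ultimately show "(\<lambda>m. y (r m)) \<longlonglongrightarrow> 0" by (rule Lim_null_comparison)
  qed
qed

lemma strictly_positive_null:
  fixes u :: "'a::banach_lattice"
  assumes u: "u \<in> monotone_convergent_part" "0 \<le> u" and \<Phi>: "0 \<le> \<Phi>"
    and strict: "\<And>w. 0 \<le> w \<Longrightarrow> w \<le> u \<Longrightarrow> dual_apply \<Phi> w = 0 \<Longrightarrow> w = 0"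
    and h: "\<And>n. \<bar>h n\<bar> \<le> c *\<^sub>R u" "0 < c" "(\<lambda>n. dual_apply \<Phi> \<bar>h n\<bar>) \<longlonglongrightarrow> 0"
  shows "h \<longlonglongrightarrow> 0"
proof (rule tendsto_zero_by_subseqs)
  fix r :: "nat \<Rightarrow> nat" assume r: "strict_mono r"
  have "(\<lambda>n. dual_apply \<Phi> \<bar>h (r n)\<bar>) \<longlonglongrightarrow> 0"
    using LIMSEQ_subseq_LIMSEQ[OF h(3) r] by (simp add: o_def)
  moreover have "c *\<^sub>R u \<in> monotone_convergent_part"
    using u(1) by (rule monotone_convergent_part_scaleR)
  moreover have "w = 0" if "0 \<le> w" "w \<le> c *\<^sub>R u" "dual_apply \<Phi> w = 0" for w
  proof -
    have "(1 / c) *\<^sub>R w \<le> (1 / c) *\<^sub>R c *\<^sub>R u"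
      using that h(2) by (intro scaleR_left_mono) auto
    then have "(1 / c) *\<^sub>R w = 0"
      using that h(2) by (intro strict scaleR_nonneg_nonneg) (auto simp: dual_apply_scaleR_right)
    then show ?thesis using h(2) by simp
  qed
  ultimately obtain s :: "nat \<Rightarrow> nat" where "strict_mono s" "(\<lambda>n. \<bar>h (r (s n))\<bar>) \<longlonglongrightarrow> 0"
    using norm_null_subseq[of "c *\<^sub>R u" "\<lambda>n. \<bar>h (r n)\<bar>" \<Phi>] \<Phi> h(1) by force
  moreover from this(2) have "(\<lambda>n. norm \<bar>h (r (s n))\<bar>) \<longlonglongrightarrow> 0"
    by (rule tendsto_norm_zero)
  ultimately show "\<exists>s. strict_mono s \<and> (\<lambda>n. h (r (s n))) \<longlonglongrightarrow> 0"
    by (auto simp: tendsto_norm_zero_iff)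
qed

lemma countable_finite_sups: "countable (finite_sups y)"
  unfolding finite_sups_def
  by (intro countable_image countable_subset[OF _ countable_Collect_finite]) auto

lemma finite_sups_bounds:
  assumes "s \<in> finite_sups y" "\<And>n. a \<le> y n" "\<And>n. y n \<le> b"
  shows "a \<le> s" "s \<le> b"
proof -
  obtain K k where K: "finite K" "k \<in> K" "s = Sup_fin (y ` K)"
    using assms(1) unfolding finite_sups_def by blast
  have "y k \<le> s" unfolding K(3) using K by (intro Sup_fin.coboundedI) auto
  with assms(2)[of k] show "a \<le> s" by (rule order_trans)
  show "s \<le> b" unfolding K(3) using K assms(3) by (intro Sup_fin.boundedI) auto
qed

text \<open>
  A convergent series of functionals that are norming for the elements of \<open>D\<close>. If it vanishes at \<open>w\<close>,
  so do all of them; but \<open>w\<close> is close to some \<open>s\<close> in \<open>D\<close>, and the functional belonging to \<open>s\<close> has the value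
  \<open>norm s\<close> there.
\<close>

lemma functional_norming_countable:
  fixes D :: "'a::banach_lattice set"
  assumes "countable D" "D \<noteq> {}" and pos: "\<And>s. s \<in> D \<Longrightarrow> 0 \<le> s"
  obtains \<Phi> :: "'a dual" where "0 \<le> \<Phi>"
    "\<And>w. 0 \<le> w \<Longrightarrow> w \<in> closure D \<Longrightarrow> dual_apply \<Phi> w = 0 \<Longrightarrow> w = 0"
proof -
  have "\<exists>\<phi> :: 'a dual. 0 \<le> \<phi> \<and> norm \<phi> \<le> 1 \<and> dual_apply \<phi> s = norm s" if "s \<in> D" for s
    using positive_norming_functional[OF pos[OF that]] by blast
  then obtain \<phi> :: "'a \<Rightarrow> 'a dual" where \<phi>: "\<And>s. s \<in> D \<Longrightarrow> 0 \<le> \<phi> s" "\<And>s. s \<in> D \<Longrightarrow> norm (\<phi> s) \<le> 1"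
    "\<And>s. s \<in> D \<Longrightarrow> dual_apply (\<phi> s) s = norm s" by metis
  define e where "e = from_nat_into D"
  have eD: "e i \<in> D" for i unfolding e_def by (rule from_nat_into[OF assms(2)])
  have De: "\<exists>i. e i = s" if "s \<in> D" for s
    unfolding e_def using from_nat_into_surj[OF assms(1) that] .
  have summ: "summable (\<lambda>i. (1 / 2) ^ i *\<^sub>R \<phi> (e i))"
    by (rule summable_geometric_scaleR[where M = 1]) (use \<phi>(2) eD in auto)
  define \<Phi> where "\<Phi> = (\<Sum>i. (1 / 2) ^ i *\<^sub>R \<phi> (e i))"
  have nn: "0 \<le> (1 / 2) ^ i *\<^sub>R \<phi> (e i)" for i
    using \<phi>(1) eD by (intro scaleR_nonneg_nonneg) auto
  have ge: "(1 / 2) ^ i *\<^sub>R \<phi> (e i) \<le> \<Phi>" for i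
    unfolding \<Phi>_def by (rule nonneg_term_le_suminf[OF summ nn])
  show ?thesis
  proof (rule that)
    show "0 \<le> \<Phi>" using order_trans[OF nn ge] .
    fix w assume w: "0 \<le> w" "w \<in> closure D" "dual_apply \<Phi> w = 0"
    have zero: "dual_apply (\<phi> s) w = 0" if s: "s \<in> D" for s
    proof -
      obtain i where i: "e i = s" using De s by blast
      have "(1 / 2) ^ i * dual_apply (\<phi> s) w \<le> 0"
        using dual_apply_mono[OF ge[of i] w(1)] w(3) i by (simp add: dual_apply_scaleR)
      moreover have "0 < (1 / 2 :: real) ^ i" by simp
      ultimately have "dual_apply (\<phi> s) w \<le> 0"
        by (simp only: mult_le_0_iff) linarith
      then show ?thesis using dual_apply_nonneg[OF \<phi>(1)[OF s] w(1)] by simp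
    qed
    have "norm w \<le> e'" if e': "0 < e'" for e' :: real
    proof -
      obtain s where s: "s \<in> D" "dist s w < e' / 2"
        using w(2) half_gt_zero[OF e'] unfolding closure_approachable by blast
      have "norm s = dual_apply (\<phi> s) (s - w)"
        using \<phi>(3)[OF s(1)] zero[OF s(1)] by (simp add: dual_apply_diff_right)
      also have "\<dots> \<le> norm (\<phi> s) * norm (s - w)"
        using norm_dual_apply[of "\<phi> s" "s - w"] by linarith
      also have "\<dots> \<le> 1 * norm (s - w)"
        using \<phi>(2)[OF s(1)] by (intro mult_right_mono) auto
      finally have "norm s \<le> norm (s - w)" by simp
      moreover have "norm w \<le> norm s + norm (s - w)"
        using norm_triangle_ineq4[of s "s - w"] by simp
      ultimately show ?thesis using s(2) by (simp add: dist_norm)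
    qed
    then have "norm w \<le> 0 + e'" if "0 < e'" for e' :: real using that by simp
    then have "norm w \<le> 0" by (rule field_le_epsilon)
    then show "w = 0" by simp
  qed
qed

text \<open>
  The finite suprema of the terms are countably many, so one functional controls all of them.
\<close>

lemma positive_weakly_null_imp_norm_null:
  fixes v :: "'a::banach_lattice"
  assumes v: "v \<in> monotone_convergent_part" and y: "\<And>n. 0 \<le> y n" "\<And>n. y n \<le> v"
    and weak: "\<And>\<Phi> :: 'a dual. 0 \<le> \<Phi> \<Longrightarrow> (\<lambda>n. dual_apply \<Phi> (y n)) \<longlonglongrightarrow> 0"
  shows "y \<longlonglongrightarrow> 0"
proof (rule tendsto_zero_by_subseqs)
  fix r :: "nat \<Rightarrow> nat" assume r: "strict_mono r"
  let ?D = "finite_sups (\<lambda>n. y (r n))"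
  have ne: "?D \<noteq> {}" unfolding finite_sups_def by auto
  have "0 \<le> s" if "s \<in> ?D" for s
    using finite_sups_bounds(1)[OF that] y by blast
  then obtain \<Phi> :: "'a dual" where \<Phi>: "0 \<le> \<Phi>"
    "\<And>w. 0 \<le> w \<Longrightarrow> w \<in> closure ?D \<Longrightarrow> dual_apply \<Phi> w = 0 \<Longrightarrow> w = 0"
    using functional_norming_countable[OF countable_finite_sups ne] by blast
  have lim: "(\<lambda>n. dual_apply \<Phi> (y (r n))) \<longlonglongrightarrow> 0"
    using LIMSEQ_subseq_LIMSEQ[OF weak[OF \<Phi>(1)] r] by (simp add: o_def)
  have strict: "\<And>w. 0 \<le> w \<Longrightarrow> w \<le> v \<Longrightarrow> w \<in> closure ?D \<Longrightarrow> dual_apply \<Phi> w = 0 \<Longrightarrow> w = 0"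
    using \<Phi>(2) by blast
  obtain s :: "nat \<Rightarrow> nat" where "strict_mono s" "(\<lambda>n. y (r (s n))) \<longlonglongrightarrow> 0"
    by (rule norm_null_subseq[where y = "\<lambda>n. y (r n)", OF v y(1) y(2) \<Phi>(1) lim strict])
  then show "\<exists>s. strict_mono s \<and> (\<lambda>n. y (r (s n))) \<longlonglongrightarrow> 0" by blast
qed

text \<open>The case in which a single functional controls the norm on the order interval.\<close>

lemma strictly_positive_weakly_Cauchy_subseq:
  fixes u :: "'a::banach_lattice"
  assumes u: "u \<in> monotone_convergent_part" "0 \<le> u" and \<Phi>: "0 \<le> \<Phi>"
    and strict: "\<And>w. 0 \<le> w \<Longrightarrow> w \<le> u \<Longrightarrow> dual_apply \<Phi> w = 0 \<Longrightarrow> w = 0"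
    and g: "\<And>n. \<bar>g n\<bar> \<le> u"
  obtains r :: "nat \<Rightarrow> nat" where "strict_mono r" "\<And>\<psi> :: 'a dual. Cauchy (\<lambda>n. dual_apply \<psi> (g (r n)))"
proof -
  obtain r :: "nat \<Rightarrow> nat" where r: "strict_mono r"
    "\<And>\<psi> :: 'a dual. (\<And>h :: nat \<Rightarrow> 'a. (\<And>n. \<bar>h n\<bar> \<le> 2 *\<^sub>R u) \<Longrightarrow>
        (\<lambda>n. dual_apply \<Phi> \<bar>h n\<bar>) \<longlonglongrightarrow> 0 \<Longrightarrow> (\<lambda>n. dual_apply \<psi> (h n)) \<longlonglongrightarrow> 0) \<Longrightarrow>
      Cauchy (\<lambda>n. dual_apply \<psi> (g (r n)))"
    using order_bounded_Cauchy_subseq[where u = u and g = g, OF \<Phi> u(2) g] by blast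
  show ?thesis
  proof (rule that[OF r(1)], rule r(2))
    fix \<psi> :: "'a dual" and h :: "nat \<Rightarrow> 'a"
    assume "\<And>n. \<bar>h n\<bar> \<le> 2 *\<^sub>R u" "(\<lambda>n. dual_apply \<Phi> \<bar>h n\<bar>) \<longlonglongrightarrow> 0"
    then have "h \<longlonglongrightarrow> 0"
      by (intro strictly_positive_null[OF u \<Phi> strict]) auto
    from bounded_linear.tendsto[OF bounded_linear_dual_apply this, of \<psi>]
    show "(\<lambda>n. dual_apply \<psi> (h n)) \<longlonglongrightarrow> 0" by (simp add: dual_apply_zero_right)
  qed
qed

section \<open>Weakly null sequences in a discrete order continuous part\<close>

lemma tendsto_zero_approx:
  fixes X :: "nat \<Rightarrow> 'a::real_normed_vector"
  assumes "\<And>e. 0 < e \<Longrightarrow> \<exists>y. y \<longlonglongrightarrow> 0 \<and> (\<forall>n. norm (X n) \<le> y n + e)"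
  shows "X \<longlonglongrightarrow> 0"
proof (rule LIMSEQ_I)
  fix r :: real assume r: "0 < r"
  then obtain y where y: "y \<longlonglongrightarrow> 0" "\<And>n. norm (X n) \<le> y n + r / 2"
    using assms[of "r / 2"] by auto
  obtain N where N: "\<And>n. N \<le> n \<Longrightarrow> norm (y n - 0) < r / 2"
    using LIMSEQ_D[OF y(1), of "r / 2"] r by auto
  have "norm (X n - 0) < r" if "N \<le> n" for n
    using y(2)[of n] N[OF that] by simp
  then show "\<exists>N. \<forall>n\<ge>N. norm (X n - 0) < r" by blast
qed

lemma weakly_null_dual_apply:
  assumes "weakly_null x"
  shows "(\<lambda>n. dual_apply f (x n)) \<longlonglongrightarrow> 0"
  using assms unfolding weakly_null_def dual_apply.rep_eq by blast

lemma weakly_nullI: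
  assumes "\<And>f :: 'a::real_normed_vector dual. (\<lambda>n. dual_apply f (x n)) \<longlonglongrightarrow> 0"
  shows "weakly_null x"
  unfolding weakly_null_def
proof
  fix \<phi> :: "'a \<Rightarrow>\<^sub>L real"
  show "(\<lambda>n. blinfun_apply \<phi> (x n)) \<longlonglongrightarrow> 0"
    using assms[of "Dual \<phi>"] by (simp add: dual_apply.rep_eq Dual_inverse)
qed

lemma LwccI:
  assumes "\<And>x. weakly_null x \<Longrightarrow> L_weakly_compact (range x) \<Longrightarrow> (\<lambda>n. blinfun_apply T (x n)) \<longlonglongrightarrow> 0"
  shows "Lwcc T"
  unfolding Lwcc_def using assms tendsto_norm_zero by blast

lemma discrete_element_below:
  fixes a y :: "'a::banach_lattice"
  assumes a: "discrete_element a" and y: "0 \<le> y" "y \<le> c *\<^sub>R a"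
  obtains t where "0 \<le> t" "y = t *\<^sub>R a"
proof -
  have "y \<in> I" if I: "order_ideal I" "{a} \<subseteq> I" for I
  proof -
    have "c *\<^sub>R a \<in> I" using I unfolding order_ideal_def by (auto intro: subspace_scale)
    then have "y \<in> solid_hull I"
      using y by (intro solid_hull_abs_le[of "c *\<^sub>R a"]) auto
    then show ?thesis using I unfolding order_ideal_def by blast
  qed
  then have "y \<in> order_ideal hull {a}" unfolding hull_def by blast
  then have "y \<in> span {a}" using a unfolding discrete_element_def by simp
  then obtain t where t: "y = t *\<^sub>R a" unfolding span_singleton by blast
  have a0: "0 < a" using a unfolding discrete_element_def by blast
  show ?thesis
  proof (cases "0 \<le> t")
    case False
    have "t *\<^sub>R a \<le> 0"
      using False a0 scaleR_left_mono[of 0 a "- t"] by simp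
    then have "y = 0" using y(1) t by simp
    then show ?thesis by (intro that[of 0]) auto
  qed (use t that in blast)
qed

text \<open>
  The coordinate along \<open>a\<close>. On the band generated by an atom all functionals with value \<open>1\<close> at \<open>a\<close> agree, so
  the choice of \<open>f\<close> is immaterial.
\<close>

definition atom_functional :: "'a::banach_lattice \<Rightarrow> 'a dual"
  where "atom_functional a = dual_component a (SOME f. 0 \<le> f \<and> dual_apply f a = 1)"

context
  fixes a :: "'a::banach_lattice"
  assumes a: "discrete_element a"
begin

lemma atom_pos: "0 < a" "0 < norm a"
  using a unfolding discrete_element_def by auto

lemma atom_functional_eq:
  obtains f where "0 \<le> f" "dual_apply f a = 1" "atom_functional a = dual_component a f"
proof -
  obtain \<phi> :: "'a dual" where \<phi>: "0 \<le> \<phi>" "norm \<phi> \<le> 1" "dual_apply \<phi> a = norm a"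
    by (rule positive_norming_functional[OF less_imp_le[OF atom_pos(1)]])
  have "\<exists>f :: 'a dual. 0 \<le> f \<and> dual_apply f a = 1"
    using \<phi> atom_pos(2)
    by (intro exI[of _ "(1 / norm a) *\<^sub>R \<phi>"]) (simp add: dual_apply_scaleR scaleR_nonneg_nonneg)
  from someI_ex[OF this] show ?thesis
    by (intro that[of "SOME f. 0 \<le> f \<and> dual_apply f a = 1"]) (auto simp: atom_functional_def)
qed

lemma atom_functional_nonneg:
  assumes "0 \<le> x"
  shows "0 \<le> dual_apply (atom_functional a) x"
proof -
  obtain f where f: "0 \<le> f" "atom_functional a = dual_component a f"
    by (rule atom_functional_eq) (rule that)
  show ?thesis
    unfolding f(2) by (intro dual_apply_nonneg dual_component_nonneg f(1) assms less_imp_le[OF atom_pos(1)])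
qed

lemma atom_functional_upper:
  assumes t: "0 \<le> t" "t *\<^sub>R a \<le> x"
  shows "t \<le> dual_apply (atom_functional a) x"
proof -
  obtain f where f: "0 \<le> f" "dual_apply f a = 1" "atom_functional a = dual_component a f"
    by (rule atom_functional_eq)
  have a0: "0 \<le> a" using atom_pos(1) by simp
  have "dual_apply (atom_functional a) (t *\<^sub>R a) = t"
    using dual_component_eq[OF a0 f(1) scaleR_nonneg_nonneg[OF t(1) a0] order_refl t(1)] f(2)
    by (simp add: f(3) dual_apply_scaleR_right)
  moreover have "0 \<le> atom_functional a"
    unfolding f(3) by (rule dual_component_nonneg[OF a0 f(1)])
  ultimately show ?thesis
    using dual_apply_mono_right[OF _ t(2)] by metis
qed

lemma atom_component_nonneg: "0 \<le> x \<Longrightarrow> 0 \<le> dual_apply (atom_functional a) x *\<^sub>R a"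
  using atom_functional_nonneg[of x] atom_pos(1) by (intro scaleR_nonneg_nonneg) auto

text \<open>
  Every \<open>inf x (k *\<^sub>R a)\<close> is a multiple \<open>t *\<^sub>R a\<close> below \<open>x\<close>, and the coordinate of \<open>x\<close> is the supremum of
  these \<open>t\<close>.
\<close>

lemma atom_component_le:
  assumes x: "0 \<le> x"
  shows "dual_apply (atom_functional a) x *\<^sub>R a \<le> x"
proof -
  obtain f where f: "0 \<le> f" "dual_apply f a = 1" "atom_functional a = dual_component a f"
    by (rule atom_functional_eq)
  have a0: "0 \<le> a" using atom_pos(1) by simp
  define c where "c = component_on a f x"
  have below: "(c - inverse (real (Suc n))) *\<^sub>R a \<le> x" for n
  proof (rule ccontr)
    assume n: "\<not> (c - inverse (real (Suc n))) *\<^sub>R a \<le> x"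
    have "component_on a f x \<le> c - inverse (real (Suc n))"
    proof (rule component_on_least[OF a0 f(1)])
      fix k :: real assume k: "0 \<le> k"
      have "0 \<le> inf x (k *\<^sub>R a)" "inf x (k *\<^sub>R a) \<le> k *\<^sub>R a"
        using x scaleR_nonneg_nonneg[OF k a0] by auto
      then obtain t where t: "0 \<le> t" "inf x (k *\<^sub>R a) = t *\<^sub>R a"
        by (rule discrete_element_below[OF a])
      show "dual_apply f (inf x (k *\<^sub>R a)) \<le> c - inverse (real (Suc n))"
      proof (rule ccontr)
        assume "\<not> ?thesis"
        then have "c - inverse (real (Suc n)) \<le> t"
          unfolding t(2) using f(2) by (simp add: dual_apply_scaleR_right)
        then have "(c - inverse (real (Suc n))) *\<^sub>R a \<le> t *\<^sub>R a"
          using a0 by (rule scaleR_right_mono)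
        also have "\<dots> \<le> x" unfolding t(2)[symmetric] by simp
        finally show False using n by simp
      qed
    qed
    moreover have "0 < inverse (real (Suc n))" by simp
    ultimately show False unfolding c_def by linarith
  qed
  have "(\<lambda>n. (c - inverse (real (Suc n))) *\<^sub>R a) \<longlonglongrightarrow> (c - 0) *\<^sub>R a"
    by (intro tendsto_intros LIMSEQ_inverse_real_of_nat)
  then have "(c - 0) *\<^sub>R a \<le> x"
    by (rule lattice_LIMSEQ_le[OF _ tendsto_const, where N = 0]) (rule below)
  then show ?thesis using x by (simp add: c_def f(3) dual_component_apply[OF a0 f(1)])
qed

end

lemma atom_multiples_disjoint:
  fixes a b :: "'a::banach_lattice"
  assumes "discrete_element a" "discrete_element b" "lat_disjoint a b" "0 \<le> s" "0 \<le> t"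
  shows "inf (s *\<^sub>R a) (t *\<^sub>R b) = 0"
proof -
  have "inf a b = 0"
    using assms(3) atom_pos(1)[OF assms(1)] atom_pos(1)[OF assms(2)] by (simp add: lat_disjoint_def)
  then have "inf (t *\<^sub>R b) a = 0"
    using inf_scaleR_eq_0[of a b t] assms(5) by (simp add: inf_commute)
  then show ?thesis
    using inf_scaleR_eq_0[of "t *\<^sub>R b" a s] assms(4) by (simp add: inf_commute)
qed

text \<open>
  The remainders form a downward directed set with infimum zero: the coordinate of \<open>u\<close> along an atom
  is the largest possible one, so a positive lower bound of the remainders is disjoint from all atoms.
\<close>

lemma discrete_approximation:
  fixes A :: "'a::banach_lattice set"
  assumes A: "\<And>a. a \<in> A \<Longrightarrow> discrete_element a" "pairwise lat_disjoint A"
    and complete: "\<And>y. y \<in> monotone_convergent_part \<Longrightarrow> (\<And>a. a \<in> A \<Longrightarrow> lat_disjoint y a) \<Longrightarrow> y = 0"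
    and u: "u \<in> monotone_convergent_part" "0 \<le> u" and e: "0 < e"
  obtains G where "finite G" "G \<subseteq> A"
    "norm (u - (\<Sum>a\<in>G. dual_apply (atom_functional a) u *\<^sub>R a)) < e"
proof -
  define s where "s G = (\<Sum>a\<in>G. dual_apply (atom_functional a) u *\<^sub>R a)" for G
  define D where "D = (\<lambda>G. u - s G) ` {G. finite G \<and> G \<subseteq> A}"
  have nn: "0 \<le> dual_apply (atom_functional a) u *\<^sub>R a" if "a \<in> A" for a
    using A(1)[OF that] u(2) by (rule atom_component_nonneg)
  have s0: "0 \<le> s G" if "G \<subseteq> A" for G
    unfolding s_def using nn that by (intro sum_nonneg) auto
  have su: "s G \<le> u" if "finite G" "G \<subseteq> A" for G
    unfolding s_def
  proof (rule sum_le_of_disjoint[OF that(1) _ _ _ u(2)])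
    show "pairwise (\<lambda>a b. inf (dual_apply (atom_functional a) u *\<^sub>R a) (dual_apply (atom_functional b) u *\<^sub>R b) = 0) G"
    proof (rule pairwiseI)
      fix a b assume "a \<in> G" "b \<in> G" "a \<noteq> b"
      then show "inf (dual_apply (atom_functional a) u *\<^sub>R a) (dual_apply (atom_functional b) u *\<^sub>R b) = 0"
        using that(2) A u(2)
        by (intro atom_multiples_disjoint atom_functional_nonneg) (auto simp: pairwise_def)
    qed
  qed (use that A(1) nn u(2) in \<open>auto intro: atom_component_le\<close>)
  have "directed_down_to_zero_in monotone_convergent_part D"
    unfolding directed_down_to_zero_in_def
  proof (intro conjI ballI impI)
    show "D \<subseteq> monotone_convergent_part"
    proof
      fix d assume "d \<in> D"
      then obtain G where G: "finite G" "G \<subseteq> A" "d = u - s G" unfolding D_def by blast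
      have "d \<le> u - 0" unfolding G(3) using s0[OF G(2)] by (intro diff_left_mono)
      then have "\<bar>d\<bar> \<le> \<bar>u\<bar>" using su[OF G(1,2)] u(2) G(3) by simp
      with u(1) show "d \<in> monotone_convergent_part" by (rule monotone_convergent_part_solid)
    qed
    show "D \<noteq> {}" unfolding D_def by blast
    show "0 \<le> d" if "d \<in> D" for d using that su unfolding D_def by auto
  next
    fix x y assume "x \<in> D" "y \<in> D"
    then obtain G H where G: "finite G" "G \<subseteq> A" "x = u - s G" and H: "finite H" "H \<subseteq> A" "y = u - s H"
      unfolding D_def by blast
    have "s G \<le> s (G \<union> H)" "s H \<le> s (G \<union> H)"
      unfolding s_def using G H nn by (auto intro!: sum_mono2)
    then show "\<exists>z\<in>D. z \<le> x \<and> z \<le> y"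
      unfolding G(3) H(3) D_def using G H
      by (intro bexI[of _ "u - s (G \<union> H)"]) (auto intro: diff_left_mono)
  next
    fix w assume w: "w \<in> monotone_convergent_part" "\<forall>x\<in>D. w \<le> x"
    have le: "pprt w \<le> u - s G" if "finite G" "G \<subseteq> A" for G
      using w(2) su that unfolding D_def by (auto simp: pprt_le_iff)
    have "pprt w = 0"
    proof (rule complete)
      show "pprt w \<in> monotone_convergent_part"
        using w(1) by (rule monotone_convergent_part_solid) (simp add: pprt_le_abs)
      fix a assume a: "a \<in> A"
      note atom = A(1)[OF a]
      have a0: "0 \<le> a" using atom_pos(1)[OF atom] by simp
      have "0 \<le> inf (pprt w) a" "inf (pprt w) a \<le> 1 *\<^sub>R a" using a0 by auto
      then obtain t where t: "0 \<le> t" "inf (pprt w) a = t *\<^sub>R a"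
        by (rule discrete_element_below[OF atom])
      have "t *\<^sub>R a \<le> u - s {a}"
        using le[of "{a}"] a inf_le1[of "pprt w" a] unfolding t(2) by (auto intro: order_trans)
      then have "(t + dual_apply (atom_functional a) u) *\<^sub>R a \<le> u"
        unfolding s_def by (simp add: scaleR_left_distrib le_diff_eq)
      then have "t + dual_apply (atom_functional a) u \<le> dual_apply (atom_functional a) u"
        using t(1) atom_functional_nonneg[OF atom u(2)] by (intro atom_functional_upper[OF atom]) auto
      then have "t = 0" using t(1) by simp
      then show "lat_disjoint (pprt w) a"
        using t(2) a0 by (simp add: lat_disjoint_def)
    qed
    then show "w \<le> 0" by (simp add: le_zero_iff_zero_pprt)
  qed
  then obtain d where "d \<in> D" "norm d < e"
    using order_continuous_norm_on_monotone_convergent_part e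
    unfolding order_continuous_norm_on_def by (metis order_refl)
  then show ?thesis using that unfolding D_def s_def by blast
qed

text \<open>
  The finite sum \<open>S\<close> of components along atoms and its complement \<open>R\<close> are positive, so a bound for \<open>R u\<close>
  gives one for \<open>R (x n)\<close> up to the error of \<open>u\<close> as an almost order bound. On the other hand
  \<open>S (x n)\<close> tends to zero because it consists of finitely many coordinates.
\<close>

theorem weakly_null_norm_null_if_discrete:
  fixes x :: "nat \<Rightarrow> 'a::banach_lattice"
  assumes disc: "discrete_ideal (monotone_convergent_part :: 'a set)"
    and x: "weakly_null x" "L_weakly_compact (range x)"
  shows "x \<longlonglongrightarrow> 0"
proof (rule tendsto_zero_approx)
  fix e :: real assume e: "0 < e"
  obtain A :: "'a set" where A: "\<And>a. a \<in> A \<Longrightarrow> discrete_element a" "pairwise lat_disjoint A"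
    "\<And>y. y \<in> monotone_convergent_part \<Longrightarrow> (\<And>a. a \<in> A \<Longrightarrow> lat_disjoint y a) \<Longrightarrow> y = 0"
    using disc unfolding discrete_ideal_def by metis
  have e2: "0 < e / 2" using e by simp
  obtain u where u: "u \<in> monotone_convergent_part" "0 \<le> u"
    "\<And>y. y \<in> range x \<Longrightarrow> norm (pprt (\<bar>y\<bar> - u)) \<le> e / 2"
    by (rule L_weakly_compact_almost_order_bounded[OF x(2) e2]) (rule that)
  obtain G where G: "finite G" "G \<subseteq> A"
    "norm (u - (\<Sum>a\<in>G. dual_apply (atom_functional a) u *\<^sub>R a)) < e / 2"
    using discrete_approximation[OF A u(1,2) e2] by blast
  define S where "S y = (\<Sum>a\<in>G. dual_apply (atom_functional a) y *\<^sub>R a)" for y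
  have S_diff: "S (y - z) = S y - S z" for y z
    unfolding S_def by (simp add: dual_apply_diff_right scaleR_left_diff_distrib sum_subtractf)
  have S_add: "S (y + z) = S y + S z" for y z
    unfolding S_def by (simp add: dual_apply_add_right scaleR_left_distrib sum.distrib)
  have S_nonneg: "0 \<le> S y" if "0 \<le> y" for y
    unfolding S_def using A(1) G(2) that
    by (intro sum_nonneg atom_component_nonneg) auto
  have S_le: "S y \<le> y" if "0 \<le> y" for y
    unfolding S_def
  proof (rule sum_le_of_disjoint[OF G(1) _ _ _ that])
    show "pairwise (\<lambda>a b. inf (dual_apply (atom_functional a) y *\<^sub>R a) (dual_apply (atom_functional b) y *\<^sub>R b) = 0) G"
      using A(1) pairwise_subset[OF A(2) G(2)] G(2) that
      by (intro pairwiseI atom_multiples_disjoint atom_functional_nonneg) (auto simp: pairwise_def)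
    show "0 \<le> dual_apply (atom_functional a) y *\<^sub>R a" if "a \<in> G" for a
      using A(1)[of a] G(2) that \<open>0 \<le> y\<close>
      by (intro atom_component_nonneg) auto
    show "dual_apply (atom_functional a) y *\<^sub>R a \<le> y" if "a \<in> G" for a
      using A(1)[of a] G(2) that \<open>0 \<le> y\<close> by (intro atom_component_le) auto
  qed
  define R where "R y = y - S y" for y
  have R_diff: "R (y - z) = R y - R z" for y z unfolding R_def S_diff by simp
  have R_add: "R (y + z) = R y + R z" for y z unfolding R_def S_add by simp
  have R0: "0 \<le> R y" "R y \<le> y" if "0 \<le> y" for y
    unfolding R_def using S_le[OF that] S_nonneg[OF that] by auto
  have R_mono: "R y \<le> R z" if "y \<le> z" for y z
    using R0(1)[of "z - y"] that by (simp add: R_diff)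
  have R_abs: "\<bar>R y\<bar> \<le> R \<bar>y\<bar>" for y
  proof (rule abs_leI)
    show "R y \<le> R \<bar>y\<bar>" by (rule R_mono[OF abs_ge_self])
    have "R (- y) = - R y" using R_diff[of 0 y] R_diff[of 0 0] by simp
    then show "- R y \<le> R \<bar>y\<bar>" using R_mono[OF abs_ge_minus_self[of y]] by simp
  qed
  have R_small: "norm (R (x n)) \<le> e" for n
  proof -
    have "R \<bar>x n\<bar> \<le> R u + R (pprt (\<bar>x n\<bar> - u))"
      unfolding R_add[symmetric] by (rule R_mono[OF le_add_pprt_minus])
    also have "\<dots> \<le> R u + pprt (\<bar>x n\<bar> - u)"
      by (intro add_left_mono R0) auto
    finally have "\<bar>R (x n)\<bar> \<le> R u + pprt (\<bar>x n\<bar> - u)"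
      using R_abs order_trans by blast
    then have "norm \<bar>R (x n)\<bar> \<le> norm (R u + pprt (\<bar>x n\<bar> - u))"
      by (intro norm_mono_pos) auto
    also have "\<dots> \<le> norm (R u) + norm (pprt (\<bar>x n\<bar> - u))" by (rule norm_triangle_ineq)
    also have "\<dots> \<le> e / 2 + e / 2"
      using G(3) u(3)[of "x n"] unfolding R_def S_def by (intro add_mono) auto
    finally show ?thesis by simp
  qed
  have "(\<lambda>n. S (x n)) \<longlonglongrightarrow> (\<Sum>a\<in>G. 0 *\<^sub>R a)"
    unfolding S_def by (intro tendsto_sum tendsto_scaleR tendsto_const weakly_null_dual_apply x(1))
  then have "(\<lambda>n. S (x n)) \<longlonglongrightarrow> 0" by simp
  then have "(\<lambda>n. norm (S (x n))) \<longlonglongrightarrow> 0" by (rule tendsto_norm_zero)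
  moreover have "norm (x n) \<le> norm (S (x n)) + e" for n
    using norm_triangle_ineq[of "S (x n)" "R (x n)"] R_small[of n] by (simp add: R_def)
  ultimately show "\<exists>y. y \<longlonglongrightarrow> 0 \<and> (\<forall>n. norm (x n) \<le> y n + e)" by blast
qed

section \<open>Operators into order continuous lattices\<close>

lemma almost_orthogonal_subseq:
  fixes b :: "nat \<Rightarrow> nat \<Rightarrow> real"
  assumes "\<And>i. (\<lambda>n. b i n) \<longlonglongrightarrow> 0" and e: "0 < e"
  obtains \<sigma> :: "nat \<Rightarrow> nat" where "strict_mono \<sigma>" "\<And>i. \<bar>b (\<sigma> i) (\<sigma> (Suc i))\<bar> \<le> e"
proof -
  have "\<exists>m. n < m \<and> \<bar>b n m\<bar> \<le> e" for n
  proof -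
    obtain N where N: "\<And>m. N \<le> m \<Longrightarrow> norm (b n m - 0) < e"
      using LIMSEQ_D[OF assms(1) e] by blast
    show ?thesis
      using N[of "max N (Suc n)"] by (intro exI[of _ "max N (Suc n)"]) auto
  qed
  then obtain f where f: "\<And>n. n < f n" "\<And>n. \<bar>b n (f n)\<bar> \<le> e" by metis
  show ?thesis
    by (rule that[of "\<lambda>i. (f ^^ i) 0"]) (use f in \<open>auto simp: strict_mono_Suc_iff\<close>)
qed

lemma Cauchy_subseq_diff_null:
  fixes a :: "nat \<Rightarrow> real"
  assumes "Cauchy a" "strict_mono (\<sigma> :: nat \<Rightarrow> nat)"
  shows "(\<lambda>i. a (\<sigma> (Suc i)) - a (\<sigma> i)) \<longlonglongrightarrow> 0"
proof -
  obtain l where l: "a \<longlonglongrightarrow> l"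
    using assms(1) Cauchy_convergent convergent_def by blast
  have *: "(\<lambda>i. a (\<sigma> i)) \<longlonglongrightarrow> l"
    using LIMSEQ_subseq_LIMSEQ[OF l assms(2)] by (simp add: o_def)
  have "(\<lambda>i. a (\<sigma> (Suc i)) - a (\<sigma> i)) \<longlonglongrightarrow> l - l"
    by (intro tendsto_diff * LIMSEQ_Suc[OF *])
  then show ?thesis by simp
qed

lemma positive_operator_mono:
  "positive_operator P \<Longrightarrow> x \<le> y \<Longrightarrow> blinfun_apply P x \<le> blinfun_apply P y"
  unfolding positive_operator_def
  by (metis blinfun.diff_right diff_ge_0_iff_ge)

lemma positive_operator_abs_le:
  assumes "positive_operator P"
  shows "\<bar>blinfun_apply P x\<bar> \<le> blinfun_apply P \<bar>x\<bar>"
proof (rule abs_leI)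
  show "blinfun_apply P x \<le> blinfun_apply P \<bar>x\<bar>"
    by (rule positive_operator_mono[OF assms abs_ge_self])
  show "- blinfun_apply P x \<le> blinfun_apply P \<bar>x\<bar>"
    using positive_operator_mono[OF assms abs_ge_minus_self[of x]] by (simp add: blinfun.minus_right)
qed

text \<open>
  The functional \<open>f\<close> is first replaced by its component \<open>f0\<close> on an element \<open>z\<close> that dominates
  multiples of all vectors involved. Evaluation at \<open>z\<close> is strictly positive on the interval from \<open>0\<close> to
  \<open>f0\<close>, so the functionals that attain \<open>f \<bar>T x\<^sub>n\<bar>\<close> have a weakly Cauchy subsequence. Differences of
  consecutive members of a sparse subsequence keep half of the value, because each fixed functional tends
  to zero along \<open>T x\<^sub>n\<close>.
\<close>

lemma weakly_null_abs_of_Lwcc_adjoint: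
  fixes T :: "'a::banach_lattice \<Rightarrow>\<^sub>L 'b::banach_lattice"
  assumes oc: "monotone_convergent_part = (UNIV :: 'b dual set)"
    and T: "Lwcc (dual_operator T)"
    and x: "weakly_null x" and bounded: "\<And>n. norm (x n) \<le> M"
    and f: "0 \<le> f"
  shows "(\<lambda>n. dual_apply f \<bar>blinfun_apply T (x n)\<bar>) \<longlonglongrightarrow> 0"
proof (rule ccontr)
  assume "\<not> ?thesis"
  then obtain e r where e: "0 < e" and r: "strict_mono r"
    and large: "\<And>n::nat. e \<le> norm (dual_apply f \<bar>blinfun_apply T (x (r n))\<bar>)"
    by (rule not_tendsto_zero_subseq) (rule that)
  define Y where "Y n = blinfun_apply T (x (r n))" for n
  have large': "e \<le> dual_apply f \<bar>Y n\<bar>" for n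
    using large[of n] dual_apply_nonneg[OF f, of "\<bar>Y n\<bar>"] by (simp add: Y_def)
  have Y_weak: "(\<lambda>n. dual_apply g (Y n)) \<longlonglongrightarrow> 0" for g
  proof -
    have "(\<lambda>n. dual_apply (blinfun_apply (dual_operator T) g) (x n)) \<longlonglongrightarrow> 0"
      by (rule weakly_null_dual_apply[OF x])
    from LIMSEQ_subseq_LIMSEQ[OF this r] show ?thesis
      by (simp add: o_def dual_operator_apply Y_def)
  qed
  have Y_bound: "norm \<bar>Y n\<bar> \<le> norm T * M" for n
    using norm_blinfun[of T "x (r n)"] mult_left_mono[OF bounded[of "r n"] norm_ge_zero[of T]]
    by (simp add: Y_def)
  have summ: "summable (\<lambda>n. (1 / 2) ^ n *\<^sub>R \<bar>Y n\<bar>)"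
    by (rule summable_geometric_scaleR[OF Y_bound])
  define z where "z = (\<Sum>n. (1 / 2) ^ n *\<^sub>R \<bar>Y n\<bar>)"
  have term_nonneg: "0 \<le> (1 / 2) ^ n *\<^sub>R \<bar>Y n\<bar>" for n
    by (intro scaleR_nonneg_nonneg) auto
  have z_ge: "(1 / 2) ^ n *\<^sub>R \<bar>Y n\<bar> \<le> z" for n
    unfolding z_def by (rule nonneg_term_le_suminf[OF summ term_nonneg])
  have z0: "0 \<le> z" using order_trans[OF term_nonneg z_ge] .
  have Y_le: "\<bar>Y n\<bar> \<le> 2 ^ n *\<^sub>R z" for n
  proof -
    have "2 ^ n *\<^sub>R (1 / 2) ^ n *\<^sub>R \<bar>Y n\<bar> \<le> 2 ^ n *\<^sub>R z"
      by (intro scaleR_left_mono z_ge) auto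
    then show ?thesis by (simp add: power_divide)
  qed
  \<comment> \<open>As the \<open>Y n\<close> lie in the ideal generated by \<open>z\<close>, passing to the component keeps all values \<open>f \<bar>Y n\<bar>\<close>.\<close>
  define f0 where "f0 = dual_component z f"
  have f0: "0 \<le> f0" unfolding f0_def by (rule dual_component_nonneg[OF z0 f])
  have f0_Y: "dual_apply f0 \<bar>Y n\<bar> = dual_apply f \<bar>Y n\<bar>" for n
    unfolding f0_def by (rule dual_component_eq[OF z0 f _ Y_le]) auto
  have "\<exists>g. \<bar>g\<bar> \<le> f0 \<and> dual_apply g (Y n) = dual_apply f0 \<bar>Y n\<bar>" for n
    using dual_sign_functional[OF f0, of "Y n"] by blast
  then obtain g where g: "\<And>n. \<bar>g n\<bar> \<le> f0" "\<And>n. dual_apply (g n) (Y n) = dual_apply f0 \<bar>Y n\<bar>"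
    by metis
  have strict: "w = 0" if w: "0 \<le> w" "w \<le> f0" "dual_apply (dual_eval z) w = 0" for w
  proof (rule dual_eq_posI)
    fix y :: 'b assume y: "0 \<le> y"
    have "dual_apply w y \<le> 0 + d" if d: "0 < d" for d
    proof -
      obtain k where "\<And>c g. 0 \<le> g \<Longrightarrow> g \<le> c *\<^sub>R dual_component z f \<Longrightarrow> 0 \<le> c \<Longrightarrow>
          dual_apply g y \<le> k * dual_apply g z + c * d"
        using dual_component_carried[OF z0 f y d] by metis
      from this[of w 1] w show ?thesis by (simp add: f0_def)
    qed
    then have "dual_apply w y \<le> 0" by (rule field_le_epsilon)
    with dual_apply_nonneg[OF w(1) y] show "dual_apply w y = dual_apply 0 y" by simp
  qed
  have f0_oc: "f0 \<in> monotone_convergent_part" using oc by simp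
  obtain s :: "nat \<Rightarrow> nat" where s: "strict_mono s" "\<And>\<psi> :: 'b dual dual. Cauchy (\<lambda>n. dual_apply \<psi> (g (s n)))"
    using strictly_positive_weakly_Cauchy_subseq[where g = g and u = f0 and \<Phi> = "dual_eval z",
        OF f0_oc f0 dual_eval_nonneg[OF z0] strict g(1)] by blast
  have "(\<lambda>n. dual_apply (g (s i)) (Y (s n))) \<longlonglongrightarrow> 0" for i
    using LIMSEQ_subseq_LIMSEQ[OF Y_weak s(1)] by (simp add: o_def)
  moreover have "0 < e / 2" using e by simp
  ultimately obtain \<sigma> :: "nat \<Rightarrow> nat" where \<sigma>: "strict_mono \<sigma>"
    "\<And>i. \<bar>dual_apply (g (s (\<sigma> i))) (Y (s (\<sigma> (Suc i))))\<bar> \<le> e / 2"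
    by (rule almost_orthogonal_subseq) (rule that)
  define h where "h i = g (s (\<sigma> (Suc i))) - g (s (\<sigma> i))" for i
  have "weakly_null h"
  proof (rule weakly_nullI)
    fix \<psi> :: "'b dual dual"
    show "(\<lambda>i. dual_apply \<psi> (h i)) \<longlonglongrightarrow> 0"
      unfolding h_def dual_apply_diff_right by (rule Cauchy_subseq_diff_null[OF s(2) \<sigma>(1)])
  qed
  moreover have "L_weakly_compact (range h)"
  proof (rule L_weakly_compact_order_bounded[of "2 *\<^sub>R f0"])
    fix a assume "a \<in> range h"
    then obtain i where a: "a = h i" by blast
    have "\<bar>h i\<bar> \<le> \<bar>g (s (\<sigma> (Suc i)))\<bar> + \<bar>g (s (\<sigma> i))\<bar>"
      unfolding h_def by (rule abs_triangle_ineq4)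
    also have "\<dots> \<le> f0 + f0" by (intro add_mono g(1))
    also have "\<dots> \<le> \<bar>2 *\<^sub>R f0\<bar>" unfolding scaleR_2 by (rule abs_ge_self)
    finally show "\<bar>a\<bar> \<le> \<bar>2 *\<^sub>R f0\<bar>" unfolding a .
  qed (use oc in auto)
  ultimately have lim: "(\<lambda>i. norm (blinfun_apply (dual_operator T) (h i))) \<longlonglongrightarrow> 0"
    using T unfolding Lwcc_def by blast
  have "e / 2 \<le> norm (blinfun_apply (dual_operator T) (h i)) * M" for i
  proof -
    let ?y = "x (r (s (\<sigma> (Suc i))))"
    have "e \<le> dual_apply (g (s (\<sigma> (Suc i)))) (Y (s (\<sigma> (Suc i))))"
      unfolding g(2) f0_Y by (rule large')
    then have "e / 2 \<le> dual_apply (h i) (Y (s (\<sigma> (Suc i))))"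
      using \<sigma>(2)[of i] unfolding h_def dual_apply_diff by linarith
    also have "\<dots> = dual_apply (blinfun_apply (dual_operator T) (h i)) ?y"
      by (simp add: dual_operator_apply Y_def)
    also have "\<dots> \<le> norm (blinfun_apply (dual_operator T) (h i)) * norm ?y"
      using norm_dual_apply[of "blinfun_apply (dual_operator T) (h i)" ?y] by linarith
    also have "\<dots> \<le> norm (blinfun_apply (dual_operator T) (h i)) * M"
      by (intro mult_left_mono bounded) auto
    finally show ?thesis .
  qed
  moreover have "(\<lambda>i. norm (blinfun_apply (dual_operator T) (h i)) * M) \<longlonglongrightarrow> 0 * M"
    by (intro tendsto_mult lim tendsto_const)
  ultimately have "e / 2 \<le> 0 * M" using LIMSEQ_le_const by blast
  with e show False by simp
qed

text \<open>
  If \<open>u\<close> is an almost order bound of the sequence, cut \<open>\<bar>T x\<^sub>n\<bar>\<close> at \<open>v = (P + Q) u\<close>. What is left below \<open>v\<close> is order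
  bounded, positive and weakly null; what is above \<open>v\<close> is small in norm.
\<close>

theorem Lwcc_if_codomain_order_continuous:
  fixes T :: "'a::banach_lattice \<Rightarrow>\<^sub>L 'b::banach_lattice"
  assumes dual_oc: "monotone_convergent_part = (UNIV :: 'b dual set)"
    and oc: "monotone_convergent_part = (UNIV :: 'b set)"
    and T: "regular_operator T" "Lwcc (dual_operator T)"
  shows "Lwcc T"
proof (rule LwccI)
  fix x :: "nat \<Rightarrow> 'a"
  assume x: "weakly_null x" "L_weakly_compact (range x)"
  obtain M where M: "\<And>n. norm (x n) \<le> M"
    using x(2) unfolding L_weakly_compact_def bounded_iff by blast
  obtain P Q where PQ: "positive_operator P" "positive_operator Q" "T = P - Q"
    using T(1) unfolding regular_operator_def by blast
  let ?S = "P + Q"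
  have S_mono: "blinfun_apply ?S a \<le> blinfun_apply ?S b" if "a \<le> b" for a b
    using positive_operator_mono[OF PQ(1) that] positive_operator_mono[OF PQ(2) that]
    by (simp add: blinfun.add_left add_mono)
  have T_le: "\<bar>blinfun_apply T y\<bar> \<le> blinfun_apply ?S \<bar>y\<bar>" for y
  proof -
    have "\<bar>blinfun_apply T y\<bar> \<le> \<bar>blinfun_apply P y\<bar> + \<bar>blinfun_apply Q y\<bar>"
      unfolding PQ(3) blinfun.diff_left by (rule abs_triangle_ineq4)
    also have "\<dots> \<le> blinfun_apply ?S \<bar>y\<bar>"
      unfolding blinfun.add_left by (intro add_mono positive_operator_abs_le PQ)
    finally show ?thesis .
  qed
  show "(\<lambda>n. blinfun_apply T (x n)) \<longlonglongrightarrow> 0"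
  proof (rule tendsto_zero_approx)
    fix e :: real assume e: "0 < e"
    obtain d where d: "0 < d" "d * norm ?S \<le> e"
      by (rule small_factor[OF norm_ge_zero e])
    obtain u where u: "u \<in> monotone_convergent_part" "0 \<le> u"
      "\<And>y. y \<in> range x \<Longrightarrow> norm (pprt (\<bar>y\<bar> - u)) \<le> d"
      by (rule L_weakly_compact_almost_order_bounded[OF x(2) d(1)]) (rule that)
    define v where "v = blinfun_apply ?S u"
    have v0: "0 \<le> v" unfolding v_def using S_mono[OF u(2)] by (simp add: blinfun.zero_right)
    define y where "y n = inf \<bar>blinfun_apply T (x n)\<bar> v" for n
    have "y \<longlonglongrightarrow> 0"
    proof (rule positive_weakly_null_imp_norm_null)
      show "v \<in> monotone_convergent_part" using oc by simp
      show y0: "0 \<le> y n" "y n \<le> v" for n unfolding y_def using v0 by auto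
      fix f :: "'b dual" assume f: "0 \<le> f"
      show "(\<lambda>n. dual_apply f (y n)) \<longlonglongrightarrow> 0"
      proof (rule tendsto_sandwich[OF _ _ tendsto_const])
        show "(\<lambda>n. dual_apply f \<bar>blinfun_apply T (x n)\<bar>) \<longlonglongrightarrow> 0"
          by (rule weakly_null_abs_of_Lwcc_adjoint[OF dual_oc T(2) x(1) M f])
        show "\<forall>\<^sub>F n in sequentially. dual_apply f (y n) \<le> dual_apply f \<bar>blinfun_apply T (x n)\<bar>"
          unfolding y_def by (intro always_eventually allI dual_apply_mono_right[OF f]) simp
        show "\<forall>\<^sub>F n in sequentially. 0 \<le> dual_apply f (y n)"
          by (intro always_eventually allI dual_apply_nonneg[OF f] y0)
      qed
    qed
    then have "(\<lambda>n. norm (y n)) \<longlonglongrightarrow> 0" by (rule tendsto_norm_zero)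
    moreover have "norm (blinfun_apply T (x n)) \<le> norm (y n) + e" for n
    proof -
      let ?t = "\<bar>blinfun_apply T (x n)\<bar>" and ?p = "pprt (\<bar>x n\<bar> - u)"
      have "?t \<le> blinfun_apply ?S (u + ?p)"
        using T_le[of "x n"] S_mono[OF le_add_pprt_minus[of "\<bar>x n\<bar>" u]] by (rule order_trans)
      then have "?t - v \<le> blinfun_apply ?S ?p"
        by (simp add: v_def blinfun.add_right diff_le_eq add.commute)
      moreover have "0 \<le> blinfun_apply ?S ?p"
        using S_mono[of 0 ?p] by (simp add: blinfun.zero_right)
      ultimately have "pprt (?t - v) \<le> blinfun_apply ?S ?p"
        by (simp add: pprt_le_iff)
      then have "norm (pprt (?t - v)) \<le> norm (blinfun_apply ?S ?p)"
        by (intro norm_mono_pos) auto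
      also have "\<dots> \<le> norm ?S * norm ?p" by (rule norm_blinfun)
      also have "\<dots> \<le> norm ?S * d" by (intro mult_left_mono u(3)) auto
      finally have "norm (pprt (?t - v)) \<le> e" using d(2) by (simp add: mult.commute)
      moreover have "?t = y n + pprt (?t - v)"
        unfolding y_def by (simp add: inf_eq_minus_pprt)
      then have "norm ?t \<le> norm (y n) + norm (pprt (?t - v))"
        by (metis norm_triangle_ineq)
      ultimately show ?thesis by simp
    qed
    ultimately show "\<exists>y. y \<longlonglongrightarrow> 0 \<and> (\<forall>n. norm (blinfun_apply T (x n)) \<le> y n + e)" by blast
  qed
qed

section \<open>Separated sequences in an order interval without atoms\<close>

text \<open>
  An element disjoint from a maximal disjoint family of atoms dominates no atom.
\<close>

lemma atomless_if_not_discrete: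
  assumes "\<not> discrete_ideal (monotone_convergent_part :: 'a::banach_lattice set)"
  obtains x :: "'a::banach_lattice" where "x \<in> monotone_convergent_part" "0 < x" "\<And>b. discrete_element b \<Longrightarrow> \<not> b \<le> x"
proof -
  define \<A> where "\<A> = {A :: 'a set. A \<subseteq> monotone_convergent_part \<and> (\<forall>a\<in>A. discrete_element a) \<and> pairwise lat_disjoint A}"
  have "\<exists>M\<in>\<A>. \<forall>X\<in>\<A>. M \<subseteq> X \<longrightarrow> X = M"
  proof (rule subset_Zorn_nonempty)
    show "\<A> \<noteq> {}" unfolding \<A>_def by (intro ex_in_conv[THEN iffD1] exI[of _ "{}"]) simp
    fix C assume C: "C \<noteq> {}" "subset.chain \<A> C"
    then have CA: "X \<in> \<A>" if "X \<in> C" for X using that unfolding subset.chain_def by blast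
    have "pairwise lat_disjoint (\<Union>C)"
    proof (rule pairwise_chain_Union)
      show "pairwise lat_disjoint X" if "X \<in> C" for X using CA[OF that] unfolding \<A>_def by blast
      show "chain\<^sub>\<subseteq> C" using C(2) unfolding subset.chain_def chain_subset_def by blast
    qed
    then show "\<Union>C \<in> \<A>" using CA unfolding \<A>_def by blast
  qed
  then obtain M where M: "M \<in> \<A>" "\<And>X. X \<in> \<A> \<Longrightarrow> M \<subseteq> X \<Longrightarrow> X = M" by blast
  have "\<not> (\<forall>y\<in>monotone_convergent_part. (\<forall>a\<in>M. lat_disjoint y a) \<longrightarrow> y = 0)"
  proof
    assume "\<forall>y\<in>monotone_convergent_part. (\<forall>a\<in>M. lat_disjoint y a) \<longrightarrow> y = 0"
    then have "discrete_ideal (monotone_convergent_part :: 'a set)"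
      unfolding discrete_ideal_def using M(1) by (intro exI[of _ M]) (simp add: \<A>_def)
    with assms show False ..
  qed
  then obtain y where y: "y \<in> monotone_convergent_part" "y \<noteq> 0" "\<And>a. a \<in> M \<Longrightarrow> lat_disjoint y a"
    by blast
  show ?thesis
  proof (rule that)
    show "\<bar>y\<bar> \<in> monotone_convergent_part"
      using y(1) by (rule monotone_convergent_part_solid) simp
    show "0 < \<bar>y\<bar>" using y(2) by simp
    fix b :: 'a assume b: "discrete_element b"
    show "\<not> b \<le> \<bar>y\<bar>"
    proof
      assume le: "b \<le> \<bar>y\<bar>"
      have b0: "0 < b" using b by (rule atom_pos)
      have dis: "inf b \<bar>a\<bar> = 0" if "a \<in> M" for a
        by (rule inf_eq_0_mono[of "\<bar>y\<bar>" "\<bar>a\<bar>"])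
           (use y(3)[OF that] b0 le in \<open>auto simp: lat_disjoint_def\<close>)
      have bM: "b \<in> monotone_convergent_part"
        using y(1) by (rule monotone_convergent_part_solid) (use b0 le in simp)
      have "insert b M \<in> \<A>"
        using M(1) b bM dis b0 unfolding \<A>_def
        by (auto simp: pairwise_insert lat_disjoint_def inf_commute)
      then have "insert b M = M" using M(2) by blast
      then have "b \<in> M" by blast
      from dis[OF this] b0 show False by simp
    qed
  qed
qed

text \<open>
  If \<open>z\<close> is a maximal zero of \<open>f\<close> between \<open>0\<close> and \<open>x\<close>, then \<open>f\<close> has no zeros but \<open>0\<close> between \<open>0\<close> and
  \<open>x - z\<close>.
\<close>

lemma strictly_positive_below:
  fixes x :: "'a::banach_lattice"
  assumes x: "x \<in> monotone_convergent_part" "0 < x"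
  obtains x' and f :: "'a dual" where "0 < x'" "x' \<le> x" "0 \<le> f"
    "\<And>w. 0 \<le> w \<Longrightarrow> w \<le> x' \<Longrightarrow> dual_apply f w = 0 \<Longrightarrow> w = 0"
proof -
  have x0: "0 \<le> x" using x(2) by simp
  obtain f :: "'a dual" where f: "0 \<le> f" "norm f \<le> 1" "dual_apply f x = norm x"
    by (rule positive_norming_functional[OF x0])
  define S where "S = {y. 0 \<le> y \<and> y \<le> x \<and> dual_apply f y = 0}"
  have S: "S \<subseteq> {0..\<bar>x\<bar>}" using x0 unfolding S_def by auto
  have "0 \<in> S" unfolding S_def using x0 by (simp add: dual_apply_zero_right)
  then have ne: "S \<noteq> {}" by blast
  have cl: "l \<in> S" if "incseq u" "\<And>n. u n \<in> S" "u \<longlonglongrightarrow> l" for u l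
  proof -
    have "0 \<le> l" "l \<le> x"
      using that(2) unfolding S_def
      by (auto intro: lattice_LIMSEQ_le[OF tendsto_const that(3)] lattice_LIMSEQ_le[OF that(3) tendsto_const])
    moreover have "(\<lambda>n. dual_apply f (u n)) \<longlonglongrightarrow> dual_apply f l"
      by (rule bounded_linear.tendsto[OF bounded_linear_dual_apply that(3)])
    then have "dual_apply f l = 0"
      using that(2) unfolding S_def by (simp add: LIMSEQ_const_iff)
    ultimately show ?thesis unfolding S_def by simp
  qed
  obtain z where z: "z \<in> S" "\<And>w. w \<in> S \<Longrightarrow> z \<le> w \<Longrightarrow> w = z"
    by (rule maximal_in_order_interval[OF x(1) S ne cl]) (assumption | rule that)+
  show ?thesis
  proof (rule that[of "x - z" f])
    have "z \<noteq> x" using z(1) f(3) x(2) unfolding S_def by auto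
    then show "0 < x - z" using z(1) unfolding S_def by (simp add: less_le)
    show "x - z \<le> x" using z(1) unfolding S_def by simp
    fix w assume w: "0 \<le> w" "w \<le> x - z" "dual_apply f w = 0"
    then have "z + w \<in> S"
      using z(1) unfolding S_def by (simp add: dual_apply_add_right le_diff_eq add.commute add_nonneg_nonneg)
    then have "z + w = z" using w(1) by (intro z(2)) auto
    then show "w = 0" by simp
  qed (rule f(1))
qed

text \<open>
  For \<open>y \<ge> 0\<close> these play the role of the measurable subsets of a measure space.
\<close>

definition lat_components :: "'a::banach_lattice \<Rightarrow> 'a set"
  where "lat_components y = {z. inf z (y - z) = 0}"

lemma lat_components_bounds:
  assumes "z \<in> lat_components y"
  shows "0 \<le> z" "z \<le> y"
proof -
  have "inf z (y - z) = 0" using assms by (simp add: lat_components_def)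
  then show "0 \<le> z" "z \<le> y" using inf_le1[of z "y - z"] inf_le2[of z "y - z"] by auto
qed

lemma lat_components_complement: "z \<in> lat_components y \<Longrightarrow> y - z \<in> lat_components y"
  by (simp add: lat_components_def inf_commute)

lemma lat_components_trans:
  assumes z: "z \<in> lat_components y" and w: "w \<in> lat_components z"
  shows "w \<in> lat_components y"
proof -
  note zb = lat_components_bounds[OF z] and wb = lat_components_bounds[OF w]
  have "inf w ((y - z) + (z - w)) \<le> inf w (y - z) + inf w (z - w)"
    using zb wb by (intro inf_add_le) auto
  also have "\<dots> \<le> inf z (y - z) + 0"
    using wb w by (intro add_mono inf_mono) (auto simp: lat_components_def)
  also have "\<dots> = 0" using z by (simp add: lat_components_def)
  finally have "inf w (y - w) \<le> 0" by simp
  then show ?thesis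
    using zb wb unfolding lat_components_def by (auto intro!: order.antisym intro: order_trans)
qed

lemma lat_components_add:
  assumes z: "z \<in> lat_components y" and w: "w \<in> lat_components (y - z)"
  shows "z + w \<in> lat_components y"
proof -
  note zb = lat_components_bounds[OF z] and wb = lat_components_bounds[OF w]
  have 0: "0 \<le> y - z - w" using wb by simp
  have "inf (y - z - w) (z + w) \<le> inf (y - z - w) z + inf (y - z - w) w"
    using zb wb 0 by (intro inf_add_le) auto
  also have "\<dots> \<le> inf (y - z) z + 0"
    using wb w by (intro add_mono inf_mono) (auto simp: lat_components_def inf_commute)
  also have "\<dots> = 0" using z by (simp add: lat_components_def inf_commute)
  finally have "inf (z + w) (y - (z + w)) \<le> 0" by (simp add: inf_commute diff_diff_eq)
  moreover have "0 \<le> z + w" "0 \<le> y - (z + w)" using zb wb 0 by (auto simp: diff_diff_eq intro: add_nonneg_nonneg)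
  ultimately show ?thesis unfolding lat_components_def by (auto intro!: order.antisym)
qed

text \<open>
  The limit of \<open>inf y (k *\<^sub>R u)\<close>, which is the projection of \<open>y\<close> to the band generated by \<open>u\<close>.
\<close>

lemma band_component_exists:
  fixes y u :: "'a::banach_lattice"
  assumes y: "y \<in> monotone_convergent_part" "0 \<le> y" and u: "0 \<le> u"
  obtains z where "z \<in> lat_components y" "inf y u \<le> z" "\<And>v. inf v u = 0 \<Longrightarrow> inf v z = 0"
proof -
  define p where "p k = inf y (real k *\<^sub>R u)" for k
  have p0: "0 \<le> p k" "p k \<le> y" for k
    unfolding p_def using y u by (auto intro: scaleR_nonneg_nonneg)
  have inc: "incseq p"
    unfolding p_def using u by (intro incseq_SucI inf_mono scaleR_right_mono) auto
  have "convergent p"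
    by (rule monotone_convergent_partD[OF y(1) incseq_imp_monoseq[OF inc]]) (use p0 y in auto)
  then obtain z where z: "p \<longlonglongrightarrow> z" by (auto simp: convergent_def)
  have zb: "p k \<le> z" for k by (rule incseq_le_limit[OF inc z])
  have zy: "z \<le> y" by (rule lattice_LIMSEQ_le[OF z tendsto_const, where N = 0]) (rule p0)
  have z0: "0 \<le> z" using p0(1)[of 0] zb[of 0] by (rule order_trans)
  define w where "w = inf (y - z) u"
  have w0: "0 \<le> w" unfolding w_def using zy u by simp
  have pw: "p k + w \<le> z" for k
  proof -
    have "p k + w \<le> z + (y - z)" unfolding w_def by (intro add_mono zb) simp
    moreover have "p k + w \<le> real k *\<^sub>R u + u" unfolding w_def p_def by (intro add_mono) auto
    ultimately have "p k + w \<le> p (Suc k)"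
      unfolding p_def by (simp add: scaleR_left_distrib add.commute)
    then show ?thesis using zb order_trans by blast
  qed
  have lim: "(\<lambda>k. p k + w) \<longlonglongrightarrow> z + w" by (intro tendsto_intros z)
  have "z + w \<le> z" by (rule lattice_LIMSEQ_le[OF lim tendsto_const, where N = 0]) (rule pw)
  then have "w = 0" using w0 by simp
  have dis: "inf v z = 0" if v: "inf v u = 0" for v
  proof -
    have v0: "0 \<le> v" using inf_le1[of v u] v by simp
    have "inf v (p k) = 0" for k
    proof (rule inf_eq_0_mono[OF inf_scaleR_eq_0[OF v, of "real k"]])
      show "p k \<le> real k *\<^sub>R u" unfolding p_def by simp
    qed (use v0 p0 in auto)
    moreover have "(\<lambda>k. inf v (p k)) \<longlonglongrightarrow> inf v z" by (intro tendsto_inf tendsto_const z)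
    ultimately show ?thesis by (simp add: LIMSEQ_const_iff)
  qed
  show ?thesis
  proof (rule that[of z])
    show "z \<in> lat_components y"
      using dis[of "y - z"] \<open>w = 0\<close> by (simp add: w_def lat_components_def inf_commute)
    show "inf y u \<le> z" using zb[of 1] by (simp add: p_def)
  qed (rule dis)
qed

lemma order_ideal_ideal_of: "0 \<le> u \<Longrightarrow> order_ideal (ideal_of u)"
proof -
  have "y \<in> ideal_of u" if "x \<in> ideal_of u" "\<bar>y\<bar> \<le> \<bar>x\<bar>" for x y
    using that unfolding ideal_of_def by (auto intro: order_trans)
  then show ?thesis
    unfolding order_ideal_def subspace_def solid_hull_def by (auto intro: ideal_of_intros)
qed

text \<open>
  The number \<open>t\<close> is the infimum of those with \<open>v \<le> t *\<^sub>R y\<close>; both order relations pass to the limit there.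
\<close>

lemma multiple_if_comparable:
  fixes v y :: "'a::banach_lattice"
  assumes v: "0 \<le> v" "v \<le> c *\<^sub>R y" and y: "0 < y"
    and cmp: "\<And>t. 0 \<le> t \<Longrightarrow> v \<le> t *\<^sub>R y \<or> t *\<^sub>R y \<le> v"
  shows "\<exists>t. v = t *\<^sub>R y"
proof -
  define S where "S = {t. 0 \<le> t \<and> v \<le> t *\<^sub>R y}"
  define t0 where "t0 = Inf S"
  have "c *\<^sub>R y \<le> \<bar>c\<bar> *\<^sub>R y" using y by (intro scaleR_right_mono) auto
  with v(2) have "v \<le> \<bar>c\<bar> *\<^sub>R y" by (rule order_trans)
  then have "\<bar>c\<bar> \<in> S" unfolding S_def by simp
  then have ne: "S \<noteq> {}" by blast
  have bdd: "bdd_below S" unfolding S_def by (intro bdd_belowI[of _ 0]) auto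
  have t0: "0 \<le> t0" unfolding t0_def by (rule cInf_greatest[OF ne]) (simp add: S_def)
  have lim: "(\<lambda>n. (t0 + inverse (real (Suc n))) *\<^sub>R y) \<longlonglongrightarrow> (t0 + 0) *\<^sub>R y"
    "(\<lambda>n. (t0 - inverse (real (Suc n))) *\<^sub>R y) \<longlonglongrightarrow> (t0 - 0) *\<^sub>R y"
    by (intro tendsto_intros LIMSEQ_inverse_real_of_nat)+
  have "v \<le> (t0 + inverse (real (Suc n))) *\<^sub>R y" for n
  proof -
    have "t0 < t0 + inverse (real (Suc n))" by simp
    then obtain t where t: "t \<in> S" "t < t0 + inverse (real (Suc n))"
      unfolding t0_def using cInf_lessD[OF ne] by blast
    have "v \<le> t *\<^sub>R y" using t(1) unfolding S_def by blast
    also have "\<dots> \<le> (t0 + inverse (real (Suc n))) *\<^sub>R y"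
      using t(2) y by (intro scaleR_right_mono) auto
    finally show ?thesis .
  qed
  then have "v \<le> (t0 + 0) *\<^sub>R y"
    by (rule lattice_LIMSEQ_le[OF tendsto_const lim(1), where N = 0])
  moreover have "(t0 - inverse (real (Suc n))) *\<^sub>R y \<le> v" for n
  proof (cases "0 \<le> t0 - inverse (real (Suc n))")
    case True
    have "t0 - inverse (real (Suc n)) \<notin> S"
    proof
      assume "t0 - inverse (real (Suc n)) \<in> S"
      then have "t0 \<le> t0 - inverse (real (Suc n))" unfolding t0_def by (intro cInf_lower bdd)
      moreover have "0 < inverse (real (Suc n))" by simp
      ultimately show False by linarith
    qed
    then show ?thesis using cmp[OF True] True unfolding S_def by blast
  next
    case False
    then have "(t0 - inverse (real (Suc n))) *\<^sub>R y \<le> 0 *\<^sub>R y"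
      using y by (intro scaleR_right_mono) auto
    then show ?thesis using v(1) by simp
  qed
  then have "(t0 - 0) *\<^sub>R y \<le> v"
    by (rule lattice_LIMSEQ_le[OF lim(2) tendsto_const, where N = 0])
  ultimately show ?thesis by (intro exI[of _ t0]) simp
qed

text \<open>
  The ideal generated by \<open>y\<close> contains some \<open>q \<ge> 0\<close> that is not a multiple of \<open>y\<close>. For a suitable \<open>t\<close> the
  element \<open>q - t *\<^sub>R y\<close> has nonzero positive and negative parts, and the band generated by the positive
  part splits \<open>y\<close>.
\<close>

lemma nontrivial_component_exists:
  fixes y :: "'a::banach_lattice"
  assumes y: "y \<in> monotone_convergent_part" "0 < y" "\<not> discrete_element y"
  obtains z where "z \<in> lat_components y" "z \<noteq> 0" "z \<noteq> y"
proof -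
  have y0: "0 \<le> y" using y(2) by simp
  have yI: "y \<in> ideal_of y" unfolding ideal_of_def using y0 by (auto intro!: exI[of _ 1])
  have span_hull: "span {y} \<subseteq> order_ideal hull {y}"
  proof -
    have "span {y} \<subseteq> I" if "order_ideal I" "{y} \<subseteq> I" for I
      using that unfolding order_ideal_def by (intro span_minimal) auto
    then show ?thesis unfolding hull_def by blast
  qed
  have "order_ideal hull {y} \<subseteq> ideal_of y"
    using order_ideal_ideal_of[OF y0] yI by (intro hull_minimal) auto
  moreover have "order_ideal hull {y} \<noteq> span {y}"
    using y(2,3) unfolding discrete_element_def by blast
  ultimately obtain v where v: "v \<in> ideal_of y" "v \<notin> span {y}" using span_hull by blast
  obtain c where c: "\<bar>v\<bar> \<le> c *\<^sub>R y" using v(1) unfolding ideal_of_def by blast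
  have "pprt v \<notin> span {y} \<or> pprt (- v) \<notin> span {y}"
    using v(2) span_diff[of "pprt v" "{y}" "pprt (- v)"] by (simp only: pprt_diff) blast
  moreover have "pprt v \<le> c *\<^sub>R y" "pprt (- v) \<le> c *\<^sub>R y"
    using order_trans[OF pprt_le_abs c] order_trans[OF pprt_le_abs[of "- v"], of "c *\<^sub>R y"] c by auto
  ultimately obtain q where q: "0 \<le> q" "q \<le> c *\<^sub>R y" "q \<notin> span {y}"
    by (metis zero_le_pprt)
  then have "\<not> (\<exists>t. q = t *\<^sub>R y)" by (auto simp: span_singleton)
  then obtain t where t: "0 \<le> t" "\<not> q \<le> t *\<^sub>R y" "\<not> t *\<^sub>R y \<le> q"
    using multiple_if_comparable[OF q(1,2) y(2)] by blast
  define u1 u2 where "u1 = pprt (q - t *\<^sub>R y)" and "u2 = pprt (t *\<^sub>R y - q)"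
  have u_ne: "u1 \<noteq> 0" "u2 \<noteq> 0"
    using t(2,3) unfolding u1_def u2_def by (simp_all flip: le_zero_iff_zero_pprt)
  have u0: "0 \<le> u1" "0 \<le> u2" unfolding u1_def u2_def by auto
  have dis: "inf u2 u1 = 0"
    using inf_pprt_pprt_uminus[of "q - t *\<^sub>R y"] unfolding u1_def u2_def by (simp add: inf_commute)
  have ty: "0 \<le> t *\<^sub>R y" using t(1) y0 by (rule scaleR_nonneg_nonneg)
  have "q - t *\<^sub>R y \<le> c *\<^sub>R y - 0" using q(2) ty by (rule diff_mono)
  moreover have "0 \<le> c *\<^sub>R y" using q(1,2) by (rule order_trans)
  ultimately have u1_le: "u1 \<le> c *\<^sub>R y" unfolding u1_def by (simp add: pprt_le_iff)
  have "c *\<^sub>R y \<le> \<bar>c\<bar> *\<^sub>R y" using y0 by (intro scaleR_right_mono) auto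
  with u1_le have u1_le: "u1 \<le> \<bar>c\<bar> *\<^sub>R y" by (rule order_trans)
  have u2_le: "u2 \<le> t *\<^sub>R y" unfolding u2_def using ty q(1) by (simp add: pprt_le_iff)
  obtain z where z: "z \<in> lat_components y" "inf y u1 \<le> z" "\<And>v. inf v u1 = 0 \<Longrightarrow> inf v z = 0"
    using band_component_exists[OF y(1) y0 u0(1)] by blast
  have zero_if: "u = 0" if "u \<le> s *\<^sub>R y" "inf u y = 0" "0 \<le> s" for u s
    using inf_scaleR_eq_0[OF that(2,3)] that(1) by (simp add: inf_absorb1)
  show ?thesis
  proof (rule that[OF z(1)])
    show "z \<noteq> 0"
    proof
      assume "z = 0"
      then have "inf u1 y = 0" using z(2) y0 u0(1) by (intro order.antisym) (auto simp: inf_commute)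
      then show False using zero_if[OF u1_le] u_ne(1) by simp
    qed
    show "z \<noteq> y"
      using z(3)[OF dis] zero_if[OF u2_le _ t(1)] u_ne(2) by blast
  qed
qed

text \<open>
  If \<open>h\<close> picks halves, level \<open>n\<close> is the union of the left halves of the \<open>2 ^ n\<close> dyadic pieces of \<open>y\<close>, as
  in the \<open>n\<close>-th Rademacher function.
\<close>

primrec dyadic_half :: "('a::banach_lattice \<Rightarrow> 'a) \<Rightarrow> nat \<Rightarrow> 'a \<Rightarrow> 'a" where
  "dyadic_half h 0 y = h y"
| "dyadic_half h (Suc n) y = dyadic_half h n (h y) + dyadic_half h n (y - h y)"

context
  fixes x :: "'a::banach_lattice" and f :: "'a dual"
  assumes x: "x \<in> monotone_convergent_part" and atomless: "\<And>b. discrete_element b \<Longrightarrow> \<not> b \<le> x"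
    and f: "0 \<le> f" and strict: "\<And>w. 0 \<le> w \<Longrightarrow> w \<le> x \<Longrightarrow> dual_apply f w = 0 \<Longrightarrow> w = 0"
begin

lemma part_below: "0 \<le> y \<Longrightarrow> y \<le> x \<Longrightarrow> y \<in> monotone_convergent_part"
  using x by (rule monotone_convergent_part_solid) (simp add: abs_ge_self order_trans[OF _ abs_ge_self])

text \<open>
  One of two complementary components carries at most half of the value of \<open>f\<close>.
\<close>

lemma small_component_exists:
  assumes y: "0 \<le> y" "y \<le> x" "y \<noteq> 0" and e: "0 < e"
  obtains z where "z \<in> lat_components y" "z \<noteq> 0" "dual_apply f z \<le> e"
proof -
  have half: "\<exists>z\<in>lat_components y. z \<noteq> 0 \<and> dual_apply f z \<le> dual_apply f y / 2"
    if y: "0 \<le> y" "y \<le> x" "y \<noteq> 0" for y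
  proof -
    have "\<not> discrete_element y" using atomless y(2) by blast
    moreover have "0 < y" using y by (simp add: less_le)
    ultimately obtain z where z: "z \<in> lat_components y" "z \<noteq> 0" "z \<noteq> y"
      using nontrivial_component_exists[OF part_below[OF y(1,2)]] by blast
    have "dual_apply f z + dual_apply f (y - z) = dual_apply f y"
      by (simp add: dual_apply_diff_right)
    then consider "dual_apply f z \<le> dual_apply f y / 2" | "dual_apply f (y - z) \<le> dual_apply f y / 2"
      by linarith
    then show ?thesis
    proof cases
      case 2
      then show ?thesis using lat_components_complement[OF z(1)] z(3) by (intro bexI[of _ "y - z"]) auto
    qed (use z in blast)
  qed
  have pow: "\<exists>z\<in>lat_components y. z \<noteq> 0 \<and> dual_apply f z \<le> dual_apply f y * (1 / 2) ^ n" for n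
  proof (induction n)
    case 0
    have "y \<in> lat_components y" using y(1) by (simp add: lat_components_def inf_absorb2)
    then show ?case using y(3) by auto
  next
    case (Suc n)
    then obtain z where z: "z \<in> lat_components y" "z \<noteq> 0" "dual_apply f z \<le> dual_apply f y * (1 / 2) ^ n"
      by blast
    obtain w where w: "w \<in> lat_components z" "w \<noteq> 0" "dual_apply f w \<le> dual_apply f z / 2"
      using half[of z] lat_components_bounds[OF z(1)] z(2) y(2) by (auto intro: order_trans)
    have "dual_apply f w \<le> dual_apply f y * (1 / 2) ^ Suc n"
      using w(3) z(3) by simp
    then show ?case using lat_components_trans[OF z(1) w(1)] w(2) by blast
  qed
  have "(\<lambda>n. dual_apply f y * (1 / 2) ^ n) \<longlonglongrightarrow> dual_apply f y * 0"
    by (intro tendsto_mult tendsto_const LIMSEQ_realpow_zero) auto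
  then have "\<forall>\<^sub>F n in sequentially. dual_apply f y * (1 / 2) ^ n < e"
    using e by (intro order_tendstoD(2)) auto
  then obtain n where n: "dual_apply f y * (1 / 2) ^ n < e"
    using eventually_happens trivial_limit_sequentially by blast
  obtain z where "z \<in> lat_components y" "z \<noteq> 0" "dual_apply f z \<le> dual_apply f y * (1 / 2) ^ n"
    using pow[of n] by blast
  with n show ?thesis by (intro that[of z]) auto
qed

text \<open>
  A maximal component on which \<open>f\<close> is at most half of \<open>f y\<close>: if the value were smaller than half, a small
  component of the rest could be added.
\<close>

lemma half_component_exists:
  assumes y: "0 \<le> y" "y \<le> x"
  shows "\<exists>z\<in>lat_components y. dual_apply f z = dual_apply f y / 2"
proof -
  define S where "S = {z \<in> lat_components y. dual_apply f z \<le> dual_apply f y / 2}"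
  have S: "S \<subseteq> {0..\<bar>y\<bar>}"
  proof
    fix z assume "z \<in> S"
    then have "z \<in> lat_components y" by (simp add: S_def)
    from lat_components_bounds[OF this] y(1) show "z \<in> {0..\<bar>y\<bar>}" by simp
  qed
  have "0 \<in> S"
    unfolding S_def lat_components_def using y dual_apply_nonneg[OF f y(1)]
    by (simp add: inf_absorb1 dual_apply_zero_right)
  then have ne: "S \<noteq> {}" by blast
  have cl: "l \<in> S" if "incseq u" "\<And>n. u n \<in> S" "u \<longlonglongrightarrow> l" for u l
  proof -
    have "(\<lambda>n. inf (u n) (y - u n)) \<longlonglongrightarrow> inf l (y - l)"
      by (intro tendsto_inf tendsto_diff tendsto_const that(3))
    moreover have "inf (u n) (y - u n) = 0" for n
      using that(2)[of n] by (simp add: S_def lat_components_def)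
    ultimately have "inf l (y - l) = 0" by (simp add: LIMSEQ_const_iff)
    moreover have "(\<lambda>n. dual_apply f (u n)) \<longlonglongrightarrow> dual_apply f l"
      by (rule bounded_linear.tendsto[OF bounded_linear_dual_apply that(3)])
    then have "dual_apply f l \<le> dual_apply f y / 2"
      using that(2) unfolding S_def by (intro LIMSEQ_le_const2) auto
    ultimately show ?thesis unfolding S_def lat_components_def by simp
  qed
  obtain z where z: "z \<in> S" "\<And>w. w \<in> S \<Longrightarrow> z \<le> w \<Longrightarrow> w = z"
    by (rule maximal_in_order_interval[OF part_below[OF y] S ne cl]) (assumption | rule that)+
  have zc: "z \<in> lat_components y" and zf: "dual_apply f z \<le> dual_apply f y / 2"
    using z(1) by (auto simp: S_def)
  note zb = lat_components_bounds[OF zc]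
  have "\<not> dual_apply f z < dual_apply f y / 2"
  proof
    assume less: "dual_apply f z < dual_apply f y / 2"
    then have "y - z \<noteq> 0" using dual_apply_nonneg[OF f y(1)] by auto
    moreover have "y - z \<le> x" using zb(1) y(2) diff_mono[OF y(2) zb(1)] by simp
    ultimately obtain w where w: "w \<in> lat_components (y - z)" "w \<noteq> 0"
      "dual_apply f w \<le> dual_apply f y / 2 - dual_apply f z"
      using small_component_exists[of "y - z" "dual_apply f y / 2 - dual_apply f z"] zb(2) less by auto
    have "z + w \<in> S"
      unfolding S_def using lat_components_add[OF zc w(1)] w(3) by (simp add: dual_apply_add_right)
    then have "z + w = z" using lat_components_bounds(1)[OF w(1)] by (intro z(2)) auto
    with w(2) show False by simp
  qed
  with zc zf show ?thesis by (intro bexI[of _ z]) auto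
qed

text \<open>
  Any two levels of the dyadic subdivision differ on exactly half of \<open>x\<close>.
\<close>

lemma separated_sequence_exists:
  assumes x0: "0 \<le> x"
  obtains a :: "nat \<Rightarrow> 'a" where "\<And>n. 0 \<le> a n" "\<And>n. a n \<le> x"
    "\<And>m n. m \<noteq> n \<Longrightarrow> dual_apply f \<bar>a m - a n\<bar> = dual_apply f x / 2"
proof -
  obtain h where h: "\<And>y. 0 \<le> y \<Longrightarrow> y \<le> x \<Longrightarrow> h y \<in> lat_components y"
    "\<And>y. 0 \<le> y \<Longrightarrow> y \<le> x \<Longrightarrow> dual_apply f (h y) = dual_apply f y / 2"
    using half_component_exists by metis
  have hb: "0 \<le> h y" "h y \<le> x" "0 \<le> y - h y" "y - h y \<le> x" "h y \<le> y"
    "dual_apply f (y - h y) = dual_apply f y / 2" "inf (h y) (y - h y) = 0" if "0 \<le> y" "y \<le> x" for y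
  proof -
    note hy = h(1)[OF that] and c = lat_components_complement[OF h(1)[OF that]]
    show "0 \<le> h y" "h y \<le> y" by (rule lat_components_bounds[OF hy])+
    show "h y \<le> x" by (rule order_trans[OF lat_components_bounds(2)[OF hy] that(2)])
    show "0 \<le> y - h y" by (rule lat_components_bounds[OF c])
    show "y - h y \<le> x" by (rule order_trans[OF lat_components_bounds(2)[OF c] that(2)])
    show "dual_apply f (y - h y) = dual_apply f y / 2"
      using h(2)[OF that] by (simp add: dual_apply_diff_right)
    show "inf (h y) (y - h y) = 0" using hy by (simp add: lat_components_def)
  qed
  let ?A = "dyadic_half h"
  have A_bounds: "0 \<le> ?A n y \<and> ?A n y \<le> y" if "0 \<le> y" "y \<le> x" for n y
    using that
  proof (induction n arbitrary: y)
    case 0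
    then show ?case using hb by simp
  next
    case (Suc n)
    note b = hb[OF Suc.prems]
    have "?A n (h y) + ?A n (y - h y) \<le> h y + (y - h y)"
      using Suc.IH b by (intro add_mono) auto
    then show ?case using Suc.IH b by (auto intro: add_nonneg_nonneg)
  qed
  have A_half: "dual_apply f (?A n y) = dual_apply f y / 2" if "0 \<le> y" "y \<le> x" for n y
    using that
  proof (induction n arbitrary: y)
    case 0
    then show ?case using h(2) by simp
  next
    case (Suc n)
    note b = hb[OF Suc.prems]
    show ?case
      using Suc.IH[OF b(1,2)] Suc.IH[OF b(3,4)] b(6) h(2)[OF Suc.prems] by (simp add: dual_apply_add_right)
  qed
  have sep: "dual_apply f \<bar>?A m y - ?A n y\<bar> = dual_apply f y / 2" if "m < n" "0 \<le> y" "y \<le> x" for m n y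
    using that
  proof (induction m arbitrary: n y)
    case 0
    then obtain k where k: "n = Suc k" by (cases n) auto
    note b = hb[OF 0(2,3)]
    define p q where "p = h y" and "q = y - h y"
    have pq: "0 \<le> p" "p \<le> x" "0 \<le> q" "q \<le> x" "inf p q = 0" using b by (auto simp: p_def q_def)
    note Ap = A_bounds[OF pq(1,2), of k] and Aq = A_bounds[OF pq(3,4), of k]
    have "inf (p - ?A k p) (?A k q) = 0"
      by (rule inf_eq_0_mono[OF pq(5)]) (use Ap Aq in auto)
    then have "\<bar>(p - ?A k p) - ?A k q\<bar> = (p - ?A k p) + ?A k q"
      by (rule abs_minus_of_disjoint)
    moreover have "?A 0 y - ?A n y = (p - ?A k p) - ?A k q"
      by (simp add: k p_def q_def)
    ultimately have "dual_apply f \<bar>?A 0 y - ?A n y\<bar> = dual_apply f p - dual_apply f p / 2 + dual_apply f q / 2"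
      using A_half[OF pq(1,2), of k] A_half[OF pq(3,4), of k] by (simp add: dual_apply_add_right dual_apply_diff_right)
    then show ?case using b(6) h(2)[OF 0(2,3)] by (simp add: p_def q_def)
  next
    case (Suc m)
    then obtain k where k: "n = Suc k" "m < k" by (cases n) auto
    note b = hb[OF Suc.prems(2,3)]
    define p q where "p = h y" and "q = y - h y"
    have pq: "0 \<le> p" "p \<le> x" "0 \<le> q" "q \<le> x" "inf p q = 0" using b by (auto simp: p_def q_def)
    have abs_le: "\<bar>?A m r - ?A k r\<bar> \<le> r" if "0 \<le> r" "r \<le> x" for r
    proof (rule abs_leI)
      show "?A m r - ?A k r \<le> r"
        using diff_mono[of "?A m r" r 0 "?A k r"] A_bounds[OF that] by simp
      show "- (?A m r - ?A k r) \<le> r"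
        using diff_mono[of "?A k r" r 0 "?A m r"] A_bounds[OF that] by simp
    qed
    have "inf \<bar>?A m p - ?A k p\<bar> \<bar>?A m q - ?A k q\<bar> = 0"
      by (rule inf_eq_0_mono[OF pq(5)]) (use abs_le pq in auto)
    then have "\<bar>(?A m p - ?A k p) + (?A m q - ?A k q)\<bar> = \<bar>?A m p - ?A k p\<bar> + \<bar>?A m q - ?A k q\<bar>"
      by (rule abs_add_of_disjoint)
    moreover have "?A (Suc m) y - ?A n y = (?A m p - ?A k p) + (?A m q - ?A k q)"
      by (simp add: k p_def q_def)
    ultimately have "dual_apply f \<bar>?A (Suc m) y - ?A n y\<bar> = dual_apply f p / 2 + dual_apply f q / 2"
      using Suc.IH[OF k(2) pq(1,2)] Suc.IH[OF k(2) pq(3,4)] by (simp add: dual_apply_add_right)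
    then show ?case using b(6) h(2)[OF Suc.prems(2,3)] by (simp add: p_def q_def)
  qed
  show ?thesis
  proof (rule that[of "\<lambda>n. ?A n x"])
    show "0 \<le> ?A n x" "?A n x \<le> x" for n using A_bounds[OF x0 order_refl] by auto
    show "dual_apply f \<bar>?A m x - ?A n x\<bar> = dual_apply f x / 2" if "m \<noteq> n" for m n
      using sep[of m n x] sep[of n m x] that x0 by (cases "m < n") (auto simp: abs_minus_commute)
  qed
qed

end

text \<open>
  The separated sequence has a weakly Cauchy subsequence, whose differences \<open>d\<close> are weakly null with
  \<open>f \<bar>d i\<bar>\<close> constant. The functionals that attain these values are dominated by the component of \<open>f\<close> on
  \<open>x\<close>. The Hilbert space argument, applied in the dual with evaluation at \<open>x\<close>, provides a weak* Cauchy
  subsequence of them; consecutive differences along a sparse subsequence are weak* null and keep half of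
  the value.
\<close>

theorem biorthogonal_weakly_null:
  assumes "\<not> discrete_ideal (monotone_convergent_part :: 'a::banach_lattice set)"
  obtains x :: "'a::banach_lattice" and f :: "'a::banach_lattice dual"
    and e :: "nat \<Rightarrow> 'a::banach_lattice" and h :: "nat \<Rightarrow> 'a::banach_lattice dual" and \<delta> :: real
  where "x \<in> monotone_convergent_part" "weakly_null e" "\<And>i. \<bar>e i\<bar> \<le> x"
    "\<And>i. \<bar>h i\<bar> \<le> f" "\<And>z. (\<lambda>i. dual_apply (h i) z) \<longlonglongrightarrow> 0"
    "0 < \<delta>" "\<And>i. \<delta> \<le> dual_apply (h i) (e i)"
proof -
  obtain x1 :: 'a where x1: "x1 \<in> monotone_convergent_part" "0 < x1" "\<And>b. discrete_element b \<Longrightarrow> \<not> b \<le> x1"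
    using atomless_if_not_discrete[OF assms] by blast
  obtain x and f :: "'a dual" where x: "0 < x" "x \<le> x1" and f: "0 \<le> f"
    and strict: "\<And>w. 0 \<le> w \<Longrightarrow> w \<le> x \<Longrightarrow> dual_apply f w = 0 \<Longrightarrow> w = 0"
    using strictly_positive_below[OF x1(1,2)] by blast
  have x0: "0 \<le> x" using x(1) by simp
  have xM: "x \<in> monotone_convergent_part"
    using x1(1) by (rule monotone_convergent_part_solid) (use x0 x in auto)
  have atomless: "\<And>b. discrete_element b \<Longrightarrow> \<not> b \<le> x"
    using x1(3) x(2) order_trans by blast
  obtain a :: "nat \<Rightarrow> 'a" where a: "\<And>n. 0 \<le> a n" "\<And>n. a n \<le> x"
    "\<And>m n. m \<noteq> n \<Longrightarrow> dual_apply f \<bar>a m - a n\<bar> = dual_apply f x / 2"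
    using separated_sequence_exists[OF xM atomless f strict x0] by blast
  define \<delta> where "\<delta> = dual_apply f x / 2"
  have "dual_apply f x \<noteq> 0" using strict[OF x0 order_refl] x(1) by auto
  then have \<delta>: "0 < \<delta>" unfolding \<delta>_def using dual_apply_nonneg[OF f x0] by simp
  have "\<bar>a n\<bar> \<le> x" for n using a(1,2) by simp
  then obtain r :: "nat \<Rightarrow> nat" where r: "strict_mono r" "\<And>\<psi> :: 'a dual. Cauchy (\<lambda>n. dual_apply \<psi> (a (r n)))"
    using strictly_positive_weakly_Cauchy_subseq[where g = a and u = x and \<Phi> = f, OF xM x0 f strict] by blast
  define d where "d i = a (r (Suc i)) - a (r i)" for i
  have d_weak: "weakly_null d"
  proof (rule weakly_nullI)
    fix \<psi> :: "'a dual"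
    show "(\<lambda>i. dual_apply \<psi> (d i)) \<longlonglongrightarrow> 0"
      unfolding d_def dual_apply_diff_right
      using Cauchy_subseq_diff_null[OF r(2), of id \<psi>] by (simp add: strict_mono_def)
  qed
  have d_le: "\<bar>d i\<bar> \<le> x" for i
  proof (rule abs_leI)
    show "d i \<le> x" unfolding d_def using diff_mono[OF a(2) a(1)] by simp
    show "- d i \<le> x" unfolding d_def using diff_mono[OF a(2) a(1), of "r i" "r (Suc i)"] by simp
  qed
  define f0 where "f0 = dual_component x f"
  have f0: "0 \<le> f0" unfolding f0_def by (rule dual_component_nonneg[OF x0 f])
  have f0_d: "dual_apply f0 \<bar>d i\<bar> = \<delta>" for i
  proof -
    have "dual_apply f0 \<bar>d i\<bar> = dual_apply f \<bar>d i\<bar>"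
      unfolding f0_def using d_le by (intro dual_component_eq[OF x0 f, where k = 1]) auto
    also have "\<dots> = \<delta>"
      unfolding d_def \<delta>_def using strict_monoD[OF r(1), of i "Suc i"] by (intro a(3)) simp
    finally show ?thesis .
  qed
  have "\<exists>g. \<bar>g\<bar> \<le> f0 \<and> dual_apply g (d i) = dual_apply f0 \<bar>d i\<bar>" for i
    using dual_sign_functional[OF f0, of "d i"] by blast
  then obtain g where g: "\<And>i. \<bar>g i\<bar> \<le> f0" "\<And>i. dual_apply (g i) (d i) = \<delta>"
    unfolding f0_d by metis
  obtain s :: "nat \<Rightarrow> nat" where s: "strict_mono s"
    "\<And>\<psi> :: 'a dual dual. (\<And>h :: nat \<Rightarrow> 'a dual. (\<And>n. \<bar>h n\<bar> \<le> 2 *\<^sub>R f0) \<Longrightarrow>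
        (\<lambda>n. dual_apply (dual_eval x) \<bar>h n\<bar>) \<longlonglongrightarrow> 0 \<Longrightarrow> (\<lambda>n. dual_apply \<psi> (h n)) \<longlonglongrightarrow> 0) \<Longrightarrow>
      Cauchy (\<lambda>n. dual_apply \<psi> (g (s n)))"
    using order_bounded_Cauchy_subseq[where g = g and u = f0 and \<Phi> = "dual_eval x",
        OF dual_eval_nonneg[OF x0] f0 g(1)] by blast
  have g_Cauchy: "Cauchy (\<lambda>n. dual_apply (g (s n)) z)" for z
  proof -
    have "Cauchy (\<lambda>n. dual_apply (dual_eval z) (g (s n)))"
    proof (rule s(2))
      fix h :: "nat \<Rightarrow> 'a dual"
      assume h: "\<And>n. \<bar>h n\<bar> \<le> 2 *\<^sub>R f0" "(\<lambda>n. dual_apply (dual_eval x) \<bar>h n\<bar>) \<longlonglongrightarrow> 0"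
      show "(\<lambda>n. dual_apply (dual_eval z) (h n)) \<longlonglongrightarrow> 0"
      proof (rule tendsto_zero_approx)
        fix e :: real assume e: "0 < e"
        then have e2: "0 < e / 2" by simp
        obtain k where k: "\<And>c g. 0 \<le> g \<Longrightarrow> g \<le> c *\<^sub>R dual_component x f \<Longrightarrow> 0 \<le> c \<Longrightarrow>
            dual_apply g \<bar>z\<bar> \<le> k * dual_apply g x + c * (e / 2)"
          using dual_component_carried[OF x0 f abs_ge_zero e2] by metis
        have "norm (dual_apply (dual_eval z) (h n)) \<le> k * dual_apply (dual_eval x) \<bar>h n\<bar> + e" for n
          using dual_abs_apply_le[OF order_refl[of "\<bar>h n\<bar>"], of z] k[of "\<bar>h n\<bar>" 2] h(1)[of n]
          by (simp add: f0_def)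
        moreover have "(\<lambda>n. k * dual_apply (dual_eval x) \<bar>h n\<bar>) \<longlonglongrightarrow> k * 0"
          by (intro tendsto_mult tendsto_const h(2))
        ultimately show "\<exists>y. y \<longlonglongrightarrow> 0 \<and> (\<forall>n. norm (dual_apply (dual_eval z) (h n)) \<le> y n + e)"
          by (intro exI[of _ "\<lambda>n. k * dual_apply (dual_eval x) \<bar>h n\<bar>"]) simp
      qed
    qed
    then show ?thesis by simp
  qed
  have "(\<lambda>n. dual_apply (g (s i)) (d (s n))) \<longlonglongrightarrow> 0" for i
    using LIMSEQ_subseq_LIMSEQ[OF weakly_null_dual_apply[OF d_weak] s(1)] by (simp add: o_def)
  moreover have "0 < \<delta> / 2" using \<delta> by simp
  ultimately obtain \<sigma> :: "nat \<Rightarrow> nat" where \<sigma>: "strict_mono \<sigma>"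
    "\<And>i. \<bar>dual_apply (g (s (\<sigma> i))) (d (s (\<sigma> (Suc i))))\<bar> \<le> \<delta> / 2"
    by (rule almost_orthogonal_subseq) (rule that)
  show ?thesis
  proof (rule that)
    show "x \<in> monotone_convergent_part" by (rule xM)
    show "weakly_null (\<lambda>i. d (s (\<sigma> (Suc i))))"
    proof (rule weakly_nullI)
      fix \<psi> :: "'a dual"
      have "strict_mono (\<lambda>i. s (\<sigma> (Suc i)))"
        using s(1) \<sigma>(1) by (simp add: strict_mono_def)
      from LIMSEQ_subseq_LIMSEQ[OF weakly_null_dual_apply[OF d_weak] this]
      show "(\<lambda>i. dual_apply \<psi> (d (s (\<sigma> (Suc i))))) \<longlonglongrightarrow> 0" by (simp add: o_def)
    qed
    show "\<bar>d (s (\<sigma> (Suc i)))\<bar> \<le> x" for i by (rule d_le)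
    show "\<bar>g (s (\<sigma> (Suc i))) - g (s (\<sigma> i))\<bar> \<le> f0 + f0" for i
      by (rule order_trans[OF abs_triangle_ineq4 add_mono[OF g(1) g(1)]])
    show "(\<lambda>i. dual_apply (g (s (\<sigma> (Suc i))) - g (s (\<sigma> i))) z) \<longlonglongrightarrow> 0" for z
      unfolding dual_apply_diff by (rule Cauchy_subseq_diff_null[OF g_Cauchy \<sigma>(1)])
    show "0 < \<delta> / 2" using \<delta> by simp
    show "\<delta> / 2 \<le> dual_apply (g (s (\<sigma> (Suc i))) - g (s (\<sigma> i))) (d (s (\<sigma> (Suc i))))" for i
      using \<sigma>(2)[of i] g(2)[of "s (\<sigma> (Suc i))"] unfolding dual_apply_diff by linarith
  qed
qed

section \<open>Operators through a disjoint order bounded sequence\<close>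

lemma disjoint_sequence_if_not_order_continuous:
  assumes "monotone_convergent_part \<noteq> (UNIV :: 'b::banach_lattice set)"
  obtains b :: "'b::banach_lattice" and w :: "nat \<Rightarrow> 'b::banach_lattice" and \<eta> :: real
  where "\<And>n. 0 \<le> w n" "\<And>n. w n \<le> b" "\<And>m n. m \<noteq> n \<Longrightarrow> inf (w m) (w n) = 0"
    "0 < \<eta>" "\<And>n. \<eta> \<le> norm (w n)"
proof -
  obtain y :: 'b where "y \<notin> monotone_convergent_part" using assms by blast
  then obtain z :: "nat \<Rightarrow> 'b" where z: "\<And>n. \<bar>z n\<bar> \<le> \<bar>y\<bar>" "\<And>m n. m \<noteq> n \<Longrightarrow> lat_disjoint (z m) (z n)"
    and not_null: "\<not> (\<lambda>n. norm (z n)) \<longlonglongrightarrow> 0"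
    using mem_monotone_convergent_part_if_disjoint_null[of y] by blast
  obtain \<eta> and r :: "nat \<Rightarrow> nat" where r: "0 < \<eta>" "strict_mono r" "\<And>n. \<eta> \<le> norm (norm (z (r n)))"
    using not_tendsto_zero_subseq[OF not_null] by blast
  show ?thesis
  proof (rule that[of "\<lambda>n. \<bar>z (r n)\<bar>" "\<bar>y\<bar>" \<eta>])
    show "inf \<bar>z (r m)\<bar> \<bar>z (r n)\<bar> = 0" if "m \<noteq> n" for m n
      using z(2)[of "r m" "r n"] that strict_mono_eq[OF r(2), of m n] by (simp add: lat_disjoint_def)
  qed (use z r in auto)
qed

lemma abs_sum_scaleR_le:
  fixes w :: "nat \<Rightarrow> 'b::banach_lattice"
  assumes w: "\<And>n. 0 \<le> w n" "\<And>n. w n \<le> b" "\<And>m n. m \<noteq> n \<Longrightarrow> inf (w m) (w n) = 0"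
    and c: "\<And>k. k \<in> K \<Longrightarrow> \<bar>c k\<bar> \<le> M" "0 \<le> M" and K: "finite K"
  shows "\<bar>\<Sum>k\<in>K. c k *\<^sub>R w k\<bar> \<le> M *\<^sub>R b"
proof -
  have b0: "0 \<le> b" using w(1,2)[of 0] by (rule order_trans)
  have "\<bar>\<Sum>k\<in>K. c k *\<^sub>R w k\<bar> \<le> (\<Sum>k\<in>K. \<bar>c k *\<^sub>R w k\<bar>)" by (rule sum_abs)
  also have "\<dots> \<le> (\<Sum>k\<in>K. M *\<^sub>R w k)"
    using w(1) c by (intro sum_mono) (simp add: lattice_abs_scaleR scaleR_right_mono)
  also have "\<dots> = M *\<^sub>R (\<Sum>k\<in>K. w k)" by (simp add: scaleR_right.sum)
  also have "\<dots> \<le> M *\<^sub>R b"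
    using w K b0 c(2) by (intro scaleR_left_mono sum_le_of_disjoint) (auto simp: pairwise_def)
  finally show ?thesis .
qed

lemma summable_disjoint:
  fixes w :: "nat \<Rightarrow> 'b::banach_lattice"
  assumes w: "\<And>n. 0 \<le> w n" "\<And>n. w n \<le> b" "\<And>m n. m \<noteq> n \<Longrightarrow> inf (w m) (w n) = 0"
    and c: "c \<longlonglongrightarrow> 0"
  shows "summable (\<lambda>n. c n *\<^sub>R w n)"
  unfolding summable_Cauchy
proof (intro allI impI)
  fix e :: real assume e: "0 < e"
  then have "0 < e / 2" by simp
  then obtain d where d: "0 < d" "d * norm b \<le> e / 2"
    by (rule small_factor[OF norm_ge_zero[of b]])
  obtain N where N: "\<And>n. N \<le> n \<Longrightarrow> norm (c n - 0) < d" using LIMSEQ_D[OF c d(1)] by blast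
  have "norm (\<Sum>k\<in>{m..<n}. c k *\<^sub>R w k) < e" if "N \<le> m" for m n
  proof -
    have "\<bar>\<Sum>k\<in>{m..<n}. c k *\<^sub>R w k\<bar> \<le> d *\<^sub>R b"
      using N that d(1) by (intro abs_sum_scaleR_le[OF w]) (auto intro: less_imp_le)
    then have "norm \<bar>\<Sum>k\<in>{m..<n}. c k *\<^sub>R w k\<bar> \<le> norm (d *\<^sub>R b)" by (intro norm_mono_pos) auto
    also have "\<dots> = d * norm b" using d(1) by simp
    finally show ?thesis using d(2) e by simp
  qed
  then show "\<exists>N. \<forall>m\<ge>N. \<forall>n. norm (sum (\<lambda>k. c k *\<^sub>R w k) {m..<n}) < e" by blast
qed

text \<open>
  The other terms of the series are disjoint from the \<open>i\<close>-th one.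
\<close>

lemma abs_suminf_ge_term:
  fixes w :: "nat \<Rightarrow> 'b::banach_lattice"
  assumes w: "\<And>n. 0 \<le> w n" "\<And>m n. m \<noteq> n \<Longrightarrow> inf (w m) (w n) = 0"
    and summ: "summable (\<lambda>n. c n *\<^sub>R w n)"
  shows "\<bar>c i\<bar> *\<^sub>R w i \<le> \<bar>\<Sum>n. c n *\<^sub>R w n\<bar>"
proof (rule lattice_LIMSEQ_le[OF tendsto_const, where N = "Suc i"])
  show "(\<lambda>n. \<bar>\<Sum>k<n. c k *\<^sub>R w k\<bar>) \<longlonglongrightarrow> \<bar>\<Sum>n. c n *\<^sub>R w n\<bar>"
    by (intro tendsto_lattice_abs summable_LIMSEQ summ)
  fix n assume n: "Suc i \<le> n"
  define R where "R = (\<Sum>k\<in>{..<n} - {i}. c k *\<^sub>R w k)"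
  have split: "(\<Sum>k<n. c k *\<^sub>R w k) = c i *\<^sub>R w i + R"
    unfolding R_def using n by (subst sum.remove[of _ i]) auto
  have wi: "0 \<le> \<bar>c i\<bar> *\<^sub>R w i" using w(1) by (intro scaleR_nonneg_nonneg) auto
  have "inf (\<bar>c i\<bar> *\<^sub>R w i) (\<Sum>k\<in>{..<n} - {i}. \<bar>c k\<bar> *\<^sub>R w k) = 0"
  proof (rule inf_sum_eq_0[OF _ wi])
    fix k assume "k \<in> {..<n} - {i}"
    then have "inf (w k) (w i) = 0" using w(2)[of k i] by simp
    then have "inf (w k) (\<bar>c i\<bar> *\<^sub>R w i) = 0" by (rule inf_scaleR_eq_0) simp
    then have "inf (\<bar>c i\<bar> *\<^sub>R w i) (w k) = 0" by (simp add: inf_commute)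
    then show "inf (\<bar>c i\<bar> *\<^sub>R w i) (\<bar>c k\<bar> *\<^sub>R w k) = 0" by (rule inf_scaleR_eq_0) simp
  qed simp
  moreover have R_le: "\<bar>R\<bar> \<le> (\<Sum>k\<in>{..<n} - {i}. \<bar>c k\<bar> *\<^sub>R w k)"
    using sum_abs[of "\<lambda>k. c k *\<^sub>R w k" "{..<n} - {i}"] w(1) by (simp add: R_def lattice_abs_scaleR)
  moreover have ci: "\<bar>c i *\<^sub>R w i\<bar> = \<bar>c i\<bar> *\<^sub>R w i" using w(1) by (simp add: lattice_abs_scaleR)
  ultimately have "inf \<bar>c i *\<^sub>R w i\<bar> \<bar>R\<bar> = 0"
    using wi by - (rule inf_eq_0_mono[of "\<bar>c i\<bar> *\<^sub>R w i" "\<Sum>k\<in>{..<n} - {i}. \<bar>c k\<bar> *\<^sub>R w k"], simp_all)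
  then have "\<bar>c i *\<^sub>R w i + R\<bar> = \<bar>c i\<bar> *\<^sub>R w i + \<bar>R\<bar>" unfolding ci[symmetric] by (rule abs_add_of_disjoint)
  then show "\<bar>c i\<bar> *\<^sub>R w i \<le> \<bar>\<Sum>k<n. c k *\<^sub>R w k\<bar>" unfolding split by simp
qed

text \<open>
  If \<open>g k\<close> lies between \<open>- u\<close> and \<open>u\<close> up to a small error, a tail of the sum is bounded by the same
  tail of the sum of \<open>u (w j)\<close>, which converges because finite sums of the \<open>w j\<close> stay below \<open>b\<close>. The
  remaining finitely many coefficients tend to zero with \<open>k\<close>.
\<close>

lemma L_weakly_compact_dual_coefficients:
  fixes w :: "nat \<Rightarrow> 'b::banach_lattice" and g :: "nat \<Rightarrow> 'b dual"
  assumes w: "\<And>n. 0 \<le> w n" "\<And>n. w n \<le> b" "\<And>m n. m \<noteq> n \<Longrightarrow> inf (w m) (w n) = 0"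
    and g: "weakly_null g" "L_weakly_compact (range g)" and e: "0 < e"
  obtains a where "a \<longlonglongrightarrow> 0" "\<And>k n. (\<Sum>j<n. \<bar>dual_apply (g k) (w j)\<bar>) \<le> a k + e"
proof -
  have b0: "0 \<le> b" using w(1,2)[of 0] by (rule order_trans)
  have w_sum: "(\<Sum>j\<in>K. w j) \<le> b" if "finite K" for K
    using w b0 that by (intro sum_le_of_disjoint) (auto simp: pairwise_def)
  have "0 < e / 2" using e by simp
  then obtain d where d: "0 < d" and db: "d * norm b \<le> e / 2"
    by (rule small_factor[OF norm_ge_zero[of b]])
  obtain u where u: "u \<in> monotone_convergent_part" "0 \<le> u"
    "\<And>f. f \<in> range g \<Longrightarrow> norm (pprt (\<bar>f\<bar> - u)) \<le> d"
    by (rule L_weakly_compact_almost_order_bounded[OF g(2) d]) (rule that)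
  have "summable (\<lambda>j. dual_apply u (w j))"
  proof (rule summableI_nonneg_bounded[where x = "dual_apply u b"])
    show "0 \<le> dual_apply u (w n)" for n by (intro dual_apply_nonneg u w)
    show "(\<Sum>j<n. dual_apply u (w j)) \<le> dual_apply u b" for n
      using dual_apply_mono_right[OF u(2) w_sum[of "{..<n}"]] by (simp add: dual_apply_sum_right)
  qed
  then obtain J where J: "\<And>m n. J \<le> m \<Longrightarrow> norm (\<Sum>j\<in>{m..<n}. dual_apply u (w j)) < e / 2"
    using e unfolding summable_Cauchy by (meson half_gt_zero)
  define a where "a k = (\<Sum>j<J. \<bar>dual_apply (g k) (w j)\<bar>)" for k
  show ?thesis
  proof (rule that)
    have "(\<lambda>k. \<bar>dual_apply (g k) (w j)\<bar>) \<longlonglongrightarrow> 0" for j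
      using weakly_null_dual_apply[OF g(1), of "dual_eval (w j)"] by (simp add: tendsto_rabs_zero)
    then have "a \<longlonglongrightarrow> (\<Sum>j<J. 0)" unfolding a_def by (intro tendsto_sum)
    then show "a \<longlonglongrightarrow> 0" by simp
    fix k n
    define p where "p = pprt (\<bar>g k\<bar> - u)"
    have p0: "0 \<le> p" by (simp add: p_def)
    have gw: "\<bar>dual_apply (g k) (w j)\<bar> \<le> dual_apply u (w j) + dual_apply p (w j)" for j
    proof -
      have "\<bar>g k\<bar> \<le> u + p" unfolding p_def by (rule le_add_pprt_minus)
      from dual_abs_apply_le[OF this, of "w j"] show ?thesis
        using w(1)[of j] by (simp add: dual_apply_add)
    qed
    have "(\<Sum>j<n. \<bar>dual_apply (g k) (w j)\<bar>) \<le> (\<Sum>j\<in>{..<J} \<union> {J..<n}. \<bar>dual_apply (g k) (w j)\<bar>)"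
      by (intro sum_mono2) auto
    also have "\<dots> = a k + (\<Sum>j\<in>{J..<n}. \<bar>dual_apply (g k) (w j)\<bar>)"
      unfolding a_def by (rule sum.union_disjoint) auto
    also have "(\<Sum>j\<in>{J..<n}. \<bar>dual_apply (g k) (w j)\<bar>)
        \<le> (\<Sum>j\<in>{J..<n}. dual_apply u (w j)) + (\<Sum>j\<in>{J..<n}. dual_apply p (w j))"
      unfolding sum.distrib[symmetric] by (intro sum_mono gw)
    also have "(\<Sum>j\<in>{J..<n}. dual_apply u (w j)) \<le> e / 2"
      using J[OF order_refl, of n] by simp
    also have "(\<Sum>j\<in>{J..<n}. dual_apply p (w j)) \<le> e / 2"
    proof -
      have "(\<Sum>j\<in>{J..<n}. dual_apply p (w j)) \<le> dual_apply p b"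
        using dual_apply_mono_right[OF p0 w_sum[of "{J..<n}"]] by (simp add: dual_apply_sum_right)
      also have "\<dots> \<le> norm p * norm b" using norm_dual_apply[of p b] by linarith
      also have "\<dots> \<le> d * norm b" unfolding p_def by (intro mult_right_mono u(3)) auto
      finally show ?thesis using db by linarith
    qed
    finally show "(\<Sum>j<n. \<bar>dual_apply (g k) (w j)\<bar>) \<le> a k + e" by simp
  qed
qed

text \<open>
  By disjointness \<open>\<bar>T (e i)\<bar>\<close> dominates \<open>h i (e i) *\<^sub>R w i\<close>, whose norm is bounded away from zero. The adjoint sends
  \<open>g\<close> to the sum of all \<open>g (w i) *\<^sub>R h i\<close>, and the \<open>h i\<close> are bounded.
\<close>

theorem non_Lwcc_operator_exists:
  assumes E: "\<not> discrete_ideal (monotone_convergent_part :: 'a::banach_lattice set)"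
    and F: "monotone_convergent_part \<noteq> (UNIV :: 'b::banach_lattice set)"
  obtains T :: "'a::banach_lattice \<Rightarrow>\<^sub>L 'b::banach_lattice"
  where "regular_operator T" "Lwcc (dual_operator T)" "\<not> Lwcc T"
proof -
  obtain x :: 'a and f :: "'a dual" and e :: "nat \<Rightarrow> 'a" and h :: "nat \<Rightarrow> 'a dual" and \<delta> where x: "x \<in> monotone_convergent_part"
    and e: "weakly_null e" "\<And>i. \<bar>e i\<bar> \<le> x"
    and h: "\<And>i. \<bar>h i\<bar> \<le> f" "\<And>z. (\<lambda>i. dual_apply (h i) z) \<longlonglongrightarrow> 0"
    and \<delta>: "0 < \<delta>" "\<And>i. \<delta> \<le> dual_apply (h i) (e i)"
    by (rule biorthogonal_weakly_null[OF E]) (rule that)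
  obtain b :: 'b and w :: "nat \<Rightarrow> 'b" and \<eta> where w: "\<And>n. 0 \<le> w n" "\<And>n. w n \<le> b" "\<And>m n. m \<noteq> n \<Longrightarrow> inf (w m) (w n) = 0"
    and \<eta>: "0 < \<eta>" "\<And>n. \<eta> \<le> norm (w n)"
    by (rule disjoint_sequence_if_not_order_continuous[OF F]) (rule that)
  have f0: "0 \<le> f" using order_trans[OF abs_ge_zero h(1)[of 0]] .
  have b0: "0 \<le> b" using w(1,2)[of 0] by (rule order_trans)
  have hz: "\<bar>dual_apply (h i) z\<bar> \<le> dual_apply f \<bar>z\<bar>" for i z by (rule dual_abs_apply_le[OF h(1)])
  have fz0: "0 \<le> dual_apply f \<bar>z\<bar>" for z by (intro dual_apply_nonneg f0) simp
  have fz: "dual_apply f \<bar>z\<bar> \<le> norm f * norm z" for z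
    using norm_dual_apply[of f "\<bar>z\<bar>"] by simp
  define t where "t z = (\<Sum>n. dual_apply (h n) z *\<^sub>R w n)" for z
  have summ: "summable (\<lambda>n. dual_apply (h n) z *\<^sub>R w n)" for z
    by (rule summable_disjoint[OF w h(2)])
  have t_lim: "(\<lambda>n. \<Sum>k<n. dual_apply (h k) z *\<^sub>R w k) \<longlonglongrightarrow> t z" for z
    unfolding t_def by (rule summable_LIMSEQ[OF summ])
  have t_le: "\<bar>t z\<bar> \<le> dual_apply f \<bar>z\<bar> *\<^sub>R b" for z
  proof (rule lattice_LIMSEQ_le[OF tendsto_lattice_abs[OF t_lim] tendsto_const, where N = 0])
    show "\<bar>\<Sum>k<n. dual_apply (h k) z *\<^sub>R w k\<bar> \<le> dual_apply f \<bar>z\<bar> *\<^sub>R b" for n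
      by (rule abs_sum_scaleR_le[OF w hz fz0]) auto
  qed
  have "bounded_linear t"
  proof (rule bounded_linear_intro[where K = "norm f * norm b"])
    show "t (y + z) = t y + t z" for y z
      unfolding t_def suminf_add[OF summ summ] by (simp add: dual_apply_add_right scaleR_left_distrib)
    show "t (r *\<^sub>R z) = r *\<^sub>R t z" for r z
      unfolding t_def suminf_scaleR_right[OF summ] by (simp add: dual_apply_scaleR_right)
    fix z
    have "norm \<bar>t z\<bar> \<le> norm (dual_apply f \<bar>z\<bar> *\<^sub>R b)" by (intro norm_mono_pos t_le) simp
    also have "\<dots> = dual_apply f \<bar>z\<bar> * norm b" using fz0[of z] by simp
    also have "\<dots> \<le> (norm f * norm z) * norm b" by (intro mult_right_mono fz) auto
    finally show "norm (t z) \<le> norm z * (norm f * norm b)" by (simp add: mult_ac)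
  qed
  then have T: "blinfun_apply (Blinfun t) z = t z" for z by (simp add: bounded_linear_Blinfun_apply)
  \<comment> \<open>The operator of rank one that dominates \<open>t\<close>.\<close>
  define P where "P = Blinfun (\<lambda>z. dual_apply f z *\<^sub>R b)"
  have P: "blinfun_apply P z = dual_apply f z *\<^sub>R b" for z
    unfolding P_def
    by (rule bounded_linear_Blinfun_apply[THEN fun_cong])
       (rule bounded_linear_scaleR_const[OF bounded_linear_dual_apply])
  show ?thesis
  proof (rule that[of "Blinfun t"])
    have "positive_operator P"
      unfolding positive_operator_def P by (auto intro: scaleR_nonneg_nonneg dual_apply_nonneg f0 b0)
    moreover have "positive_operator (P - Blinfun t)"
      unfolding positive_operator_def
    proof (intro allI impI)
      fix z :: 'a assume z: "0 \<le> z"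
      have "t z \<le> \<bar>t z\<bar>" by (rule abs_ge_self)
      also have "\<dots> \<le> dual_apply f z *\<^sub>R b" using t_le[of z] z by simp
      finally show "0 \<le> blinfun_apply (P - Blinfun t) z" by (simp add: blinfun.diff_left P T)
    qed
    ultimately show "regular_operator (Blinfun t)"
      unfolding regular_operator_def by (intro exI[of _ P] exI[of _ "P - Blinfun t"]) simp
  next
    show "\<not> Lwcc (Blinfun t)"
    proof
      assume "Lwcc (Blinfun t)"
      moreover have "L_weakly_compact (range e)"
        by (rule L_weakly_compact_order_bounded[OF x]) (use e(2) in \<open>auto intro: order_trans abs_ge_self\<close>)
      ultimately have lim: "(\<lambda>i. norm (t (e i))) \<longlonglongrightarrow> 0"
        using e(1) unfolding Lwcc_def T by blast
      have "\<delta> * \<eta> \<le> norm (t (e i))" for i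
      proof -
        have "\<bar>dual_apply (h i) (e i)\<bar> *\<^sub>R w i \<le> \<bar>t (e i)\<bar>"
          unfolding t_def by (rule abs_suminf_ge_term[OF w(1,3) summ])
        then have "norm (\<bar>dual_apply (h i) (e i)\<bar> *\<^sub>R w i) \<le> norm \<bar>t (e i)\<bar>"
          using w(1) by (intro norm_mono_pos scaleR_nonneg_nonneg) auto
        then have "\<bar>dual_apply (h i) (e i)\<bar> * norm (w i) \<le> norm (t (e i))" by simp
        moreover have "\<delta> * \<eta> \<le> \<bar>dual_apply (h i) (e i)\<bar> * norm (w i)"
          using \<delta>(1) \<eta>(1) \<delta>(2)[of i] \<eta>(2)[of i] by (intro mult_mono) auto
        ultimately show ?thesis by linarith
      qed
      then have "\<delta> * \<eta> \<le> 0" using LIMSEQ_le_const[OF lim] by blast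
      with mult_pos_pos[OF \<delta>(1) \<eta>(1)] show False by simp
    qed
  next
    show "Lwcc (dual_operator (Blinfun t))"
    proof (rule LwccI)
      fix g :: "nat \<Rightarrow> 'b dual"
      assume g: "weakly_null g" "L_weakly_compact (range g)"
      show "(\<lambda>k. blinfun_apply (dual_operator (Blinfun t)) (g k)) \<longlonglongrightarrow> 0"
      proof (rule tendsto_zero_approx)
        fix e :: real assume e: "0 < e"
        obtain d where d: "0 < d" and fd: "d * norm f \<le> e"
          by (rule small_factor[OF norm_ge_zero e])
        obtain a where a: "a \<longlonglongrightarrow> 0" "\<And>k n. (\<Sum>j<n. \<bar>dual_apply (g k) (w j)\<bar>) \<le> a k + d"
          by (rule L_weakly_compact_dual_coefficients[where w = w and b = b, OF w g d]) (assumption | rule that)+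
        have ad: "0 \<le> a k + d" for k using a(2)[where n = 0] by simp
        have bound: "norm (blinfun_apply (dual_operator (Blinfun t)) (g k)) \<le> norm f * (a k + d)" for k
        proof (rule norm_dual_bound)
          show "0 \<le> norm f * (a k + d)" using ad by simp
          fix z :: 'a
          have "\<bar>dual_apply (g k) (\<Sum>j<n. dual_apply (h j) z *\<^sub>R w j)\<bar> \<le> norm f * norm z * (a k + d)" for n
          proof -
            have "\<bar>dual_apply (g k) (\<Sum>j<n. dual_apply (h j) z *\<^sub>R w j)\<bar>
                \<le> (\<Sum>j<n. \<bar>dual_apply (h j) z * dual_apply (g k) (w j)\<bar>)"
              unfolding dual_apply_sum_right dual_apply_scaleR_right by (rule sum_abs)
            also have "\<dots> \<le> (\<Sum>j<n. norm f * norm z * \<bar>dual_apply (g k) (w j)\<bar>)"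
              unfolding abs_mult by (intro sum_mono mult_right_mono order_trans[OF hz fz]) auto
            also have "\<dots> = norm f * norm z * (\<Sum>j<n. \<bar>dual_apply (g k) (w j)\<bar>)"
              by (rule sum_distrib_left[symmetric])
            also have "\<dots> \<le> norm f * norm z * (a k + d)"
              by (intro mult_left_mono a(2)) auto
            finally show ?thesis .
          qed
          moreover have "(\<lambda>n. \<bar>dual_apply (g k) (\<Sum>j<n. dual_apply (h j) z *\<^sub>R w j)\<bar>) \<longlonglongrightarrow> \<bar>dual_apply (g k) (t z)\<bar>"
            by (intro tendsto_rabs bounded_linear.tendsto[OF bounded_linear_dual_apply] t_lim)
          ultimately have "\<bar>dual_apply (g k) (t z)\<bar> \<le> norm f * norm z * (a k + d)"
            by (intro LIMSEQ_le_const2) auto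
          then show "\<bar>dual_apply (blinfun_apply (dual_operator (Blinfun t)) (g k)) z\<bar> \<le> norm f * (a k + d) * norm z"
            by (simp add: dual_operator_apply T mult_ac)
        qed
        have "norm (blinfun_apply (dual_operator (Blinfun t)) (g k)) \<le> norm f * a k + e" for k
          using bound[of k] fd by (simp add: distrib_left mult.commute)
        moreover have "(\<lambda>k. norm f * a k) \<longlonglongrightarrow> norm f * 0"
          by (intro tendsto_mult tendsto_const a(1))
        ultimately show "\<exists>y. y \<longlonglongrightarrow> 0 \<and>
            (\<forall>k. norm (blinfun_apply (dual_operator (Blinfun t)) (g k)) \<le> y k + e)"
          by (intro exI[of _ "\<lambda>k. norm f * a k"]) simp
      qed
    qed
  qed
qed

theorem theorem1p1:
  assumes "order_continuous_norm_on (UNIV :: 'b::banach_lattice dual set)"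
  shows "(\<forall>T :: 'a::banach_lattice \<Rightarrow>\<^sub>L 'b.
            regular_operator T \<and> Lwcc (dual_operator T) \<longrightarrow> Lwcc T) \<longleftrightarrow>
         order_continuous_norm_on (UNIV :: 'b set) \<or>
         discrete_ideal (order_continuous_part :: 'a set)"
proof
  assume all: "\<forall>T :: 'a \<Rightarrow>\<^sub>L 'b. regular_operator T \<and> Lwcc (dual_operator T) \<longrightarrow> Lwcc T"
  show "order_continuous_norm_on (UNIV :: 'b set) \<or> discrete_ideal (order_continuous_part :: 'a set)"
  proof (rule ccontr)
    assume "\<not> ?thesis"
    then have "\<not> discrete_ideal (monotone_convergent_part :: 'a set)"
      "monotone_convergent_part \<noteq> (UNIV :: 'b set)"
      by (simp_all add: order_continuous_part_eq order_continuous_norm_on_UNIV_iff)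
    then obtain T :: "'a \<Rightarrow>\<^sub>L 'b" where "regular_operator T" "Lwcc (dual_operator T)" "\<not> Lwcc T"
      by (rule non_Lwcc_operator_exists)
    with all show False by blast
  qed
next
  assume "order_continuous_norm_on (UNIV :: 'b set) \<or> discrete_ideal (order_continuous_part :: 'a set)"
  then show "\<forall>T :: 'a \<Rightarrow>\<^sub>L 'b. regular_operator T \<and> Lwcc (dual_operator T) \<longrightarrow> Lwcc T"
  proof
    assume "order_continuous_norm_on (UNIV :: 'b set)"
    then show ?thesis
      using assms Lwcc_if_codomain_order_continuous by (auto simp: order_continuous_norm_on_UNIV_iff)
  next
    assume "discrete_ideal (order_continuous_part :: 'a set)"
    then have disc: "discrete_ideal (monotone_convergent_part :: 'a set)"
      by (simp add: order_continuous_part_eq)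
    have "Lwcc T" for T :: "'a \<Rightarrow>\<^sub>L 'b"
    proof (rule LwccI)
      fix x :: "nat \<Rightarrow> 'a"
      assume "weakly_null x" "L_weakly_compact (range x)"
      then have "x \<longlonglongrightarrow> 0" by (rule weakly_null_norm_null_if_discrete[OF disc])
      from bounded_linear.tendsto[OF blinfun.bounded_linear_right this, of T]
      show "(\<lambda>n. blinfun_apply T (x n)) \<longlonglongrightarrow> 0" by (simp add: blinfun.zero_right)
    qed
    then show ?thesis by blast
  qed
qed

end
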